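(* Consider triplets $(\mathbf{C},\mathbf{P},\boldsymbol{\varepsilon}_0^\sigma)\in\mathbb{V}:=\mathbb{E}\mathrm{la}\oplus\mathbb{P}\mathrm{iez}\oplus\mathbb{S}^2(\mathbb{R}^2)$ (2D elasticity, piezoelectricity and dielectric permittivity tensors), written $(\lambda_1,\lambda_2,\lambda_3,z_{1a},z_{1b},z_{2a},z_{2b},z_3,z_4)$ in a fixed explicit harmonic decomposition $\mathbb{V}\simeq3\mathbb{H}^0(\mathbb{R}^2)\oplus2\mathbb{H}^1(\mathbb{R}^2)\oplus2\mathbb{H}^2(\mathbb{R}^2)\oplus\mathbb{H}^3(\mathbb{R}^2)\oplus\mathbb{H}^4(\mathbb{R}^2)$. Let $\mathcal{L}$ be the following list of $98$ monomials: order 0: $z_{1a}\overline{z}_{1b}$, $z_{2a}\overline{z}_{2b}$; $z_{1a}^2\overline{z}_{2a}$, $z_{1a}^2\overline{z}_{2b}$, $z_{1b}^2\overline{z}_{2a}$, $z_{1b}^2\overline{z}_{2b}$, $z_{2a}^2\overline{z}_4$, $z_{2b}^2\overline{z}_4$, $z_{1a}z_{1b}\overline{z}_{2a}$, $z_{1a}z_{1b}\overline{z}_{2b}$, $z_{1a}z_{2a}\overline{z}_3$, $z_{1b}z_{2a}\overline{z}_3$, $z_{1b}z_{2b}\overline{z}_3$, $z_{1a}z_{2b}\overline{z}_3$, $z_{2a}z_{2b}\overline{z}_4$, $z_{1a}z_3\overline{z}_4$, $z_{1b}z_3\overline{z}_4$; $z_{1a}^3\overline{z}_3$, $z_{1a}^2z_{1b}\overline{z}_3$,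 $z_{1a}z_{1b}^2\overline{z}_3$, $z_{1b}^3\overline{z}_3$, $z_{1a}\overline{z}_{2a}^2z_3$, $z_{1b}\overline{z}_{2a}^2z_3$, $z_{1a}\overline{z}_{2a}\overline{z}_{2b}z_3$, $z_{1b}\overline{z}_{2a}\overline{z}_{2b}z_3$, $z_{1a}\overline{z}_{2b}^2z_3$, $z_{1b}\overline{z}_{2b}^2z_3$, $z_{1a}^2z_{2a}\overline{z}_4$, $z_{1a}z_{1b}z_{2a}\overline{z}_4$, $z_{1b}^2z_{2a}\overline{z}_4$, $z_{1a}^2z_{2b}\overline{z}_4$, $z_{1a}z_{1b}z_{2b}\overline{z}_4$, $z_{1b}^2z_{2b}\overline{z}_4$, $z_{1a}\overline{z}_{2a}\overline{z}_3z_4$, $z_{1b}\overline{z}_{2a}\overline{z}_3z_4$, $z_{1a}\overline{z}_{2b}\overline{z}_3z_4$, $z_{1b}\overline{z}_{2b}\overline{z}_3z_4$, $z_{2a}\overline{z}_3^2z_4$, $z_{2b}\overline{z}_3^2z_4$; $z_{2a}^3\overline{z}_3^2$, $z_{2a}^2z_{2b}\overline{z}_3^2$, $z_{2a}z_{2b}^2\overline{z}_3^2$, $z_{2b}^3\overline{z}_3^2$, $z_{1a}^4\overline{z}_4$, $z_{1a}^3z_{1b}\overline{z}_4$, $z_{1a}^2z_{1b}^2\overline{z}_4$, $z_{1a}z_{1b}^3\overline{z}_4$, $z_{1b}^4\overline{z}_4$, $z_{2a}z_3^2\overline{z}_4^2$, $z_{2b}z_3^2\overline{z}_4^2$, $z_{1a}^2\overline{z}_3^2z_4$,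 $z_{1a}z_{1b}\overline{z}_3^2z_4$, $z_{1b}^2\overline{z}_3^2z_4$; $z_{1a}\overline{z}_3^3z_4^2$, $z_{1b}\overline{z}_3^3z_4^2$; $z_3^4\overline{z}_4^3$; order 1: $\overline{z}_{1a}z$, $\overline{z}_{1b}z$; $z_{1a}\overline{z}_{2a}z$, $z_{1b}\overline{z}_{2a}z$, $z_{1a}\overline{z}_{2b}z$, $z_{1b}\overline{z}_{2b}z$, $z_{2a}\overline{z}_3z$, $z_{2b}\overline{z}_3z$, $z_3\overline{z}_4z$; $z_{1a}^2\overline{z}_3z$, $\overline{z}_{2b}^2z_3z$, $z_{1b}^2\overline{z}_3z$, $\overline{z}_{2a}^2z_3z$, $\overline{z}_{2a}\overline{z}_{2b}z_3z$, $z_{1a}z_{1b}\overline{z}_3z$, $\overline{z}_{2a}\overline{z}_3z_4z$, $\overline{z}_{2b}\overline{z}_3z_4z$, $z_{1a}z_{2a}\overline{z}_4z$, $z_{1b}z_{2a}\overline{z}_4z$, $z_{1a}z_{2b}\overline{z}_4z$, $z_{1b}z_{2b}\overline{z}_4z$; $z_{1a}^3\overline{z}_4z$, $z_{1b}^3\overline{z}_4z$, $z_{1a}\overline{z}_3^2z_4z$, $z_{1b}\overline{z}_3^2z_4z$, $z_{1a}^2z_{1b}\overline{z}_4z$, $z_{1a}z_{1b}^2\overline{z}_4z$; $\overline{z}_3^3z_4^2z$; order 2: $\overline{z}_{2a}z^2$, $\overline{z}_{2b}z^2$, $z_{1a}\overline{z}_3z^2$, $z_{1b}\overline{z}_3z^2$,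 $z_{2a}\overline{z}_4z^2$, $z_{2b}\overline{z}_4z^2$, $z_{1a}^2\overline{z}_4z^2$, $z_{1b}^2\overline{z}_4z^2$, $\overline{z}_3^2z_4z^2$, $z_{1a}z_{1b}\overline{z}_4z^2$; order 3: $\overline{z}_3z^3$, $z_{1a}\overline{z}_4z^3$, $z_{1b}\overline{z}_4z^3$; order 4: $\overline{z}_4z^4$. Then: (1) a minimal integrity basis for $\mathrm{Cov}(\mathbb{V},\mathrm{SO}(2))$ consists of the $206$ covariants ($121$ of them invariants): $\lambda_1,\lambda_2,\lambda_3$, $z_{1a}\overline{z}_{1a}$, $z_{1b}\overline{z}_{1b}$, $z_{2a}\overline{z}_{2a}$, $z_{2b}\overline{z}_{2b}$, $z_3\overline{z}_3$, $z_4\overline{z}_4$, $z\overline{z}$, and $\mathrm{Re}(\mathbf{m})$, $\mathrm{Im}(\mathbf{m})$ for $\mathbf{m}\in\mathcal{L}$; (2) a minimal integrity basis for $\mathrm{Cov}(\mathbb{V},\mathrm{O}(2))$ consists of the $123$ covariants ($71$ of them invariants): $\lambda_1,\lambda_2,\lambda_3$, $z_{1a}\overline{z}_{1a}$, $z_{1b}\overline{z}_{1b}$, $z_{2a}\overline{z}_{2a}$, $z_{2b}\overline{z}_{2b}$, $z_3\overline{z}_3$, $z_4\overline{z}_4$, $z\overline{z}$, $\mathrm{Re}(\mathbf{m})$ for $\mathbf{m}\in\mathcal{L}$, and the fifteen products $\mathrm{Im}(z_{1a}\overline{z}_{1b})\mathrm{Im}(z_{2a}\overline{z}_{2b})$,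 $\mathrm{Im}(z_{1a}\overline{z}_{1b})\mathrm{Im}(z_{2a}^2\overline{z}_4)$, $\mathrm{Im}(z_{1a}\overline{z}_{1b})\mathrm{Im}(z_{2b}^2\overline{z}_4)$, $\mathrm{Im}(z_{1a}\overline{z}_{1b})\mathrm{Im}(z_{2a}z_{2b}\overline{z}_4)$, $\mathrm{Im}(z_{2a}\overline{z}_{2b})\mathrm{Im}(z_{1a}z_3\overline{z}_4)$, $\mathrm{Im}(z_{2a}\overline{z}_{2b})\mathrm{Im}(z_{1b}z_3\overline{z}_4)$, $\mathrm{Im}(z_{2a}\overline{z}_{2b})\mathrm{Im}(\overline{z}_{1a}z)$, $\mathrm{Im}(z_{2a}\overline{z}_{2b})\mathrm{Im}(\overline{z}_{1b}z)$, $\mathrm{Im}(z_{2a}^2\overline{z}_4)\mathrm{Im}(\overline{z}_{1a}z)$, $\mathrm{Im}(z_{2a}^2\overline{z}_4)\mathrm{Im}(\overline{z}_{1b}z)$, $\mathrm{Im}(z_{2b}^2\overline{z}_4)\mathrm{Im}(\overline{z}_{1a}z)$, $\mathrm{Im}(z_{2b}^2\overline{z}_4)\mathrm{Im}(\overline{z}_{1b}z)$, $\mathrm{Im}(z_{2a}z_{2b}\overline{z}_4)\mathrm{Im}(\overline{z}_{1a}z)$, $\mathrm{Im}(z_{2a}z_{2b}\overline{z}_4)\mathrm{Im}(\overline{z}_{1b}z)$, $\mathrm{Im}(z_{2a}\overline{z}_{2b})\mathrm{Im}(z_3\overline{z}_4z)$.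
   Context: $\mathbb{E}\mathrm{la}$: fourth-order tensors on $\mathbb{R}^2$ with $C_{ijkl}=C_{jikl}=C_{ijlk}=C_{klij}$. $\mathbb{P}\mathrm{iez}$: third-order tensors with $P_{ijk}=P_{ikj}$. $\mathbb{S}^2(\mathbb{R}^2)$: symmetric second-order tensors. All carry the standard tensorial action of $\mathrm{O}(2)$, generated by rotations $r_\theta$ and $\sigma=\mathrm{diag}(1,-1)$. $\mathbb{H}^0=\mathbb{R}$ is the trivial representation (coordinates $\lambda_k$); for $n\ge1$, $\mathbb{H}^n(\mathbb{R}^2)$ is the two-dimensional irreducible representation where $r_\theta$ acts as rotation of angle $n\theta$ and $\sigma$ as $\mathrm{diag}(1,-1)$. An explicit harmonic decomposition is a choice of $\mathrm{O}(2)$-equivariant linear isomorphism with the indicated direct sum; a component $(a,b)$ in a factor $\mathbb{H}^n$ is encoded by a complex coordinate $z_{n\ast}=a+ib$ (letters label multiplicities), so $r_\theta$ acts by $z_{n\ast}\mapsto e^{in\theta}z_{n\ast}$ and $\sigma$ by conjugation. $\mathrm{Inv}(\mathbb{V},G)$ is the algebra of $G$-invariant real polynomials on $\mathbb{V}$; $\mathrm{Cov}(\mathbb{V},G):=\mathrm{Inv}(\mathbb{V}\oplus\mathbb{R}^2,G)$, $G$ acting on $\mathbb{R}^2\ni\mathbf{x}=(x,y)$ in the standard way; $z=x+iy$. The order of a covariant is its degree in $\mathbf{x}$; invariants are covariants of order $0$. An integrity basis is a finite set of homogeneous generators of the algebra; it is minimal if no proper subset generates. *)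

theory Defs
  imports "HOL-Analysis.Analysis"
begin

subsection \<open>Polynomial invariants on a subspace\<close>

text \<open>
  A polynomial on a linear subspace \<open>W\<close> is represented by its values on \<open>W\<close>; outside \<open>W\<close>
  the function is \<open>undefined\<close> (see \<open>restrict\<close>). Hence equality of such functions is
  equality of polynomials on \<open>W\<close>.
\<close>

definition polynomials_on :: "'a::real_normed_vector set \<Rightarrow> ('a \<Rightarrow> real) set" where
  "polynomials_on W = (\<lambda>p. restrict p W) ` {p. real_polynomial_function p}"

definition Inv :: "('g \<Rightarrow> 'a \<Rightarrow> 'a) \<Rightarrow> 'a::real_normed_vector set \<Rightarrow> 'g set \<Rightarrow> ('a \<Rightarrow> real) set" where
  "Inv act W G = {f \<in> polynomials_on W. \<forall>g\<in>G. \<forall>x\<in>W. f (act g x) = f x}"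

inductive_set generated_algebra ::
    "'a::real_normed_vector set \<Rightarrow> ('a \<Rightarrow> real) set \<Rightarrow> ('a \<Rightarrow> real) set"
  for W :: "'a set" and S :: "('a \<Rightarrow> real) set" where
  const: "restrict (\<lambda>_. c) W \<in> generated_algebra W S"
| gen: "f \<in> S \<Longrightarrow> f \<in> generated_algebra W S"
| add: "f \<in> generated_algebra W S \<Longrightarrow> g \<in> generated_algebra W S \<Longrightarrow>
    restrict (\<lambda>x. f x + g x) W \<in> generated_algebra W S"
| mult: "f \<in> generated_algebra W S \<Longrightarrow> g \<in> generated_algebra W S \<Longrightarrow>
    restrict (\<lambda>x. f x * g x) W \<in> generated_algebra W S"

definition homogeneous_on :: "'a::real_normed_vector set \<Rightarrow> ('a \<Rightarrow> real) \<Rightarrow> bool" where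
  "homogeneous_on W f \<longleftrightarrow> (\<exists>d. \<forall>x\<in>W. \<forall>t. f (t *\<^sub>R x) = t ^ d * f x)"

definition integrity_basis ::
    "'a::real_normed_vector set \<Rightarrow> ('a \<Rightarrow> real) set \<Rightarrow> ('a \<Rightarrow> real) set \<Rightarrow> bool" where
  "integrity_basis W A S \<longleftrightarrow>
     finite S \<and> S \<subseteq> A \<and> (\<forall>f\<in>S. homogeneous_on W f) \<and> generated_algebra W S = A"

definition minimal_integrity_basis ::
    "'a::real_normed_vector set \<Rightarrow> ('a \<Rightarrow> real) set \<Rightarrow> ('a \<Rightarrow> real) set \<Rightarrow> bool" where
  "minimal_integrity_basis W A S \<longleftrightarrow>
     integrity_basis W A S \<and> (\<forall>T. T \<subset> S \<longrightarrow> generated_algebra W T \<noteq> A)"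

text \<open>Covariants of \<open>V\<close> are the invariants of \<open>V \<oplus> \<real>\<^sup>2\<close>.\<close>

definition Cov :: "(real^2^2 \<Rightarrow> 'a \<Rightarrow> 'a) \<Rightarrow> 'a::real_normed_vector set \<Rightarrow> (real^2^2) set \<Rightarrow>
    ('a \<times> (real^2) \<Rightarrow> real) set" where
  "Cov act V G = Inv (\<lambda>g (v, x). (act g v, g *v x)) (V \<times> UNIV) G"

definition has_order :: "'a::real_normed_vector set \<Rightarrow> nat \<Rightarrow> ('a \<times> (real^2) \<Rightarrow> real) \<Rightarrow> bool" where
  "has_order V k f \<longleftrightarrow> (\<forall>v\<in>V. \<forall>x. \<forall>t. f (v, t *\<^sub>R x) = t ^ k * f (v, x))"


subsection \<open>The groups $\mathrm{O}(2)$ and $\mathrm{SO}(2)$\<close>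

definition O2 :: "(real^2^2) set" where
  "O2 = {g. orthogonal_matrix g}"

definition SO2 :: "(real^2^2) set" where
  "SO2 = {g. orthogonal_matrix g \<and> det g = 1}"

definition rot :: "real \<Rightarrow> real^2^2" where
  "rot \<theta> = vector [vector [cos \<theta>, - sin \<theta>], vector [sin \<theta>, cos \<theta>]]"

definition refl2 :: "real^2^2" where
  "refl2 = vector [vector [1, 0], vector [0, -1]]"

lemma rot_nth: "rot t $ 1 $ 1 = cos t" "rot t $ 1 $ 2 = - sin t" "rot t $ 2 $ 1 = sin t" "rot t $ 2 $ 2 = cos t"
  by (simp_all add: rot_def)

lemma refl2_nth: "refl2 $ 1 $ 1 = 1" "refl2 $ 1 $ 2 = 0" "refl2 $ 2 $ 1 = 0" "refl2 $ 2 $ 2 = -1"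
  by (simp_all add: refl2_def)

lemma SO2_eq: "SO2 = range rot"
proof (intro equalityI subsetI)
  fix g :: "real^2^2" assume "g \<in> SO2"
  then have g: "transpose g ** g = mat 1" "g ** transpose g = mat 1" "det g = 1"
    by (auto simp: SO2_def orthogonal_matrix_def)
  have e: "(g$1$1)\<^sup>2 + (g$2$1)\<^sup>2 = 1" "g$1$1 * g$1$2 + g$2$1 * g$2$2 = 0"
    using arg_cong[OF g(1), of "\<lambda>m. m$1$1"] arg_cong[OF g(1), of "\<lambda>m. m$1$2"]
    by (simp_all add: matrix_matrix_mult_def transpose_def mat_def sum_2 power2_eq_square)
  have d: "g$1$1 * g$2$2 - g$1$2 * g$2$1 = 1" using g(3) by (simp add: det_2)
  obtain t where t: "g$1$1 = cos t" "g$2$1 = sin t" using sincos_total_2pi[OF e(1)] by metis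
  have c: "(cos t)\<^sup>2 + (sin t)\<^sup>2 = 1" by simp
  have "g$2$2 = cos t" "g$1$2 = - sin t" using c e(2) d unfolding t by algebra+
  with t have "g = rot t" by (simp add: vec_eq_iff forall_2 rot_nth)
  then show "g \<in> range rot" by blast
next
  fix g assume "g \<in> range rot"
  then show "g \<in> SO2"
    by (auto simp: SO2_def orthogonal_matrix vec_eq_iff forall_2 rot_nth matrix_matrix_mult_def
        transpose_def mat_def sum_2 det_2 simp flip: power2_eq_square)
qed

lemma refl2_orth: "orthogonal_matrix refl2" "det refl2 = -1" "refl2 ** refl2 = mat 1"
  by (simp_all add: orthogonal_matrix vec_eq_iff forall_2 refl2_nth matrix_matrix_mult_def
        transpose_def mat_def sum_2 det_2)

lemma O2_eq: "O2 = range rot \<union> range (\<lambda>\<theta>. rot \<theta> ** refl2)"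
proof (intro equalityI subsetI)
  fix g :: "real^2^2" assume "g \<in> O2"
  then have g: "orthogonal_matrix g" by (simp add: O2_def)
  show "g \<in> range rot \<union> range (\<lambda>\<theta>. rot \<theta> ** refl2)"
  proof (cases "det g = 1")
    case True
    then show ?thesis using g SO2_eq by (auto simp: SO2_def)
  next
    case False
    then have "det g = -1" using det_orthogonal_matrix[OF g] by simp
    then have "g ** refl2 \<in> SO2"
      using g by (simp add: SO2_def orthogonal_matrix_mul refl2_orth det_mul)
    then obtain t where "g ** refl2 = rot t" by (auto simp: SO2_eq)
    then have "g = rot t ** refl2"
      by (metis matrix_mul_assoc matrix_mul_rid refl2_orth(3))
    then show ?thesis by blast
  qed
next
  fix g assume "g \<in> range rot \<union> range (\<lambda>\<theta>. rot \<theta> ** refl2)"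
  moreover have "orthogonal_matrix (rot t)" for t using SO2_eq by (auto simp: SO2_def)
  ultimately show "g \<in> O2" by (auto simp: O2_def orthogonal_matrix_mul refl2_orth)
qed


subsection \<open>The tensor spaces\<close>

type_synonym tens2 = "real^2^2"
type_synonym tens3 = "real^2^2^2"
type_synonym tens4 = "real^2^2^2^2"

definition Ela :: "tens4 set" where
  "Ela = {C. \<forall>i j k l. C$i$j$k$l = C$j$i$k$l \<and> C$i$j$k$l = C$i$j$l$k \<and> C$i$j$k$l = C$k$l$i$j}"

definition Piez :: "tens3 set" where
  "Piez = {P. \<forall>i j k. P$i$j$k = P$i$k$j}"

definition Sym2 :: "tens2 set" where
  "Sym2 = {S. \<forall>i j. S$i$j = S$j$i}"

definition act4 :: "real^2^2 \<Rightarrow> tens4 \<Rightarrow> tens4" where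
  "act4 g C = (\<chi> i j k l. \<Sum>p\<in>UNIV. \<Sum>q\<in>UNIV. \<Sum>r\<in>UNIV. \<Sum>s\<in>UNIV.
      g$i$p * g$j$q * g$k$r * g$l$s * C$p$q$r$s)"

definition act3 :: "real^2^2 \<Rightarrow> tens3 \<Rightarrow> tens3" where
  "act3 g P = (\<chi> i j k. \<Sum>p\<in>UNIV. \<Sum>q\<in>UNIV. \<Sum>r\<in>UNIV. g$i$p * g$j$q * g$k$r * P$p$q$r)"

definition act2 :: "real^2^2 \<Rightarrow> tens2 \<Rightarrow> tens2" where
  "act2 g S = (\<chi> i j. \<Sum>p\<in>UNIV. \<Sum>q\<in>UNIV. g$i$p * g$j$q * S$p$q)"

type_synonym triplet = "tens4 \<times> tens3 \<times> tens2"

definition VV :: "triplet set" where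
  "VV = Ela \<times> Piez \<times> Sym2"

definition actV :: "real^2^2 \<Rightarrow> triplet \<Rightarrow> triplet" where
  "actV g = (\<lambda>(C, P, S). (act4 g C, act3 g P, act2 g S))"


subsection \<open>Harmonic decompositions\<close>

text \<open>
  The space $3\mathbb{H}^0 \oplus 2\mathbb{H}^1 \oplus 2\mathbb{H}^2 \oplus \mathbb{H}^3 \oplus
  \mathbb{H}^4$, with $(a,b) \in \mathbb{H}^n$ written as $a + ib$.
\<close>

type_synonym harm =
  "real \<times> real \<times> real \<times> complex \<times> complex \<times> complex \<times> complex \<times> complex \<times> complex"

definition harm_rot :: "real \<Rightarrow> harm \<Rightarrow> harm" where
  "harm_rot \<theta> = (\<lambda>(l1, l2, l3, a1, b1, a2, b2, a3, a4).
     (l1, l2, l3, cis \<theta> * a1, cis \<theta> * b1, cis (2 * \<theta>) * a2, cis (2 * \<theta>) * b2,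
      cis (3 * \<theta>) * a3, cis (4 * \<theta>) * a4))"

definition harm_refl :: "harm \<Rightarrow> harm" where
  "harm_refl = (\<lambda>(l1, l2, l3, a1, b1, a2, b2, a3, a4).
     (l1, l2, l3, cnj a1, cnj b1, cnj a2, cnj b2, cnj a3, cnj a4))"

text \<open>
  Only the values on \<open>VV\<close> are constrained. Equivariance is required for the generators of
  $\mathrm{O}(2)$, see \<open>O2_eq\<close>.
\<close>

definition harmonic_decomposition :: "(triplet \<Rightarrow> harm) \<Rightarrow> bool" where
  "harmonic_decomposition \<Phi> \<longleftrightarrow>
     (\<forall>u\<in>VV. \<forall>v\<in>VV. \<Phi> (u + v) = \<Phi> u + \<Phi> v) \<and>
     (\<forall>c. \<forall>v\<in>VV. \<Phi> (c *\<^sub>R v) = c *\<^sub>R \<Phi> v) \<and>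
     bij_betw \<Phi> VV UNIV \<and>
     (\<forall>\<theta>. \<forall>v\<in>VV. \<Phi> (actV (rot \<theta>) v) = harm_rot \<theta> (\<Phi> v)) \<and>
     (\<forall>v\<in>VV. \<Phi> (actV refl2 v) = harm_refl (\<Phi> v))"

text \<open>
  A witness that \<open>harmonic_decomposition\<close> is satisfiable. Its components are the contractions of
  \<open>C\<close>, \<open>P\<close>, \<open>S\<close> with $w = (1, i)$ and $\overline{w}$ (up to linear combinations); for
  instance the last one is $\sum C_{ijkl} w_i w_j w_k w_l$.
\<close>

definition std_decomposition :: "triplet \<Rightarrow> harm" where
  "std_decomposition = (\<lambda>(C, P, S).
    (C$1$1$1$1 + 2 * C$1$1$2$2 + C$2$2$2$2,
     C$1$1$1$1 - 2 * C$1$1$2$2 + C$2$2$2$2 + 4 * C$1$2$1$2,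
     S$1$1 + S$2$2,
     Complex (P$1$1$1 + P$1$2$2) (P$2$1$1 + P$2$2$2),
     Complex (P$1$1$1 - P$1$2$2 + 2 * P$2$1$2) (2 * P$1$1$2 - P$2$1$1 + P$2$2$2),
     Complex (C$1$1$1$1 - C$2$2$2$2) (2 * C$1$1$1$2 + 2 * C$1$2$2$2),
     Complex (S$1$1 - S$2$2) (2 * S$1$2),
     Complex (P$1$1$1 - P$1$2$2 - 2 * P$2$1$2) (2 * P$1$1$2 + P$2$1$1 - P$2$2$2),
     Complex (C$1$1$1$1 - 2 * C$1$1$2$2 - 4 * C$1$2$1$2 + C$2$2$2$2)
       (4 * C$1$1$1$2 - 4 * C$1$2$2$2)))"

lemma Ela_iff: "C \<in> Ela \<longleftrightarrow>
  C$2$1$1$1 = C$1$1$1$2 \<and> C$1$2$1$1 = C$1$1$1$2 \<and> C$1$1$2$1 = C$1$1$1$2 \<and>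
  C$2$2$1$1 = C$1$1$2$2 \<and> C$2$1$2$1 = C$1$2$1$2 \<and> C$1$2$2$1 = C$1$2$1$2 \<and> C$2$1$1$2 = C$1$2$1$2 \<and>
  C$2$1$2$2 = C$1$2$2$2 \<and> C$2$2$1$2 = C$1$2$2$2 \<and> C$2$2$2$1 = C$1$2$2$2" (is "_ \<longleftrightarrow> ?E")
proof
  assume "C \<in> Ela"
  then have "C$i$j$k$l = C$j$i$k$l" "C$i$j$k$l = C$i$j$l$k" "C$i$j$k$l = C$k$l$i$j" for i j k l
    unfolding Ela_def by blast+
  then show ?E by metis
next
  assume ?E
  then show "C \<in> Ela" unfolding Ela_def forall_2 by simp
qed

lemma Piez_iff: "P \<in> Piez \<longleftrightarrow> P$1$2$1 = P$1$1$2 \<and> P$2$2$1 = P$2$1$2"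
  unfolding Piez_def forall_2 mem_Collect_eq by auto

lemma Sym2_iff: "S \<in> Sym2 \<longleftrightarrow> S$2$1 = S$1$2"
  unfolding Sym2_def forall_2 mem_Collect_eq by auto

lemma cis_mult_Complex: "cis t * Complex a b = Complex (cos t * a - sin t * b) (cos t * b + sin t * a)"
  by (simp add: complex_eq_iff)

lemma cos_sin_multiple:
  fixes t :: real
  shows "cos (2 * t) = (cos t)\<^sup>2 - (sin t)\<^sup>2" "sin (2 * t) = 2 * sin t * cos t"
    "cos (3 * t) = cos t ^ 3 - 3 * cos t * (sin t)\<^sup>2" "sin (3 * t) = 3 * (cos t)\<^sup>2 * sin t - sin t ^ 3"
    "cos (4 * t) = cos t ^ 4 - 6 * (cos t)\<^sup>2 * (sin t)\<^sup>2 + sin t ^ 4"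
    "sin (4 * t) = 4 * cos t ^ 3 * sin t - 4 * cos t * sin t ^ 3"
proof -
  have *: "cis (real n * t) = cis t ^ n" for n by (rule Complex.DeMoivre[symmetric])
  have "cis (2 * t) = cis t ^ 2" "cis (3 * t) = cis t ^ 3" "cis (4 * t) = cis t ^ 4"
    using *[of 2] *[of 3] *[of 4] by simp_all
  then show "cos (2 * t) = (cos t)\<^sup>2 - (sin t)\<^sup>2" "sin (2 * t) = 2 * sin t * cos t"
    "cos (3 * t) = cos t ^ 3 - 3 * cos t * (sin t)\<^sup>2" "sin (3 * t) = 3 * (cos t)\<^sup>2 * sin t - sin t ^ 3"
    "cos (4 * t) = cos t ^ 4 - 6 * (cos t)\<^sup>2 * (sin t)\<^sup>2 + sin t ^ 4"
    "sin (4 * t) = 4 * cos t ^ 3 * sin t - 4 * cos t * sin t ^ 3"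
    by (simp_all add: complex_eq_iff numeral_eq_Suc algebra_simps)
qed

lemma std_rot:
  assumes "v \<in> VV"
  shows "std_decomposition (actV (rot t) v) = harm_rot t (std_decomposition v)"
proof -
  obtain C P S where v: "v = (C, P, S)" by (metis prod_cases3)
  have C: "C \<in> Ela" and P: "P \<in> Piez" and S: "S \<in> Sym2" using assms by (auto simp: v VV_def)
  define c s where "c = cos t" and "s = sin t"
  have cs: "s * s = 1 - c * c"
    using sin_cos_squared_add[of t] by (simp add: c_def s_def power2_eq_square)
  then have cs': "s * (s * x) = x - c * (c * x)" for x
    by (metis left_diff_distrib mult.assoc mult_1)
  note [simp] = C[unfolded Ela_iff] P[unfolded Piez_iff] S[unfolded Sym2_iff]
  show ?thesis
    unfolding v std_decomposition_def actV_def harm_rot_def prod.case prod.inject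
      act4_def act3_def act2_def vec_lambda_beta sum_2 rot_nth cis_mult_Complex complex.inject
      cos_sin_multiple c_def[symmetric] s_def[symmetric]
    by (simp add: algebra_simps numeral_eq_Suc cs cs')
qed

lemma std_refl:
  assumes "v \<in> VV"
  shows "std_decomposition (actV refl2 v) = harm_refl (std_decomposition v)"
proof -
  obtain C P S where v: "v = (C, P, S)" by (metis prod_cases3)
  show ?thesis
    unfolding v std_decomposition_def actV_def harm_refl_def prod.case prod.inject
      act4_def act3_def act2_def vec_lambda_beta sum_2 refl2_nth
    by (simp add: complex_eq_iff)
qed

lemma std_inj: "inj_on std_decomposition VV"
proof (rule inj_onI)
  fix u v assume uv: "u \<in> VV" "v \<in> VV" "std_decomposition u = std_decomposition v"
  obtain C P S where u: "u = (C, P, S)" by (metis prod_cases3)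
  obtain C' P' S' where v: "v = (C', P', S')" by (metis prod_cases3)
  have m: "C \<in> Ela" "P \<in> Piez" "S \<in> Sym2" "C' \<in> Ela" "P' \<in> Piez" "S' \<in> Sym2"
    using uv by (auto simp: u v VV_def)
  note eq = uv(3)[unfolded u v std_decomposition_def prod.case prod.inject complex.inject]
  have "C = C'" using m(1,4) eq
    unfolding Ela_iff vec_eq_iff forall_2 by simp
  moreover have "P = P'" using m(2,5) eq
    unfolding Piez_iff vec_eq_iff forall_2 by simp
  moreover have "S = S'" using m(3,6) eq
    unfolding Sym2_iff vec_eq_iff forall_2 by simp
  ultimately show "u = v" by (simp add: u v)
qed

lemma std_surj: "h \<in> std_decomposition ` VV"
proof -
  obtain l1 l2 l3 a1 b1 a2 r where r: "h = (l1, l2, l3, a1, b1, a2, r)"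
    by (rule prod_cases7)
  obtain b2 a3 a4 where "r = (b2, a3, a4)"
    by (rule prod_cases3)
  with r have h: "h = (l1, l2, l3, a1, b1, a2, b2, a3, a4)" by simp
  define s where "s = (l1 + (l2 + Re a4) / 2) / 2"
  define A where "A = (s + Re a2) / 2"
  define F where "F = (s - Re a2) / 2"
  define B where "B = (Im a2 / 2 + Im a4 / 4) / 2"
  define E where "E = (Im a2 / 2 - Im a4 / 4) / 2"
  define K where "K = (l1 - s) / 2"
  define D where "D = (l2 - Re a4) / 8"
  define C :: tens4 where "C = vector [vector [vector [vector [A, B], vector [B, K]],
     vector [vector [B, D], vector [D, E]]], vector [vector [vector [B, D], vector [D, E]],
     vector [vector [K, E], vector [E, F]]]]"
  define m where "m = (Re b1 + Re a3) / 2"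
  define n where "n = (Im a3 - Im b1) / 2"
  define P112 where "P112 = (Im b1 + Im a3) / 4"
  define P212 where "P212 = (Re b1 - Re a3) / 4"
  define P :: tens3 where "P = vector [vector [vector [(Re a1 + m) / 2, P112], vector [P112, (Re a1 - m) / 2]],
     vector [vector [(Im a1 + n) / 2, P212], vector [P212, (Im a1 - n) / 2]]]"
  define S :: tens2 where "S = vector [vector [(l3 + Re b2) / 2, Im b2 / 2],
     vector [Im b2 / 2, (l3 - Re b2) / 2]]"
  have Ce: "C$1$1$1$1 = A" "C$1$1$1$2 = B" "C$1$1$2$1 = B" "C$1$1$2$2 = K" "C$1$2$1$1 = B"
    "C$1$2$1$2 = D" "C$1$2$2$1 = D" "C$1$2$2$2 = E" "C$2$1$1$1 = B" "C$2$1$1$2 = D" "C$2$1$2$1 = D"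
    "C$2$1$2$2 = E" "C$2$2$1$1 = K" "C$2$2$1$2 = E" "C$2$2$2$1 = E" "C$2$2$2$2 = F"
    by (simp_all only: C_def vector_2)
  have Pe: "P$1$1$1 = (Re a1 + m) / 2" "P$1$1$2 = P112" "P$1$2$1 = P112" "P$1$2$2 = (Re a1 - m) / 2"
    "P$2$1$1 = (Im a1 + n) / 2" "P$2$1$2 = P212" "P$2$2$1 = P212" "P$2$2$2 = (Im a1 - n) / 2"
    by (simp_all only: P_def vector_2)
  have Se: "S$1$1 = (l3 + Re b2) / 2" "S$1$2 = Im b2 / 2" "S$2$1 = Im b2 / 2" "S$2$2 = (l3 - Re b2) / 2"
    by (simp_all only: S_def vector_2)
  have "(C, P, S) \<in> VV" by (simp add: VV_def Ela_iff Piez_iff Sym2_iff Ce Pe Se)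
  moreover have "std_decomposition (C, P, S) = h"
    unfolding h std_decomposition_def prod.case prod.inject Ce Pe Se complex_eq_iff complex.sel
      A_def B_def D_def E_def F_def K_def s_def m_def n_def P112_def P212_def
    by (intro conjI) (simp_all add: field_simps)
  ultimately show ?thesis by blast
qed

lemma harmonic_decomposition_std: "harmonic_decomposition std_decomposition"
  unfolding harmonic_decomposition_def
proof (intro conjI allI ballI)
  show "std_decomposition (u + v) = std_decomposition u + std_decomposition v" for u v
    by (cases u; cases v) (simp add: std_decomposition_def complex_eq_iff)
  show "std_decomposition (c *\<^sub>R v) = c *\<^sub>R std_decomposition v" for c v
    by (cases v) (simp add: std_decomposition_def complex_eq_iff algebra_simps)
  show "bij_betw std_decomposition VV UNIV"
    using std_inj std_surj by (auto simp: bij_betw_def)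
qed (simp_all add: std_rot std_refl)

subsection \<open>Coordinates and lists of covariants\<close>

text \<open>
  A point of $\mathbb{V} \oplus \mathbb{R}^2$ in coordinates; the last component is $z = x + iy$
  and its projection is called \<open>zx\<close>.
\<close>

type_synonym point = "harm \<times> complex"

definition lam1 :: "point \<Rightarrow> real" where "lam1 = (\<lambda>((l1, l2, l3, a1, b1, a2, b2, a3, a4), z). l1)"
definition lam2 :: "point \<Rightarrow> real" where "lam2 = (\<lambda>((l1, l2, l3, a1, b1, a2, b2, a3, a4), z). l2)"
definition lam3 :: "point \<Rightarrow> real" where "lam3 = (\<lambda>((l1, l2, l3, a1, b1, a2, b2, a3, a4), z). l3)"
definition z1a :: "point \<Rightarrow> complex" where "z1a = (\<lambda>((l1, l2, l3, a1, b1, a2, b2, a3, a4), z). a1)"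
definition z1b :: "point \<Rightarrow> complex" where "z1b = (\<lambda>((l1, l2, l3, a1, b1, a2, b2, a3, a4), z). b1)"
definition z2a :: "point \<Rightarrow> complex" where "z2a = (\<lambda>((l1, l2, l3, a1, b1, a2, b2, a3, a4), z). a2)"
definition z2b :: "point \<Rightarrow> complex" where "z2b = (\<lambda>((l1, l2, l3, a1, b1, a2, b2, a3, a4), z). b2)"
definition z3 :: "point \<Rightarrow> complex" where "z3 = (\<lambda>((l1, l2, l3, a1, b1, a2, b2, a3, a4), z). a3)"
definition z4 :: "point \<Rightarrow> complex" where "z4 = (\<lambda>((l1, l2, l3, a1, b1, a2, b2, a3, a4), z). a4)"
definition zx :: "point \<Rightarrow> complex" where "zx = (\<lambda>((l1, l2, l3, a1, b1, a2, b2, a3, a4), z). z)"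

text \<open>The digit in \<open>monomials0\<close>, \<dots>, \<open>monomials4\<close> is the order of the monomials in the list.\<close>

definition monomials0 :: "(point \<Rightarrow> complex) list" where
  "monomials0 = [
    (\<lambda>p. z1a p * cnj (z1b p)),
    (\<lambda>p. z2a p * cnj (z2b p)),
    (\<lambda>p. z1a p ^ 2 * cnj (z2a p)),
    (\<lambda>p. z1a p ^ 2 * cnj (z2b p)),
    (\<lambda>p. z1b p ^ 2 * cnj (z2a p)),
    (\<lambda>p. z1b p ^ 2 * cnj (z2b p)),
    (\<lambda>p. z2a p ^ 2 * cnj (z4 p)),
    (\<lambda>p. z2b p ^ 2 * cnj (z4 p)),
    (\<lambda>p. z1a p * z1b p * cnj (z2a p)),
    (\<lambda>p. z1a p * z1b p * cnj (z2b p)),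
    (\<lambda>p. z1a p * z2a p * cnj (z3 p)),
    (\<lambda>p. z1b p * z2a p * cnj (z3 p)),
    (\<lambda>p. z1b p * z2b p * cnj (z3 p)),
    (\<lambda>p. z1a p * z2b p * cnj (z3 p)),
    (\<lambda>p. z2a p * z2b p * cnj (z4 p)),
    (\<lambda>p. z1a p * z3 p * cnj (z4 p)),
    (\<lambda>p. z1b p * z3 p * cnj (z4 p)),
    (\<lambda>p. z1a p ^ 3 * cnj (z3 p)),
    (\<lambda>p. z1a p ^ 2 * z1b p * cnj (z3 p)),
    (\<lambda>p. z1a p * z1b p ^ 2 * cnj (z3 p)),
    (\<lambda>p. z1b p ^ 3 * cnj (z3 p)),
    (\<lambda>p. z1a p * cnj (z2a p) ^ 2 * z3 p),
    (\<lambda>p. z1b p * cnj (z2a p) ^ 2 * z3 p),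
    (\<lambda>p. z1a p * cnj (z2a p) * cnj (z2b p) * z3 p),
    (\<lambda>p. z1b p * cnj (z2a p) * cnj (z2b p) * z3 p),
    (\<lambda>p. z1a p * cnj (z2b p) ^ 2 * z3 p),
    (\<lambda>p. z1b p * cnj (z2b p) ^ 2 * z3 p),
    (\<lambda>p. z1a p ^ 2 * z2a p * cnj (z4 p)),
    (\<lambda>p. z1a p * z1b p * z2a p * cnj (z4 p)),
    (\<lambda>p. z1b p ^ 2 * z2a p * cnj (z4 p)),
    (\<lambda>p. z1a p ^ 2 * z2b p * cnj (z4 p)),
    (\<lambda>p. z1a p * z1b p * z2b p * cnj (z4 p)),
    (\<lambda>p. z1b p ^ 2 * z2b p * cnj (z4 p)),
    (\<lambda>p. z1a p * cnj (z2a p) * cnj (z3 p) * z4 p),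
    (\<lambda>p. z1b p * cnj (z2a p) * cnj (z3 p) * z4 p),
    (\<lambda>p. z1a p * cnj (z2b p) * cnj (z3 p) * z4 p),
    (\<lambda>p. z1b p * cnj (z2b p) * cnj (z3 p) * z4 p),
    (\<lambda>p. z2a p * cnj (z3 p) ^ 2 * z4 p),
    (\<lambda>p. z2b p * cnj (z3 p) ^ 2 * z4 p),
    (\<lambda>p. z2a p ^ 3 * cnj (z3 p) ^ 2),
    (\<lambda>p. z2a p ^ 2 * z2b p * cnj (z3 p) ^ 2),
    (\<lambda>p. z2a p * z2b p ^ 2 * cnj (z3 p) ^ 2),
    (\<lambda>p. z2b p ^ 3 * cnj (z3 p) ^ 2),
    (\<lambda>p. z1a p ^ 4 * cnj (z4 p)),
    (\<lambda>p. z1a p ^ 3 * z1b p * cnj (z4 p)),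
    (\<lambda>p. z1a p ^ 2 * z1b p ^ 2 * cnj (z4 p)),
    (\<lambda>p. z1a p * z1b p ^ 3 * cnj (z4 p)),
    (\<lambda>p. z1b p ^ 4 * cnj (z4 p)),
    (\<lambda>p. z2a p * z3 p ^ 2 * cnj (z4 p) ^ 2),
    (\<lambda>p. z2b p * z3 p ^ 2 * cnj (z4 p) ^ 2),
    (\<lambda>p. z1a p ^ 2 * cnj (z3 p) ^ 2 * z4 p),
    (\<lambda>p. z1a p * z1b p * cnj (z3 p) ^ 2 * z4 p),
    (\<lambda>p. z1b p ^ 2 * cnj (z3 p) ^ 2 * z4 p),
    (\<lambda>p. z1a p * cnj (z3 p) ^ 3 * z4 p ^ 2),
    (\<lambda>p. z1b p * cnj (z3 p) ^ 3 * z4 p ^ 2),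
    (\<lambda>p. z3 p ^ 4 * cnj (z4 p) ^ 3)]"

definition monomials1 :: "(point \<Rightarrow> complex) list" where
  "monomials1 = [
    (\<lambda>p. cnj (z1a p) * zx p),
    (\<lambda>p. cnj (z1b p) * zx p),
    (\<lambda>p. z1a p * cnj (z2a p) * zx p),
    (\<lambda>p. z1b p * cnj (z2a p) * zx p),
    (\<lambda>p. z1a p * cnj (z2b p) * zx p),
    (\<lambda>p. z1b p * cnj (z2b p) * zx p),
    (\<lambda>p. z2a p * cnj (z3 p) * zx p),
    (\<lambda>p. z2b p * cnj (z3 p) * zx p),
    (\<lambda>p. z3 p * cnj (z4 p) * zx p),
    (\<lambda>p. z1a p ^ 2 * cnj (z3 p) * zx p),
    (\<lambda>p. cnj (z2b p) ^ 2 * z3 p * zx p),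
    (\<lambda>p. z1b p ^ 2 * cnj (z3 p) * zx p),
    (\<lambda>p. cnj (z2a p) ^ 2 * z3 p * zx p),
    (\<lambda>p. cnj (z2a p) * cnj (z2b p) * z3 p * zx p),
    (\<lambda>p. z1a p * z1b p * cnj (z3 p) * zx p),
    (\<lambda>p. cnj (z2a p) * cnj (z3 p) * z4 p * zx p),
    (\<lambda>p. cnj (z2b p) * cnj (z3 p) * z4 p * zx p),
    (\<lambda>p. z1a p * z2a p * cnj (z4 p) * zx p),
    (\<lambda>p. z1b p * z2a p * cnj (z4 p) * zx p),
    (\<lambda>p. z1a p * z2b p * cnj (z4 p) * zx p),
    (\<lambda>p. z1b p * z2b p * cnj (z4 p) * zx p),
    (\<lambda>p. z1a p ^ 3 * cnj (z4 p) * zx p),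
    (\<lambda>p. z1b p ^ 3 * cnj (z4 p) * zx p),
    (\<lambda>p. z1a p * cnj (z3 p) ^ 2 * z4 p * zx p),
    (\<lambda>p. z1b p * cnj (z3 p) ^ 2 * z4 p * zx p),
    (\<lambda>p. z1a p ^ 2 * z1b p * cnj (z4 p) * zx p),
    (\<lambda>p. z1a p * z1b p ^ 2 * cnj (z4 p) * zx p),
    (\<lambda>p. cnj (z3 p) ^ 3 * z4 p ^ 2 * zx p)]"

definition monomials2 :: "(point \<Rightarrow> complex) list" where
  "monomials2 = [
    (\<lambda>p. cnj (z2a p) * zx p ^ 2),
    (\<lambda>p. cnj (z2b p) * zx p ^ 2),
    (\<lambda>p. z1a p * cnj (z3 p) * zx p ^ 2),
    (\<lambda>p. z1b p * cnj (z3 p) * zx p ^ 2),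
    (\<lambda>p. z2a p * cnj (z4 p) * zx p ^ 2),
    (\<lambda>p. z2b p * cnj (z4 p) * zx p ^ 2),
    (\<lambda>p. z1a p ^ 2 * cnj (z4 p) * zx p ^ 2),
    (\<lambda>p. z1b p ^ 2 * cnj (z4 p) * zx p ^ 2),
    (\<lambda>p. cnj (z3 p) ^ 2 * z4 p * zx p ^ 2),
    (\<lambda>p. z1a p * z1b p * cnj (z4 p) * zx p ^ 2)]"

definition monomials3 :: "(point \<Rightarrow> complex) list" where
  "monomials3 = [
    (\<lambda>p. cnj (z3 p) * zx p ^ 3),
    (\<lambda>p. z1a p * cnj (z4 p) * zx p ^ 3),
    (\<lambda>p. z1b p * cnj (z4 p) * zx p ^ 3)]"

definition monomials4 :: "(point \<Rightarrow> complex) list" where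
  "monomials4 = [
    (\<lambda>p. cnj (z4 p) * zx p ^ 4)]"

definition monomials :: "(point \<Rightarrow> complex) list" where
  "monomials = monomials0 @ monomials1 @ monomials2 @ monomials3 @ monomials4"

lemma length_monomials: "length monomials = 98"
  by (simp add: monomials_def monomials0_def monomials1_def monomials2_def monomials3_def
      monomials4_def)

text \<open>The products $z\overline{z}$ are real valued; \<open>Re\<close> only changes the type.\<close>

definition basic_covariants :: "(point \<Rightarrow> real) list" where
  "basic_covariants = [lam1, lam2, lam3,
    (\<lambda>p. Re (z1a p * cnj (z1a p))),
    (\<lambda>p. Re (z1b p * cnj (z1b p))),
    (\<lambda>p. Re (z2a p * cnj (z2a p))),
    (\<lambda>p. Re (z2b p * cnj (z2b p))),
    (\<lambda>p. Re (z3 p * cnj (z3 p))),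
    (\<lambda>p. Re (z4 p * cnj (z4 p))),
    (\<lambda>p. Re (zx p * cnj (zx p)))]"

definition im_products :: "(point \<Rightarrow> real) list" where
  "im_products = [
    (\<lambda>p. Im (z1a p * cnj (z1b p)) * Im (z2a p * cnj (z2b p))),
    (\<lambda>p. Im (z1a p * cnj (z1b p)) * Im (z2a p ^ 2 * cnj (z4 p))),
    (\<lambda>p. Im (z1a p * cnj (z1b p)) * Im (z2b p ^ 2 * cnj (z4 p))),
    (\<lambda>p. Im (z1a p * cnj (z1b p)) * Im (z2a p * z2b p * cnj (z4 p))),
    (\<lambda>p. Im (z2a p * cnj (z2b p)) * Im (z1a p * z3 p * cnj (z4 p))),
    (\<lambda>p. Im (z2a p * cnj (z2b p)) * Im (z1b p * z3 p * cnj (z4 p))),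
    (\<lambda>p. Im (z2a p * cnj (z2b p)) * Im (cnj (z1a p) * zx p)),
    (\<lambda>p. Im (z2a p * cnj (z2b p)) * Im (cnj (z1b p) * zx p)),
    (\<lambda>p. Im (z2a p ^ 2 * cnj (z4 p)) * Im (cnj (z1a p) * zx p)),
    (\<lambda>p. Im (z2a p ^ 2 * cnj (z4 p)) * Im (cnj (z1b p) * zx p)),
    (\<lambda>p. Im (z2b p ^ 2 * cnj (z4 p)) * Im (cnj (z1a p) * zx p)),
    (\<lambda>p. Im (z2b p ^ 2 * cnj (z4 p)) * Im (cnj (z1b p) * zx p)),
    (\<lambda>p. Im (z2a p * z2b p * cnj (z4 p)) * Im (cnj (z1a p) * zx p)),
    (\<lambda>p. Im (z2a p * z2b p * cnj (z4 p)) * Im (cnj (z1b p) * zx p)),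
    (\<lambda>p. Im (z2a p * cnj (z2b p)) * Im (z3 p * cnj (z4 p) * zx p))]"

definition SO2_covariants :: "(point \<Rightarrow> real) list" where
  "SO2_covariants = basic_covariants
     @ map (\<lambda>m p. Re (m p)) monomials @ map (\<lambda>m p. Im (m p)) monomials"

definition O2_covariants :: "(point \<Rightarrow> real) list" where
  "O2_covariants = basic_covariants @ map (\<lambda>m p. Re (m p)) monomials @ im_products"

text \<open>A function of the coordinates, regarded as a function on $\mathbb{V} \oplus \mathbb{R}^2$.\<close>

definition in_coordinates ::
    "(triplet \<Rightarrow> harm) \<Rightarrow> (point \<Rightarrow> real) \<Rightarrow> triplet \<times> (real^2) \<Rightarrow> real" where
  "in_coordinates \<Phi> F = restrict (\<lambda>(v, x). F (\<Phi> v, Complex (x$1) (x$2))) (VV \<times> UNIV)"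

end

theory Submission
  imports Defs "HOL-Library.Poly_Mapping"
begin

text \<open>
  In harmonic coordinates a rotation multiplies every monomial in the coordinates and their
  conjugates by a phase given by its weight. Hence the rotation invariants are the combinations of
  monomials of weight zero, and reflection invariance leaves the real parts of these monomials
  (\<open>SO2_invariant_in_alg\<close>, \<open>O2_invariant_in_alg\<close>). A monomial of weight zero is a product of
  irreducible ones. Whether a monomial is irreducible depends on its weights alone, and the minimal
  zero-sum families of weights between -4 and 4 are classified in \<open>zero_sum_contains_pattern\<close>. The
  monomials over them are, up to conjugation, the listed ones (\<open>irreducible_listed\<close>), and this proves
  generation for \<open>SO(2)\<close>.

  For \<open>O(2)\<close> the real part of a product of irreducible monomials is a polynomial in their real parts
  and in the products of two of their imaginary parts. Most of these products reduce to real parts.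
  If two monomials contain letters whose weights agree up to sign, the exchange relation
  \<open>Im_Im_exchange\<close> expresses the product of their imaginary parts by real parts of shorter monomials;
  and \<open>Im m * Im n\<close> equals \<open>- Re (m * n)\<close> up to a product of real parts, so that a factorization of
  \<open>m * n\<close> other than the given one may be used instead. Only fifteen products resist
  (\<open>pattern_pairs\<close>, \<open>exceptional_nonreal\<close>).

  Minimality rests on the linear independence of the monomials, which makes coefficients well
  defined. For every generator there is a condition on the coefficients that is preserved by sums
  and products and satisfied by all generators except this one. At an irreducible monomial it is the
  vanishing of the real or the imaginary part of the coefficient. For a product \<open>Im m * Im n\<close> it
  compares the coefficients of \<open>m * n\<close> and \<open>m * cnj n\<close>, which have no factorization into invariant
  monomials but the obvious one (\<open>balanced_at\<close>). The same conditions show that the generators are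
  distinct. Finally, the coordinate map is a linear bijection that carries everything over to the
  tensors.
\<close>

section \<open>Monomials in the coordinates and their conjugates\<close>

declare split_paired_All [simp del] split_paired_Ex [simp del]

text \<open>
  One letter for each coordinate and one for each conjugate, so that a monomial is a multiset of
  letters; the \<open>Lam\<close> are real and hence are their own conjugates.
\<close>

datatype letter = Lam1 | Lam2 | Lam3 | A1 | A1' | B1 | B1' | A2 | A2' | B2 | B2' | A3 | A3' | A4 | A4' | X | X'

type_synonym mono = "letter multiset"

fun bar :: "letter \<Rightarrow> letter" where
  "bar Lam1 = Lam1" | "bar Lam2 = Lam2" | "bar Lam3 = Lam3"
| "bar A1 = A1'" | "bar A1' = A1" | "bar B1 = B1'" | "bar B1' = B1"
| "bar A2 = A2'" | "bar A2' = A2" | "bar B2 = B2'" | "bar B2' = B2"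
| "bar A3 = A3'" | "bar A3' = A3" | "bar A4 = A4'" | "bar A4' = A4" | "bar X = X'" | "bar X' = X"

fun wtl :: "letter \<Rightarrow> int" where
  "wtl Lam1 = 0" | "wtl Lam2 = 0" | "wtl Lam3 = 0"
| "wtl A1 = 1" | "wtl A1' = -1" | "wtl B1 = 1" | "wtl B1' = -1"
| "wtl A2 = 2" | "wtl A2' = -2" | "wtl B2 = 2" | "wtl B2' = -2"
| "wtl A3 = 3" | "wtl A3' = -3" | "wtl A4 = 4" | "wtl A4' = -4" | "wtl X = 1" | "wtl X' = -1"

fun val :: "letter \<Rightarrow> point \<Rightarrow> complex" where
  "val Lam1 p = of_real (lam1 p)" | "val Lam2 p = of_real (lam2 p)" | "val Lam3 p = of_real (lam3 p)"
| "val A1 p = z1a p" | "val A1' p = cnj (z1a p)" | "val B1 p = z1b p" | "val B1' p = cnj (z1b p)"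
| "val A2 p = z2a p" | "val A2' p = cnj (z2a p)" | "val B2 p = z2b p" | "val B2' p = cnj (z2b p)"
| "val A3 p = z3 p" | "val A3' p = cnj (z3 p)" | "val A4 p = z4 p" | "val A4' p = cnj (z4 p)"
| "val X p = zx p" | "val X' p = cnj (zx p)"

lemma bar_bar [simp]: "bar (bar l) = l"
  by (cases l) auto

lemma bar_eq_iff: "bar l = bar k \<longleftrightarrow> l = k"
  by (metis bar_bar)

lemma wtl_bar [simp]: "wtl (bar l) = - wtl l"
  by (cases l) auto

lemma val_bar [simp]: "val (bar l) p = cnj (val l p)"
  by (cases l) auto

definition ev :: "mono \<Rightarrow> point \<Rightarrow> complex" where
  "ev M p = (\<Prod>l\<in>#M. val l p)"

definition wt :: "mono \<Rightarrow> int" where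
  "wt M = (\<Sum>l\<in>#M. wtl l)"

abbreviation conj_mono :: "mono \<Rightarrow> mono" where
  "conj_mono \<equiv> image_mset bar"

lemma ev_simps [simp]: "ev {#} p = 1" "ev (add_mset l M) p = val l p * ev M p" "ev (M + N) p = ev M p * ev N p"
  by (auto simp: ev_def)

lemma wt_simps [simp]: "wt {#} = 0" "wt (add_mset l M) = wtl l + wt M" "wt (M + N) = wt M + wt N"
  by (auto simp: wt_def)

lemma conj_conj [simp]: "conj_mono (conj_mono M) = M"
  by (induction M) auto

lemma conj_mono_eq_iff: "conj_mono M = conj_mono N \<longleftrightarrow> M = N"
  by (metis conj_conj)

lemma ev_conj [simp]: "ev (conj_mono M) p = cnj (ev M p)"
  by (induction M) auto

lemma wt_conj [simp]: "wt (conj_mono M) = - wt M"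
  by (induction M) auto

text \<open>
  Only the values at unconjugated letters enter; conjugate letters receive the prescribed values if
  the prescription commutes with conjugation.
\<close>

definition assign :: "(letter \<Rightarrow> complex) \<Rightarrow> point" where
  "assign g = ((Re (g Lam1), Re (g Lam2), Re (g Lam3), g A1, g B1, g A2, g B2, g A3, g A4), g X)"

lemma coords_assign:
  "lam1 (assign g) = Re (g Lam1)" "lam2 (assign g) = Re (g Lam2)" "lam3 (assign g) = Re (g Lam3)"
  "z1a (assign g) = g A1" "z1b (assign g) = g B1" "z2a (assign g) = g A2" "z2b (assign g) = g B2"
  "z3 (assign g) = g A3" "z4 (assign g) = g A4" "zx (assign g) = g X"
  by (simp_all add: assign_def lam1_def lam2_def lam3_def z1a_def z1b_def z2a_def z2b_def z3_def z4_def zx_def)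

lemma val_assign:
  assumes "\<And>l. g (bar l) = cnj (g l)"
  shows "val l (assign g) = g l"
proof -
  have real: "of_real (Re (g k)) = g k" if "bar k = k" for k
    using assms[of k] that by (simp add: complex_eq_iff)
  show ?thesis
    using assms[of A1] assms[of B1] assms[of A2] assms[of B2] assms[of A3] assms[of A4] assms[of X]
    by (cases l) (simp_all add: coords_assign real)
qed

text \<open>
  Linear independence of the monomials is Artin's lemma on characters: pointwise multiplication
  makes the points a monoid, on which every monomial is multiplicative.
\<close>

definition pmul :: "point \<Rightarrow> point \<Rightarrow> point" where
  "pmul p q = assign (\<lambda>l. val l p * val l q)"

lemma ev_pmul: "ev M (pmul p q) = ev M p * ev M q"
  by (induction M) (simp_all add: pmul_def val_assign)

definition at_letter :: "letter \<Rightarrow> complex \<Rightarrow> point" where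
  "at_letter l z = assign (\<lambda>k. if k = l then z else if k = bar l then cnj z else 1)"

lemma val_at_letter:
  assumes "bar l = l \<Longrightarrow> cnj z = z"
  shows "val k (at_letter l z) = (if k = l then z else if k = bar l then cnj z else 1)"
  unfolding at_letter_def using assms
  by (subst val_assign) (auto simp: bar_eq_iff)

lemma ev_at_real_letter:
  assumes "bar l = l"
  shows "ev M (at_letter l 2) = 2 ^ count M l"
  using assms by (induction M) (auto simp: val_at_letter)

lemma ev_at_letter:
  assumes "bar l \<noteq> l"
  shows "ev M (at_letter l z) = z ^ count M l * cnj z ^ count M (bar l)"
proof -
  have "val k (at_letter l z) = (if k = l then z else if k = bar l then cnj z else 1)" for k
    by (rule val_at_letter) (use assms in simp)
  then show ?thesis using assms by (induction M) auto
qed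

lemma exponents_eq_of_values_eq:
  fixes a b a' b' :: nat
  assumes eq: "\<And>z::complex. z ^ a * cnj z ^ b = z ^ a' * cnj z ^ b'"
  shows "a = a'"
proof -
  have "(2::complex) ^ (a + b) = 2 ^ (a' + b')"
    using eq[of 2] by (simp add: power_add)
  then have "norm ((2::complex) ^ (a + b)) = norm ((2::complex) ^ (a' + b'))" by simp
  then have s: "a + b = a' + b'" by (simp add: norm_power)
  define d where "d = int a - int b - (int a' - int b')"
  \<comment> \<open>The angle is so small that \<open>d * t\<close> stays far below a full turn.\<close>
  define t where "t = 1 / (1 + real_of_int \<bar>d\<bar>)"
  have c: "cis t ^ m * cnj (cis t) ^ n = cis ((real m - real n) * t)" for m n
    by (simp add: cis_cnj Complex.DeMoivre cis_mult algebra_simps)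
  have "cis ((real a - real b) * t) = cis ((real a' - real b') * t)"
    using eq[of "cis t"] by (simp only: c)
  then have "cis ((real a - real b) * t) * cis (- ((real a' - real b') * t)) = 1"
    by (simp add: cis_mult)
  then have "cis (real_of_int d * t) = 1"
    by (simp add: cis_mult d_def algebra_simps)
  then have "cos (real_of_int d * t) = 1" by (simp add: complex_eq_iff)
  moreover have "\<bar>real_of_int d * t\<bar> < 1"
    by (simp add: t_def abs_mult divide_simps)
  ultimately have "real_of_int d * t = 0"
    by (smt (verit) cos_monotone_0_pi cos_zero cos_minus pi_gt3)
  moreover have "t \<noteq> 0" by (simp add: t_def add_nonneg_eq_0_iff)
  ultimately have "d = 0" by simp
  with s show ?thesis unfolding d_def by linarith
qed

lemma monomials_separated:
  assumes "M \<noteq> N"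
  obtains p where "ev M p \<noteq> ev N p"
proof (rule ccontr)
  assume "\<not> thesis"
  with that have eq: "ev M p = ev N p" for p by blast
  have "count M l = count N l" for l
  proof (cases "bar l = l")
    case True
    have "norm (ev M (at_letter l 2)) = norm (ev N (at_letter l 2))" by (simp add: eq)
    then show ?thesis by (simp add: True ev_at_real_letter norm_power)
  next
    case False
    show ?thesis
      by (rule exponents_eq_of_values_eq) (use eq[of "at_letter l _"] in \<open>simp add: ev_at_letter False\<close>)
  qed
  with assms show False by (simp add: multiset_eq_iff)
qed

lemma monomials_independent:
  assumes "finite S" "\<And>p. (\<Sum>M\<in>S. c M * ev M p) = 0" "M \<in> S"
  shows "c M = 0"
  using assms
proof (induction S arbitrary: c M rule: finite_induct)
  case empty
  then show ?case by simp
next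
  case (insert N S)
  \<comment> \<open>The relation at \<open>q p\<close> minus \<open>ev N q\<close> times the relation at \<open>p\<close> no longer involves \<open>N\<close>.\<close>
  have coeffs: "c M = 0" if "M \<in> S" for M
  proof -
    have "M \<noteq> N" using that insert.hyps(2) by auto
    then obtain q where q: "ev M q \<noteq> ev N q" by (rule monomials_separated)
    have "(\<Sum>M\<in>S. c M * (ev M q - ev N q) * ev M p) = 0" for p
    proof -
      have "(\<Sum>M\<in>insert N S. c M * ev M (pmul q p)) - ev N q * (\<Sum>M\<in>insert N S. c M * ev M p) = 0"
        by (simp only: insert.prems(1) mult_zero_right diff_self)
      then show ?thesis
        using insert.hyps by (simp add: ev_pmul algebra_simps sum_distrib_left sum_subtractf)
    qed
    from insert.IH[OF this that] q show ?thesis by simp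
  qed
  obtain p where p: "ev N p \<noteq> 0"
  proof
    have "ev N (assign (\<lambda>_. 1)) = 1" by (induction N) (simp_all add: val_assign)
    then show "ev N (assign (\<lambda>_. 1)) \<noteq> 0" by simp
  qed
  have "c N * ev N p = 0" using insert.prems(1)[of p] insert.hyps coeffs by simp
  with p coeffs insert.prems(2) show ?case by auto
qed

section \<open>Polynomials in the coordinates\<close>

text \<open>
  Formal complex combinations of monomials. Since the monomials are independent, a real polynomial
  function of a point has exactly one such representation, so that its coefficients can serve to
  tell subalgebras apart.
\<close>

type_synonym pol = "mono \<Rightarrow>\<^sub>0 complex"

abbreviation coefficient :: "pol \<Rightarrow> mono \<Rightarrow> complex" where
  "coefficient \<equiv> Poly_Mapping.lookup"

abbreviation mterm :: "mono \<Rightarrow> complex \<Rightarrow> pol" where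
  "mterm \<equiv> Poly_Mapping.single"

definition evp :: "pol \<Rightarrow> point \<Rightarrow> complex" where
  "evp P p = (\<Sum>M\<in>Poly_Mapping.keys P. coefficient P M * ev M p)"

lemma evp_superset:
  assumes "finite S" "Poly_Mapping.keys P \<subseteq> S"
  shows "evp P p = (\<Sum>M\<in>S. coefficient P M * ev M p)"
  unfolding evp_def using assms by (intro sum.mono_neutral_left) (auto simp: in_keys_iff)

lemma evp_add [simp]: "evp (P + Q) p = evp P p + evp Q p"
proof -
  let ?S = "Poly_Mapping.keys P \<union> Poly_Mapping.keys Q"
  have "evp (P + Q) p = (\<Sum>M\<in>?S. coefficient (P + Q) M * ev M p)"
    by (rule evp_superset) (use keys_add[of P Q] in auto)
  also have "\<dots> = (\<Sum>M\<in>?S. coefficient P M * ev M p) + (\<Sum>M\<in>?S. coefficient Q M * ev M p)"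
    by (simp add: lookup_add algebra_simps sum.distrib)
  also have "\<dots> = evp P p + evp Q p" by (simp add: evp_superset[of ?S])
  finally show ?thesis .
qed

lemma evp_term [simp]: "evp (mterm M c) p = c * ev M p"
  by (subst evp_superset[of "{M}"]) auto

lemma evp_zero [simp]: "evp 0 p = 0"
  by (simp add: evp_def)

lemma evp_sum: "evp (\<Sum>i\<in>I. P i) p = (\<Sum>i\<in>I. evp (P i) p)"
  by (induction I rule: infinite_finite_induct) auto

lemma pol_as_sum: "P = (\<Sum>M\<in>Poly_Mapping.keys P. mterm M (coefficient P M))"
  by (rule poly_mapping_eqI) (auto simp: lookup_sum lookup_single when_def in_keys_iff)

lemma evp_mult [simp]: "evp (P * Q) p = evp P p * evp Q p"
proof -
  have "P * Q = (\<Sum>M\<in>Poly_Mapping.keys P. \<Sum>N\<in>Poly_Mapping.keys Q. mterm (M + N) (coefficient P M * coefficient Q N))"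
    by (subst (1) pol_as_sum[of P], subst (1) pol_as_sum[of Q]) (simp add: sum_product mult_single)
  then have "evp (P * Q) p =
      (\<Sum>M\<in>Poly_Mapping.keys P. \<Sum>N\<in>Poly_Mapping.keys Q. coefficient P M * coefficient Q N * ev (M + N) p)"
    by (simp add: evp_sum)
  then show ?thesis by (simp add: evp_def sum_product algebra_simps)
qed

lemma evp_eq_imp_eq:
  assumes "\<And>p. evp P p = evp Q p"
  shows "P = Q"
proof (rule poly_mapping_eqI)
  fix M
  let ?S = "insert M (Poly_Mapping.keys P \<union> Poly_Mapping.keys Q)"
  have "(\<Sum>N\<in>?S. (coefficient P N - coefficient Q N) * ev N p) = 0" for p
  proof -
    have "evp P p = (\<Sum>N\<in>?S. coefficient P N * ev N p)" "evp Q p = (\<Sum>N\<in>?S. coefficient Q N * ev N p)"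
      by (rule evp_superset; auto)+
    with assms[of p] show ?thesis by (simp only: left_diff_distrib sum_subtractf diff_self)
  qed
  from monomials_independent[OF _ this, of M] show "coefficient P M = coefficient Q M" by simp
qed

definition represents :: "pol \<Rightarrow> (point \<Rightarrow> real) \<Rightarrow> bool" where
  "represents P F \<longleftrightarrow> (\<forall>p. complex_of_real (F p) = evp P p)"

lemma represents_unique: "represents P F \<Longrightarrow> represents Q F \<Longrightarrow> P = Q"
  unfolding represents_def by (metis evp_eq_imp_eq)

lemma represents_const: "represents (mterm {#} (of_real c)) (\<lambda>_. c)"
  by (simp add: represents_def)

lemma represents_add: "represents P F \<Longrightarrow> represents Q G \<Longrightarrow> represents (P + Q) (\<lambda>p. F p + G p)"
  by (simp add: represents_def)

lemma represents_mult: "represents P F \<Longrightarrow> represents Q G \<Longrightarrow> represents (P * Q) (\<lambda>p. F p * G p)"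
  by (simp add: represents_def)

definition Re_pol :: "mono \<Rightarrow> pol" where
  "Re_pol M = mterm M (1/2) + mterm (conj_mono M) (1/2)"

definition Im_pol :: "mono \<Rightarrow> pol" where
  "Im_pol M = mterm M (- \<i>/2) + mterm (conj_mono M) (\<i>/2)"

lemma represents_Re: "represents (Re_pol M) (\<lambda>p. Re (ev M p))"
  by (simp add: represents_def Re_pol_def complex_eq_iff)

lemma represents_Im: "represents (Im_pol M) (\<lambda>p. Im (ev M p))"
  by (simp add: represents_def Im_pol_def complex_eq_iff)

lemma point_as_combination:
  "p = lam1 p *\<^sub>R ((1,0,0,0,0,0,0,0,0),0) + lam2 p *\<^sub>R ((0,1,0,0,0,0,0,0,0),0) + lam3 p *\<^sub>R ((0,0,1,0,0,0,0,0,0),0)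
    + Re (z1a p) *\<^sub>R ((0,0,0,1,0,0,0,0,0),0) + Im (z1a p) *\<^sub>R ((0,0,0,\<i>,0,0,0,0,0),0)
    + Re (z1b p) *\<^sub>R ((0,0,0,0,1,0,0,0,0),0) + Im (z1b p) *\<^sub>R ((0,0,0,0,\<i>,0,0,0,0),0)
    + Re (z2a p) *\<^sub>R ((0,0,0,0,0,1,0,0,0),0) + Im (z2a p) *\<^sub>R ((0,0,0,0,0,\<i>,0,0,0),0)
    + Re (z2b p) *\<^sub>R ((0,0,0,0,0,0,1,0,0),0) + Im (z2b p) *\<^sub>R ((0,0,0,0,0,0,\<i>,0,0),0)
    + Re (z3 p) *\<^sub>R ((0,0,0,0,0,0,0,1,0),0) + Im (z3 p) *\<^sub>R ((0,0,0,0,0,0,0,\<i>,0),0)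
    + Re (z4 p) *\<^sub>R ((0,0,0,0,0,0,0,0,1),0) + Im (z4 p) *\<^sub>R ((0,0,0,0,0,0,0,0,\<i>),0)
    + Re (zx p) *\<^sub>R ((0,0,0,0,0,0,0,0,0),1) + Im (zx p) *\<^sub>R ((0,0,0,0,0,0,0,0,0),\<i>)"
proof -
  obtain l1 l2 l3 a1 b1 a2 b2 a3 a4 z where "p = ((l1, l2, l3, a1, b1, a2, b2, a3, a4), z)"
    by (metis prod.exhaust_sel)
  then show ?thesis
    by (simp add: complex_eq_iff lam1_def lam2_def lam3_def z1a_def z1b_def z2a_def z2b_def z3_def z4_def zx_def)
qed

lemma real_polynomial_represented:
  assumes "real_polynomial_function (F :: point \<Rightarrow> real)"
  obtains P where "represents P F"
proof -
  have scaled: "\<exists>P. represents P (\<lambda>p. F p * c)" if "\<exists>P. represents P F" for F c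
    using that represents_mult represents_const by blast
  have plus: "\<exists>P. represents P (\<lambda>p. F p + G p)" if "\<exists>P. represents P F" "\<exists>P. represents P G" for F G
    using that represents_add by blast
  have re: "\<exists>P. represents P (\<lambda>p. Re (val l p))" and im: "\<exists>P. represents P (\<lambda>p. Im (val l p))" for l
    using represents_Re[of "{#l#}"] represents_Im[of "{#l#}"] by auto
  from assms have "\<exists>P. represents P F"
  proof (induction rule: real_polynomial_function.induct)
    case (linear f)
    then interpret f: bounded_linear f .
    note coords = re[of Lam1] re[of Lam2] re[of Lam3] re[of A1] re[of B1] re[of A2] re[of B2] re[of A3] re[of A4]
      re[of X] im[of A1] im[of B1] im[of A2] im[of B2] im[of A3] im[of A4] im[of X]
    have "\<exists>P. represents P (\<lambda>p. f p)"
      by (subst point_as_combination, unfold f.add f.scaleR real_scaleR_def, intro plus scaled)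
        (use coords in simp_all)
    then show ?case by simp
  next
    case (const c)
    then show ?case using represents_const by blast
  qed (auto intro: plus represents_mult)
  with that show ?thesis by blast
qed

lemma real_polynomial_val: "real_polynomial_function (\<lambda>p. Re (val l p))" "real_polynomial_function (\<lambda>p. Im (val l p))"
proof -
  have lin: "bounded_linear lam1" "bounded_linear lam2" "bounded_linear lam3" "bounded_linear z1a"
    "bounded_linear z1b" "bounded_linear z2a" "bounded_linear z2b" "bounded_linear z3" "bounded_linear z4"
    "bounded_linear zx"
    by (intro linear_conv_bounded_linear[THEN iffD1] linearI;
        auto simp: lam1_def lam2_def lam3_def z1a_def z1b_def z2a_def z2b_def z3_def z4_def zx_def)+
  note parts = lin(4-)[THEN bounded_linear_compose[OF bounded_linear_Re]]
    lin(4-)[THEN bounded_linear_compose[OF bounded_linear_Im]]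
  note coords = real_polynomial_function.intros(1)[OF lin(1)] real_polynomial_function.intros(1)[OF lin(2)]
    real_polynomial_function.intros(1)[OF lin(3)] parts[THEN real_polynomial_function.intros(1)]
  show "real_polynomial_function (\<lambda>p. Re (val l p))"
    by (cases l) (use coords in simp_all)
  show "real_polynomial_function (\<lambda>p. Im (val l p))"
    by (cases l) (use coords real_polynomial_function.intros(2)[of 0] in \<open>simp_all add: real_polynomial_function_minus\<close>)
qed

lemma real_polynomial_ev: "real_polynomial_function (\<lambda>p. Re (ev M p)) \<and> real_polynomial_function (\<lambda>p. Im (ev M p))"
  by (induction M) (auto intro!: real_polynomial_val real_polynomial_function_diff)

section \<open>Invariant polynomials are combinations of monomials of weight zero\<close>

definition rotate_point :: "real \<Rightarrow> point \<Rightarrow> point" where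
  "rotate_point \<theta> p = assign (\<lambda>l. cis (\<theta> * of_int (wtl l)) * val l p)"

definition reflect_point :: "point \<Rightarrow> point" where
  "reflect_point p = assign (\<lambda>l. cnj (val l p))"

lemma ev_rotate: "ev M (rotate_point \<theta> p) = cis (\<theta> * of_int (wt M)) * ev M p"
proof (induction M)
  case (add l M)
  have "val l (rotate_point \<theta> p) = cis (\<theta> * of_int (wtl l)) * val l p"
    by (simp add: rotate_point_def val_assign cis_cnj)
  then show ?case using add by (simp add: cis_mult algebra_simps flip: mult.assoc)
qed simp

lemma ev_reflect: "ev M (reflect_point p) = cnj (ev M p)"
  by (induction M) (simp_all add: reflect_point_def val_assign)

definition weight_zero :: "pol \<Rightarrow> bool" where
  "weight_zero P \<longleftrightarrow> (\<forall>M\<in>Poly_Mapping.keys P. wt M = 0)"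

definition SO2_invariants :: "(point \<Rightarrow> real) set" where
  "SO2_invariants = {F. real_polynomial_function F \<and> (\<forall>\<theta> p. F (rotate_point \<theta> p) = F p)}"

definition O2_invariants :: "(point \<Rightarrow> real) set" where
  "O2_invariants = {F \<in> SO2_invariants. \<forall>p. F (reflect_point p) = F p}"

lemma invariant_represented:
  assumes "F \<in> SO2_invariants"
  obtains P where "represents P F" "weight_zero P"
proof -
  obtain P where P: "represents P F"
    using assms real_polynomial_represented by (auto simp: SO2_invariants_def)
  have "wt M = 0" if M: "M \<in> Poly_Mapping.keys P" for M
  proof (rule ccontr)
    assume w: "wt M \<noteq> 0"
    \<comment> \<open>Rotation by this angle multiplies the monomials with the weight of \<open>M\<close> by -1.\<close>
    define \<theta> where "\<theta> = pi / of_int (wt M)"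
    have "(\<Sum>N\<in>Poly_Mapping.keys P. coefficient P N * (cis (\<theta> * of_int (wt N)) - 1) * ev N p) = 0" for p
    proof -
      have "complex_of_real (F (rotate_point \<theta> p)) = complex_of_real (F p)"
        using assms by (simp add: SO2_invariants_def)
      then have "evp P (rotate_point \<theta> p) - evp P p = 0"
        using P unfolding represents_def by (metis diff_self)
      then show ?thesis by (simp add: evp_def ev_rotate algebra_simps sum_subtractf)
    qed
    from monomials_independent[OF _ this M]
    have "coefficient P M * (cis (\<theta> * of_int (wt M)) - 1) = 0" by simp
    moreover have "cis (\<theta> * of_int (wt M)) = -1" using w by (simp add: \<theta>_def)
    ultimately show False using M by (simp add: in_keys_iff)
  qed
  with P that show ?thesis by (auto simp: weight_zero_def)
qed

lemma restrict_UNIV [simp]: "restrict f UNIV = f"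
  by (simp add: restrict_def)

abbreviation alg :: "(point \<Rightarrow> real) set \<Rightarrow> (point \<Rightarrow> real) set" where
  "alg \<equiv> generated_algebra UNIV"

lemma alg_const: "(\<lambda>_. c) \<in> alg S"
  using generated_algebra.const[of c UNIV S] by simp

lemma alg_add: "F \<in> alg S \<Longrightarrow> G \<in> alg S \<Longrightarrow> (\<lambda>p. F p + G p) \<in> alg S"
  using generated_algebra.add[of F UNIV S G] by simp

lemma alg_mult: "F \<in> alg S \<Longrightarrow> G \<in> alg S \<Longrightarrow> (\<lambda>p. F p * G p) \<in> alg S"
  using generated_algebra.mult[of F UNIV S G] by simp

lemma alg_scale: "F \<in> alg S \<Longrightarrow> (\<lambda>p. c * F p) \<in> alg S"
  by (intro alg_mult alg_const)

lemma alg_uminus: "F \<in> alg S \<Longrightarrow> (\<lambda>p. - F p) \<in> alg S"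
  using alg_scale[of F S "-1"] by simp

lemma alg_diff: "F \<in> alg S \<Longrightarrow> G \<in> alg S \<Longrightarrow> (\<lambda>p. F p - G p) \<in> alg S"
  using alg_add[of F S "\<lambda>p. - G p"] alg_uminus[of G S] by simp

lemma alg_sum: "(\<And>i. i \<in> I \<Longrightarrow> F i \<in> alg S) \<Longrightarrow> (\<lambda>p. \<Sum>i\<in>I. F i p) \<in> alg S"
  by (induction I rule: infinite_finite_induct) (auto intro: alg_const alg_add)

lemma SO2_invariant_in_alg:
  assumes "F \<in> SO2_invariants"
    and "\<And>M. wt M = 0 \<Longrightarrow> (\<lambda>p. Re (ev M p)) \<in> alg S"
    and "\<And>M. wt M = 0 \<Longrightarrow> (\<lambda>p. Im (ev M p)) \<in> alg S"
  shows "F \<in> alg S"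
proof -
  obtain P where P: "represents P F" "weight_zero P" using invariant_represented[OF assms(1)] .
  have "F p = (\<Sum>M\<in>Poly_Mapping.keys P. Re (coefficient P M) * Re (ev M p) - Im (coefficient P M) * Im (ev M p))" for p
    using arg_cong[OF P(1)[unfolded represents_def, rule_format, of p], of Re] by (simp add: evp_def)
  moreover have "(\<lambda>p. \<Sum>M\<in>Poly_Mapping.keys P.
      Re (coefficient P M) * Re (ev M p) - Im (coefficient P M) * Im (ev M p)) \<in> alg S"
    using P(2) by (intro alg_sum alg_diff alg_scale assms) (auto simp: weight_zero_def)
  ultimately show ?thesis by presburger
qed

text \<open>
  Averaging over the reflection replaces every monomial by its real part and removes the imaginary
  parts of the coefficients.
\<close>

lemma O2_invariant_in_alg:
  assumes "F \<in> O2_invariants" and "\<And>M. wt M = 0 \<Longrightarrow> (\<lambda>p. Re (ev M p)) \<in> alg S"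
  shows "F \<in> alg S"
proof -
  have "F \<in> SO2_invariants" using assms(1) by (simp add: O2_invariants_def)
  then obtain P where P: "represents P F" "weight_zero P" using invariant_represented by blast
  have F: "F p = (\<Sum>M\<in>Poly_Mapping.keys P. Re (coefficient P M) * Re (ev M p))" for p
  proof -
    have "F p = Re (evp P p)" "F p = Re (evp P (reflect_point p))"
      using assms(1) P(1) unfolding O2_invariants_def represents_def by (metis (mono_tags, lifting) Re_complex_of_real mem_Collect_eq)+
    then have "F p = (Re (evp P p) + Re (evp P (reflect_point p))) / 2" by simp
    also have "\<dots> = (\<Sum>M\<in>Poly_Mapping.keys P. Re (coefficient P M) * Re (ev M p))"
      by (simp add: evp_def ev_reflect sum_divide_distrib mult.commute flip: sum.distrib)
    finally show ?thesis .
  qed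
  have "(\<lambda>p. \<Sum>M\<in>Poly_Mapping.keys P. Re (coefficient P M) * Re (ev M p)) \<in> alg S"
    using P(2) by (intro alg_sum alg_scale assms) (auto simp: weight_zero_def)
  then show ?thesis using F by presburger
qed

lemma Re_invariant: "wt M = 0 \<Longrightarrow> (\<lambda>p. Re (ev M p)) \<in> O2_invariants"
  using real_polynomial_ev[of M] by (simp add: O2_invariants_def SO2_invariants_def ev_rotate ev_reflect)

lemma Im_invariant: "wt M = 0 \<Longrightarrow> (\<lambda>p. Im (ev M p)) \<in> SO2_invariants"
  using real_polynomial_ev[of M] by (simp add: SO2_invariants_def ev_rotate)

lemma Im_Im_invariant: "wt M = 0 \<Longrightarrow> wt N = 0 \<Longrightarrow> (\<lambda>p. Im (ev M p) * Im (ev N p)) \<in> O2_invariants"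
  using real_polynomial_ev[of M] real_polynomial_ev[of N]
  by (auto simp: O2_invariants_def SO2_invariants_def ev_rotate ev_reflect)

lemma alg_subset_SO2_invariants:
  assumes "S \<subseteq> SO2_invariants"
  shows "alg S \<subseteq> SO2_invariants"
proof
  fix F assume "F \<in> alg S"
  then show "F \<in> SO2_invariants"
    by (induction rule: generated_algebra.induct) (use assms in \<open>auto simp: SO2_invariants_def\<close>)
qed

lemma alg_subset_O2_invariants:
  assumes "S \<subseteq> O2_invariants"
  shows "alg S \<subseteq> O2_invariants"
proof
  fix F assume "F \<in> alg S"
  then show "F \<in> O2_invariants"
    by (induction rule: generated_algebra.induct)
      (use assms in \<open>auto simp: O2_invariants_def SO2_invariants_def\<close>)
qed

section \<open>The irreducible monomials of weight zero\<close>

definition irreducible_mono :: "mono \<Rightarrow> bool" where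
  "irreducible_mono M \<longleftrightarrow> M \<noteq> {#} \<and> wt M = 0 \<and> (\<forall>N. N \<subseteq># M \<longrightarrow> wt N = 0 \<longrightarrow> N = {#} \<or> N = M)"

definition basic_monomials :: "letter list list" where
  "basic_monomials = [[Lam1], [Lam2], [Lam3], [A1, A1'], [B1, B1'], [A2, A2'], [B2, B2'], [A3, A3'],
    [A4, A4'], [X, X']]"

definition nonreal_monomials :: "letter list list" where
  "nonreal_monomials = [
    [A1, B1'], [A2, B2'], [A1, A1, A2'], [A1, A1, B2'], [B1, B1, A2'], [B1, B1, B2'],
    [A2, A2, A4'], [B2, B2, A4'], [A1, B1, A2'], [A1, B1, B2'], [A1, A2, A3'], [B1, A2, A3'],
    [B1, B2, A3'], [A1, B2, A3'], [A2, B2, A4'], [A1, A3, A4'], [B1, A3, A4'], [A1, A1, A1, A3'],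
    [A1, A1, B1, A3'], [A1, B1, B1, A3'], [B1, B1, B1, A3'], [A1, A2', A2', A3],
    [B1, A2', A2', A3], [A1, A2', B2', A3], [B1, A2', B2', A3], [A1, B2', B2', A3],
    [B1, B2', B2', A3], [A1, A1, A2, A4'], [A1, B1, A2, A4'], [B1, B1, A2, A4'], [A1, A1, B2, A4'],
    [A1, B1, B2, A4'], [B1, B1, B2, A4'], [A1, A2', A3', A4], [B1, A2', A3', A4],
    [A1, B2', A3', A4], [B1, B2', A3', A4], [A2, A3', A3', A4], [B2, A3', A3', A4],
    [A2, A2, A2, A3', A3'], [A2, A2, B2, A3', A3'], [A2, B2, B2, A3', A3'], [B2, B2, B2, A3', A3'],
    [A1, A1, A1, A1, A4'], [A1, A1, A1, B1, A4'], [A1, A1, B1, B1, A4'], [A1, B1, B1, B1, A4'],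
    [B1, B1, B1, B1, A4'], [A2, A3, A3, A4', A4'], [B2, A3, A3, A4', A4'], [A1, A1, A3', A3', A4],
    [A1, B1, A3', A3', A4], [B1, B1, A3', A3', A4], [A1, A3', A3', A3', A4, A4],
    [B1, A3', A3', A3', A4, A4], [A3, A3, A3, A3, A4', A4', A4'], [A1', X], [B1', X], [A1, A2', X],
    [B1, A2', X], [A1, B2', X], [B1, B2', X], [A2, A3', X], [B2, A3', X], [A3, A4', X],
    [A1, A1, A3', X], [B2', B2', A3, X], [B1, B1, A3', X], [A2', A2', A3, X], [A2', B2', A3, X],
    [A1, B1, A3', X], [A2', A3', A4, X], [B2', A3', A4, X], [A1, A2, A4', X], [B1, A2, A4', X],
    [A1, B2, A4', X], [B1, B2, A4', X], [A1, A1, A1, A4', X], [B1, B1, B1, A4', X],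
    [A1, A3', A3', A4, X], [B1, A3', A3', A4, X], [A1, A1, B1, A4', X], [A1, B1, B1, A4', X],
    [A3', A3', A3', A4, A4, X], [A2', X, X], [B2', X, X], [A1, A3', X, X], [B1, A3', X, X],
    [A2, A4', X, X], [B2, A4', X, X], [A1, A1, A4', X, X], [B1, B1, A4', X, X],
    [A3', A3', A4, X, X], [A1, B1, A4', X, X], [A3', X, X, X], [A1, A4', X, X, X],
    [B1, A4', X, X, X], [A4', X, X, X, X]]"

definition generator_monomials :: "letter list list" where
  "generator_monomials = basic_monomials @ nonreal_monomials"

text \<open>
  The weights occurring in a monomial decide whether it is irreducible. These are the minimal
  zero-sum multisets of weights from 1 to 4 in absolute value, one of each pair of opposite ones.
\<close>

definition weight_patterns :: "int list list" where
  "weight_patterns = [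
    [1, -1], [2, -2], [3, -3], [4, -4], [1, 1, -2], [2, 2, -4], [1, 2, -3], [1, 3, -4],
    [1, 1, 1, -3], [1, -2, -2, 3], [1, 1, 2, -4], [1, -2, -3, 4], [2, -3, -3, 4],
    [2, 2, 2, -3, -3], [1, 1, 1, 1, -4], [2, 3, 3, -4, -4], [1, 1, -3, -3, 4],
    [1, -3, -3, -3, 4, 4], [3, 3, 3, 3, -4, -4, -4]]"

definition signed_patterns :: "int list list" where
  "signed_patterns = [0] # weight_patterns @ map (map uminus) weight_patterns"

lemma mset_subseteq_iff_count_list: "mset xs \<subseteq># W \<longleftrightarrow> (\<forall>x\<in>set xs. count_list xs x \<le> count W x)"
proof -
  have "count (mset xs) x = count_list xs x" for x by (induction xs) auto
  then show ?thesis
    by (simp add: subseteq_mset_def) (metis count_list_0_iff le0)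
qed

lemma sum_mset_small_weights:
  assumes "set_mset W \<subseteq> {-4..4 :: int}"
  shows "\<Sum>\<^sub># W = (int (count W 1) - int (count W (-1))) + 2 * (int (count W 2) - int (count W (-2)))
    + 3 * (int (count W 3) - int (count W (-3))) + 4 * (int (count W 4) - int (count W (-4)))"
  using assms
proof (induction W)
  case (add x W)
  have "-4 \<le> x \<and> x \<le> 4" using add.prems by simp
  then have "x = -4 \<or> x = -3 \<or> x = -2 \<or> x = -1 \<or> x = 0 \<or> x = 1 \<or> x = 2 \<or> x = 3 \<or> x = 4"
    by presburger
  then show ?case using add by auto
qed simp

text \<open>
  A zero-sum family of weights without two opposite ones has a sign for each absolute value; in
  each of the eight distributions of signs, up to a global one, the patterns that fit leave
  finitely many small cases. In the names, p and m stand for the signs of the weights 1 to 4.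
\<close>

lemma zero_sum_pppp:
  fixes n1 n2 n3 n4 :: int
  assumes "0 \<le> n1" "0 \<le> n2" "0 \<le> n3" "0 \<le> n4" "n1 + 2 * n2 + 3 * n3 + 4 * n4 = 0"
  shows "n1 = 0 \<and> n2 = 0 \<and> n3 = 0 \<and> n4 = 0"
  using assms by (smt (verit))

lemma zero_sum_pppm:
  fixes n1 n2 n3 n4 :: int
  assumes "0 \<le> n1" "0 \<le> n2" "0 \<le> n3" "0 \<le> n4" "n1 + 2 * n2 + 3 * n3 = 4 * n4"
    "\<not> (2 \<le> n2 \<and> 1 \<le> n4)"
    "\<not> (1 \<le> n1 \<and> 1 \<le> n3 \<and> 1 \<le> n4)"
    "\<not> (2 \<le> n1 \<and> 1 \<le> n2 \<and> 1 \<le> n4)"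
    "\<not> (4 \<le> n1 \<and> 1 \<le> n4)"
    "\<not> (1 \<le> n2 \<and> 2 \<le> n3 \<and> 2 \<le> n4)"
    "\<not> (4 \<le> n3 \<and> 3 \<le> n4)"
  shows "n1 = 0 \<and> n2 = 0 \<and> n3 = 0 \<and> n4 = 0"
  using assms by (smt (verit))

lemma zero_sum_ppmp:
  fixes n1 n2 n3 n4 :: int
  assumes "0 \<le> n1" "0 \<le> n2" "0 \<le> n3" "0 \<le> n4" "n1 + 2 * n2 + 4 * n4 = 3 * n3"
    "\<not> (1 \<le> n1 \<and> 1 \<le> n2 \<and> 1 \<le> n3)"
    "\<not> (3 \<le> n1 \<and> 1 \<le> n3)"
    "\<not> (1 \<le> n2 \<and> 2 \<le> n3 \<and> 1 \<le> n4)"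
    "\<not> (3 \<le> n2 \<and> 2 \<le> n3)"
    "\<not> (2 \<le> n1 \<and> 2 \<le> n3 \<and> 1 \<le> n4)"
    "\<not> (1 \<le> n1 \<and> 3 \<le> n3 \<and> 2 \<le> n4)"
    "\<not> (4 \<le> n3 \<and> 3 \<le> n4)"
  shows "n1 = 0 \<and> n2 = 0 \<and> n3 = 0 \<and> n4 = 0"
  using assms by (smt (verit))

lemma zero_sum_ppmm:
  fixes n1 n2 n3 n4 :: int
  assumes "0 \<le> n1" "0 \<le> n2" "0 \<le> n3" "0 \<le> n4" "n1 + 2 * n2 = 3 * n3 + 4 * n4"
    "\<not> (2 \<le> n2 \<and> 1 \<le> n4)"
    "\<not> (1 \<le> n1 \<and> 1 \<le> n2 \<and> 1 \<le> n3)"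
    "\<not> (3 \<le> n1 \<and> 1 \<le> n3)"
    "\<not> (2 \<le> n1 \<and> 1 \<le> n2 \<and> 1 \<le> n4)"
    "\<not> (3 \<le> n2 \<and> 2 \<le> n3)"
    "\<not> (4 \<le> n1 \<and> 1 \<le> n4)"
  shows "n1 = 0 \<and> n2 = 0 \<and> n3 = 0 \<and> n4 = 0"
  using assms by (smt (verit))

lemma zero_sum_pmpp:
  fixes n1 n2 n3 n4 :: int
  assumes "0 \<le> n1" "0 \<le> n2" "0 \<le> n3" "0 \<le> n4" "n1 + 3 * n3 + 4 * n4 = 2 * n2"
    "\<not> (2 \<le> n1 \<and> 1 \<le> n2)"
    "\<not> (1 \<le> n1 \<and> 2 \<le> n2 \<and> 1 \<le> n3)"
    "\<not> (2 \<le> n2 \<and> 1 \<le> n4)"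
    "\<not> (3 \<le> n2 \<and> 2 \<le> n3)"
  shows "n1 = 0 \<and> n2 = 0 \<and> n3 = 0 \<and> n4 = 0"
  using assms by (smt (verit))

lemma zero_sum_pmpm:
  fixes n1 n2 n3 n4 :: int
  assumes "0 \<le> n1" "0 \<le> n2" "0 \<le> n3" "0 \<le> n4" "n1 + 3 * n3 = 2 * n2 + 4 * n4"
    "\<not> (2 \<le> n1 \<and> 1 \<le> n2)"
    "\<not> (1 \<le> n1 \<and> 1 \<le> n3 \<and> 1 \<le> n4)"
    "\<not> (1 \<le> n1 \<and> 2 \<le> n2 \<and> 1 \<le> n3)"
    "\<not> (4 \<le> n1 \<and> 1 \<le> n4)"
    "\<not> (4 \<le> n3 \<and> 3 \<le> n4)"
    "\<not> (1 \<le> n2 \<and> 2 \<le> n3 \<and> 1 \<le> n4)"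
    "\<not> (3 \<le> n2 \<and> 2 \<le> n3)"
  shows "n1 = 0 \<and> n2 = 0 \<and> n3 = 0 \<and> n4 = 0"
  using assms by (smt (verit))

lemma zero_sum_pmmp:
  fixes n1 n2 n3 n4 :: int
  assumes "0 \<le> n1" "0 \<le> n2" "0 \<le> n3" "0 \<le> n4" "n1 + 4 * n4 = 2 * n2 + 3 * n3"
    "\<not> (2 \<le> n1 \<and> 1 \<le> n2)"
    "\<not> (3 \<le> n1 \<and> 1 \<le> n3)"
    "\<not> (1 \<le> n1 \<and> 1 \<le> n2 \<and> 1 \<le> n3 \<and> 1 \<le> n4)"
    "\<not> (2 \<le> n1 \<and> 2 \<le> n3 \<and> 1 \<le> n4)"
    "\<not> (1 \<le> n1 \<and> 3 \<le> n3 \<and> 2 \<le> n4)"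
    "\<not> (2 \<le> n2 \<and> 1 \<le> n4)"
    "\<not> (1 \<le> n2 \<and> 2 \<le> n3 \<and> 2 \<le> n4)"
    "\<not> (4 \<le> n3 \<and> 3 \<le> n4)"
  shows "n1 = 0 \<and> n2 = 0 \<and> n3 = 0 \<and> n4 = 0"
  using assms by (smt (verit))

lemma zero_sum_pmmm:
  fixes n1 n2 n3 n4 :: int
  assumes "0 \<le> n1" "0 \<le> n2" "0 \<le> n3" "0 \<le> n4" "n1 = 2 * n2 + 3 * n3 + 4 * n4"
    "\<not> (2 \<le> n1 \<and> 1 \<le> n2)"
    "\<not> (3 \<le> n1 \<and> 1 \<le> n3)"
    "\<not> (4 \<le> n1 \<and> 1 \<le> n4)"
  shows "n1 = 0 \<and> n2 = 0 \<and> n3 = 0 \<and> n4 = 0"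
  using assms by (smt (verit))

lemma zero_sum_contains_pattern:
  fixes W :: "int multiset"
  assumes "set_mset W \<subseteq> {-4..4}" "\<Sum>\<^sub># W = 0" "W \<noteq> {#}"
  shows "\<exists>p\<in>set signed_patterns. mset p \<subseteq># W"
proof (rule ccontr)
  assume no: "\<not> ?thesis"
  define c where "c k = int (count W k)" for k
  have nonneg: "0 \<le> c k" for k by (simp add: c_def)
  have le: "n \<le> count W k \<longleftrightarrow> int n \<le> c k" for n k by (simp add: c_def)
  have free: "\<forall>p\<in>set signed_patterns. \<not> (\<forall>x\<in>set p. int (count_list p x) \<le> c x)"
    using no by (simp add: mset_subseteq_iff_count_list le)
  note pattern_defs = signed_patterns_def weight_patterns_def
  have free1: "\<not> (1 \<le> c 1 \<and> 1 \<le> c (-1))"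
    using free[rule_format, of "[1, -1]"] by (simp add: pattern_defs)
  have free2: "\<not> (1 \<le> c 2 \<and> 1 \<le> c (-2))"
    using free[rule_format, of "[2, -2]"] by (simp add: pattern_defs)
  have free3: "\<not> (1 \<le> c 3 \<and> 1 \<le> c (-3))"
    using free[rule_format, of "[3, -3]"] by (simp add: pattern_defs)
  have free4: "\<not> (1 \<le> c 4 \<and> 1 \<le> c (-4))"
    using free[rule_format, of "[4, -4]"] by (simp add: pattern_defs)
  have free5: "\<not> (2 \<le> c 1 \<and> 1 \<le> c (-2))"
    using free[rule_format, of "[1, 1, -2]"] by (simp add: pattern_defs)
  have free6: "\<not> (2 \<le> c 2 \<and> 1 \<le> c (-4))"
    using free[rule_format, of "[2, 2, -4]"] by (simp add: pattern_defs)
  have free7: "\<not> (1 \<le> c 1 \<and> 1 \<le> c 2 \<and> 1 \<le> c (-3))"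
    using free[rule_format, of "[1, 2, -3]"] by (simp add: pattern_defs)
  have free8: "\<not> (1 \<le> c 1 \<and> 1 \<le> c 3 \<and> 1 \<le> c (-4))"
    using free[rule_format, of "[1, 3, -4]"] by (simp add: pattern_defs)
  have free9: "\<not> (3 \<le> c 1 \<and> 1 \<le> c (-3))"
    using free[rule_format, of "[1, 1, 1, -3]"] by (simp add: pattern_defs)
  have free10: "\<not> (1 \<le> c 1 \<and> 2 \<le> c (-2) \<and> 1 \<le> c 3)"
    using free[rule_format, of "[1, -2, -2, 3]"] by (simp add: pattern_defs)
  have free11: "\<not> (2 \<le> c 1 \<and> 1 \<le> c 2 \<and> 1 \<le> c (-4))"
    using free[rule_format, of "[1, 1, 2, -4]"] by (simp add: pattern_defs)
  have free12: "\<not> (1 \<le> c 1 \<and> 1 \<le> c (-2) \<and> 1 \<le> c (-3) \<and> 1 \<le> c 4)"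
    using free[rule_format, of "[1, -2, -3, 4]"] by (simp add: pattern_defs)
  have free13: "\<not> (1 \<le> c 2 \<and> 2 \<le> c (-3) \<and> 1 \<le> c 4)"
    using free[rule_format, of "[2, -3, -3, 4]"] by (simp add: pattern_defs)
  have free14: "\<not> (3 \<le> c 2 \<and> 2 \<le> c (-3))"
    using free[rule_format, of "[2, 2, 2, -3, -3]"] by (simp add: pattern_defs)
  have free15: "\<not> (4 \<le> c 1 \<and> 1 \<le> c (-4))"
    using free[rule_format, of "[1, 1, 1, 1, -4]"] by (simp add: pattern_defs)
  have free16: "\<not> (1 \<le> c 2 \<and> 2 \<le> c 3 \<and> 2 \<le> c (-4))"
    using free[rule_format, of "[2, 3, 3, -4, -4]"] by (simp add: pattern_defs)
  have free17: "\<not> (2 \<le> c 1 \<and> 2 \<le> c (-3) \<and> 1 \<le> c 4)"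
    using free[rule_format, of "[1, 1, -3, -3, 4]"] by (simp add: pattern_defs)
  have free18: "\<not> (1 \<le> c 1 \<and> 3 \<le> c (-3) \<and> 2 \<le> c 4)"
    using free[rule_format, of "[1, -3, -3, -3, 4, 4]"] by (simp add: pattern_defs)
  have free19: "\<not> (4 \<le> c 3 \<and> 3 \<le> c (-4))"
    using free[rule_format, of "[3, 3, 3, 3, -4, -4, -4]"] by (simp add: pattern_defs)
  have free20: "\<not> (2 \<le> c (-1) \<and> 1 \<le> c 2)"
    using free[rule_format, of "[-1, -1, 2]"] by (simp add: pattern_defs)
  have free21: "\<not> (2 \<le> c (-2) \<and> 1 \<le> c 4)"
    using free[rule_format, of "[-2, -2, 4]"] by (simp add: pattern_defs)
  have free22: "\<not> (1 \<le> c (-1) \<and> 1 \<le> c (-2) \<and> 1 \<le> c 3)"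
    using free[rule_format, of "[-1, -2, 3]"] by (simp add: pattern_defs)
  have free23: "\<not> (1 \<le> c (-1) \<and> 1 \<le> c (-3) \<and> 1 \<le> c 4)"
    using free[rule_format, of "[-1, -3, 4]"] by (simp add: pattern_defs)
  have free24: "\<not> (3 \<le> c (-1) \<and> 1 \<le> c 3)"
    using free[rule_format, of "[-1, -1, -1, 3]"] by (simp add: pattern_defs)
  have free25: "\<not> (1 \<le> c (-1) \<and> 2 \<le> c 2 \<and> 1 \<le> c (-3))"
    using free[rule_format, of "[-1, 2, 2, -3]"] by (simp add: pattern_defs)
  have free26: "\<not> (2 \<le> c (-1) \<and> 1 \<le> c (-2) \<and> 1 \<le> c 4)"
    using free[rule_format, of "[-1, -1, -2, 4]"] by (simp add: pattern_defs)
  have free27: "\<not> (1 \<le> c (-1) \<and> 1 \<le> c 2 \<and> 1 \<le> c 3 \<and> 1 \<le> c (-4))"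
    using free[rule_format, of "[-1, 2, 3, -4]"] by (simp add: pattern_defs)
  have free28: "\<not> (1 \<le> c (-2) \<and> 2 \<le> c 3 \<and> 1 \<le> c (-4))"
    using free[rule_format, of "[-2, 3, 3, -4]"] by (simp add: pattern_defs)
  have free29: "\<not> (3 \<le> c (-2) \<and> 2 \<le> c 3)"
    using free[rule_format, of "[-2, -2, -2, 3, 3]"] by (simp add: pattern_defs)
  have free30: "\<not> (4 \<le> c (-1) \<and> 1 \<le> c 4)"
    using free[rule_format, of "[-1, -1, -1, -1, 4]"] by (simp add: pattern_defs)
  have free31: "\<not> (1 \<le> c (-2) \<and> 2 \<le> c (-3) \<and> 2 \<le> c 4)"
    using free[rule_format, of "[-2, -3, -3, 4, 4]"] by (simp add: pattern_defs)
  have free32: "\<not> (2 \<le> c (-1) \<and> 2 \<le> c 3 \<and> 1 \<le> c (-4))"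
    using free[rule_format, of "[-1, -1, 3, 3, -4]"] by (simp add: pattern_defs)
  have free33: "\<not> (1 \<le> c (-1) \<and> 3 \<le> c 3 \<and> 2 \<le> c (-4))"
    using free[rule_format, of "[-1, 3, 3, 3, -4, -4]"] by (simp add: pattern_defs)
  have free34: "\<not> (4 \<le> c (-3) \<and> 3 \<le> c 4)"
    using free[rule_format, of "[-3, -3, -3, -3, 4, 4, 4]"] by (simp add: pattern_defs)
  have free35: "\<not> 1 \<le> c 0"
    using free[rule_format, of "[0]"] by (simp add: pattern_defs)
  note free = free1 free2 free3 free4 free5 free6 free7 free8 free9 free10 free11 free12 free13 free14 free15 free16 free17 free18 free19 free20 free21 free22 free23 free24 free25 free26 free27 free28 free29 free30 free31 free32 free33 free34 free35
  have eq: "c 1 + 2 * c 2 + 3 * c 3 + 4 * c 4 = c (-1) + 2 * c (-2) + 3 * c (-3) + 4 * c (-4)"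
    using sum_mset_small_weights[OF assms(1)] assms(2) by (simp add: c_def)
  have e: "c 1 = 0 \<or> c (-1) = 0" "c 2 = 0 \<or> c (-2) = 0" "c 3 = 0 \<or> c (-3) = 0" "c 4 = 0 \<or> c (-4) = 0"
    using free(1-4) nonneg[of 1] nonneg[of 2] nonneg[of 3] nonneg[of 4]
      nonneg[of "-1"] nonneg[of "-2"] nonneg[of "-3"] nonneg[of "-4"] by linarith+
  have "c 0 = 0" using free(35) nonneg[of 0] by linarith
  have pppp: "c 1 = 0 \<and> c 2 = 0 \<and> c 3 = 0 \<and> c 4 = 0"
    if "c (-1) = 0" "c (-2) = 0" "c (-3) = 0" "c (-4) = 0"
    by (rule zero_sum_pppp) (fact nonneg free | use eq that in simp)+
  have pppm: "c 1 = 0 \<and> c 2 = 0 \<and> c 3 = 0 \<and> c (-4) = 0"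
    if "c (-1) = 0" "c (-2) = 0" "c (-3) = 0" "c 4 = 0"
    by (rule zero_sum_pppm) (fact nonneg free | use eq that in simp)+
  have ppmp: "c 1 = 0 \<and> c 2 = 0 \<and> c (-3) = 0 \<and> c 4 = 0"
    if "c (-1) = 0" "c (-2) = 0" "c 3 = 0" "c (-4) = 0"
    by (rule zero_sum_ppmp) (fact nonneg free | use eq that in simp)+
  have ppmm: "c 1 = 0 \<and> c 2 = 0 \<and> c (-3) = 0 \<and> c (-4) = 0"
    if "c (-1) = 0" "c (-2) = 0" "c 3 = 0" "c 4 = 0"
    by (rule zero_sum_ppmm) (fact nonneg free | use eq that in simp)+
  have pmpp: "c 1 = 0 \<and> c (-2) = 0 \<and> c 3 = 0 \<and> c 4 = 0"
    if "c (-1) = 0" "c 2 = 0" "c (-3) = 0" "c (-4) = 0"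
    by (rule zero_sum_pmpp) (fact nonneg free | use eq that in simp)+
  have pmpm: "c 1 = 0 \<and> c (-2) = 0 \<and> c 3 = 0 \<and> c (-4) = 0"
    if "c (-1) = 0" "c 2 = 0" "c (-3) = 0" "c 4 = 0"
    by (rule zero_sum_pmpm) (fact nonneg free | use eq that in simp)+
  have pmmp: "c 1 = 0 \<and> c (-2) = 0 \<and> c (-3) = 0 \<and> c 4 = 0"
    if "c (-1) = 0" "c 2 = 0" "c 3 = 0" "c (-4) = 0"
    by (rule zero_sum_pmmp) (fact nonneg free | use eq that in simp)+
  have pmmm: "c 1 = 0 \<and> c (-2) = 0 \<and> c (-3) = 0 \<and> c (-4) = 0"
    if "c (-1) = 0" "c 2 = 0" "c 3 = 0" "c 4 = 0"
    by (rule zero_sum_pmmm) (fact nonneg free | use eq that in simp)+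
  have mppp: "c (-1) = 0 \<and> c 2 = 0 \<and> c 3 = 0 \<and> c 4 = 0"
    if "c 1 = 0" "c (-2) = 0" "c (-3) = 0" "c (-4) = 0"
    by (rule zero_sum_pmmm) (fact nonneg free | use eq that in simp)+
  have mppm: "c (-1) = 0 \<and> c 2 = 0 \<and> c 3 = 0 \<and> c (-4) = 0"
    if "c 1 = 0" "c (-2) = 0" "c (-3) = 0" "c 4 = 0"
    by (rule zero_sum_pmmp) (fact nonneg free | use eq that in simp)+
  have mpmp: "c (-1) = 0 \<and> c 2 = 0 \<and> c (-3) = 0 \<and> c 4 = 0"
    if "c 1 = 0" "c (-2) = 0" "c 3 = 0" "c (-4) = 0"
    by (rule zero_sum_pmpm) (fact nonneg free | use eq that in simp)+
  have mpmm: "c (-1) = 0 \<and> c 2 = 0 \<and> c (-3) = 0 \<and> c (-4) = 0"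
    if "c 1 = 0" "c (-2) = 0" "c 3 = 0" "c 4 = 0"
    by (rule zero_sum_pmpp) (fact nonneg free | use eq that in simp)+
  have mmpp: "c (-1) = 0 \<and> c (-2) = 0 \<and> c 3 = 0 \<and> c 4 = 0"
    if "c 1 = 0" "c 2 = 0" "c (-3) = 0" "c (-4) = 0"
    by (rule zero_sum_ppmm) (fact nonneg free | use eq that in simp)+
  have mmpm: "c (-1) = 0 \<and> c (-2) = 0 \<and> c 3 = 0 \<and> c (-4) = 0"
    if "c 1 = 0" "c 2 = 0" "c (-3) = 0" "c 4 = 0"
    by (rule zero_sum_ppmp) (fact nonneg free | use eq that in simp)+
  have mmmp: "c (-1) = 0 \<and> c (-2) = 0 \<and> c (-3) = 0 \<and> c 4 = 0"
    if "c 1 = 0" "c 2 = 0" "c 3 = 0" "c (-4) = 0"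
    by (rule zero_sum_pppm) (fact nonneg free | use eq that in simp)+
  have mmmm: "c (-1) = 0 \<and> c (-2) = 0 \<and> c (-3) = 0 \<and> c (-4) = 0"
    if "c 1 = 0" "c 2 = 0" "c 3 = 0" "c 4 = 0"
    by (rule zero_sum_pppp) (fact nonneg free | use eq that in simp)+
  have all0: "c 1 = 0 \<and> c 2 = 0 \<and> c 3 = 0 \<and> c 4 = 0 \<and> c (-1) = 0 \<and> c (-2) = 0 \<and> c (-3) = 0 \<and> c (-4) = 0"
    using e pppp pppm ppmp ppmm pmpp pmpm pmmp pmmm mppp mppm mpmp mpmm mmpp mmpm mmmp mmmm by argo
  obtain x where x: "x \<in># W" using assms(3) by auto
  with assms(1) have "-4 \<le> x \<and> x \<le> 4" by auto
  then have "x = -4 \<or> x = -3 \<or> x = -2 \<or> x = -1 \<or> x = 0 \<or> x = 1 \<or> x = 2 \<or> x = 3 \<or> x = 4"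
    by presburger
  with all0 \<open>c 0 = 0\<close> have "count W x = 0" by (auto simp: c_def)
  with x show False by (simp add: not_in_iff[symmetric])
qed

definition letters_of_weight :: "int \<Rightarrow> letter list" where
  "letters_of_weight w = filter (\<lambda>l. wtl l = w)
    [Lam1, Lam2, Lam3, A1, A1', B1, B1', A2, A2', B2, B2', A3, A3', A4, A4', X, X']"

lemma set_letters_of_weight: "set (letters_of_weight w) = {l. wtl l = w}"
proof -
  have "l \<in> set [Lam1, Lam2, Lam3, A1, A1', B1, B1', A2, A2', B2, B2', A3, A3', A4, A4', X, X']" for l
    by (cases l) simp_all
  then show ?thesis unfolding letters_of_weight_def set_filter by blast
qed

lemma in_product_lists_letters:
  "xs \<in> set (product_lists (map letters_of_weight p)) \<longleftrightarrow> map wtl xs = p"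
proof -
  have "list_all2 (\<lambda>x ys. x \<in> set ys) xs (map letters_of_weight p) \<longleftrightarrow> map wtl xs = p"
    unfolding list_all2_map2 set_letters_of_weight
    by (induction p arbitrary: xs) (auto simp: list_all2_Cons2)
  then show ?thesis by (simp add: product_lists_set)
qed

lemma subset_of_image_lifts:
  assumes "mset p \<subseteq># image_mset f M"
  shows "\<exists>xs. mset xs \<subseteq># M \<and> map f xs = p"
  using assms
proof (induction p arbitrary: M)
  case (Cons w p)
  then have "w \<in># image_mset f M" by (simp add: insert_subset_eq_iff)
  then obtain l where l: "l \<in># M" "f l = w" by auto
  then have "mset p \<subseteq># image_mset f (M - {#l#})"
    using Cons.prems by (simp add: insert_subset_eq_iff image_mset_Diff)
  with Cons.IH obtain xs where "mset xs \<subseteq># M - {#l#}" "map f xs = p" by blast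
  with l show ?case by (intro exI[of _ "l # xs"]) (simp add: insert_subset_eq_iff)
qed simp

lemma wt_mset: "wt (mset xs) = sum_list (map wtl xs)"
  by (simp add: wt_def flip: mset_map sum_mset_sum_list)

lemma wt_eq_sum_weights: "wt M = \<Sum>\<^sub># (image_mset wtl M)"
  by (simp add: wt_def)

lemma sum_signed_patterns: "\<forall>p\<in>set signed_patterns. p \<noteq> [] \<and> sum_list p = 0"
  by (simp add: signed_patterns_def weight_patterns_def)

text \<open>
  Finite families of monomials are compared by computation. Multisets of letters are encoded by
  products of primes, so that unique factorization makes the comparison one of numbers.
\<close>

fun letter_prime :: "letter \<Rightarrow> nat" where
  "letter_prime A1 = 2" | "letter_prime A1' = 3" | "letter_prime B1 = 5" | "letter_prime B1' = 7"
| "letter_prime X = 11" | "letter_prime X' = 13" | "letter_prime A2 = 17" | "letter_prime A2' = 19"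
| "letter_prime B2 = 23" | "letter_prime B2' = 29" | "letter_prime A3 = 31" | "letter_prime A3' = 37"
| "letter_prime A4 = 41" | "letter_prime A4' = 43" | "letter_prime Lam1 = 47" | "letter_prime Lam2 = 53"
| "letter_prime Lam3 = 59"

definition code :: "letter list \<Rightarrow> nat" where
  "code xs = prod_list (map letter_prime xs)"

lemma prime_letter_prime: "prime (letter_prime l)"
  by (cases l) (simp_all add: prime_nat_numeral_eq)

lemma inj_letter_prime: "inj letter_prime"
proof (rule injI)
  fix l k assume "letter_prime l = letter_prime k"
  then show "l = k" by (cases l; cases k) simp_all
qed

lemma code_eq_iff: "code xs = code ys \<longleftrightarrow> mset xs = mset ys"
proof
  assume "code xs = code ys"
  then have "prime_factorization (prod_mset (image_mset letter_prime (mset xs)))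
      = prime_factorization (prod_mset (image_mset letter_prime (mset ys)))"
    by (simp add: code_def flip: prod_mset_prod_list mset_map)
  then have "image_mset letter_prime (mset xs) = image_mset letter_prime (mset ys)"
    by (subst (asm) (1 2) prime_factorization_prod_mset_primes) (auto simp: prime_letter_prime)
  then show "mset xs = mset ys" by (rule multiset.inj_map[OF inj_letter_prime, THEN injD])
next
  assume "mset xs = mset ys"
  then show "code xs = code ys"
    by (metis code_def mset_map prod_mset_prod_list)
qed

definition irreducible_codes :: "nat list" where
  "irreducible_codes = map code generator_monomials @ map (\<lambda>xs. code (map bar xs)) nonreal_monomials"

lemmas generator_monomials_list = generator_monomials_def[unfolded basic_monomials_def nonreal_monomials_def, simplified]

lemmas irreducible_codes_list =
  irreducible_codes_def[unfolded generator_monomials_list nonreal_monomials_def code_def, simplified]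

lemma distinct_irreducible_codes: "distinct irreducible_codes"
  unfolding irreducible_codes_list by simp

text \<open>
  All ways of choosing letters with the weights of a pattern.
\<close>

definition lifted_codes :: "nat list" where
  "lifted_codes = concat (map (\<lambda>p. map code (product_lists (map letters_of_weight p))) ([0] # weight_patterns))"

lemmas lifted_codes_list =
  lifted_codes_def[unfolded weight_patterns_def letters_of_weight_def code_def, simplified]

lemma lifted_codes_listed: "set lifted_codes \<subseteq> set irreducible_codes"
  unfolding lifted_codes_list irreducible_codes_list by simp

lemma generator_monomials_irreducible_weights:
  "\<forall>ws\<in>set (map (map wtl) generator_monomials). ws \<noteq> [] \<and> sum_list ws = 0 \<and>
     (\<forall>vs\<in>set (subseqs ws). sum_list vs = 0 \<longrightarrow> vs = [] \<or> length vs = length ws)"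
  unfolding generator_monomials_list by (simp add: Let_def)
lemma subset_mset_subseq:
  assumes "N \<subseteq># mset xs"
  shows "\<exists>ys\<in>set (subseqs xs). mset ys = N"
  using assms
proof (induction xs arbitrary: N)
  case (Cons x xs)
  show ?case
  proof (cases "x \<in># N")
    case True
    then obtain N' where N: "N = add_mset x N'" by (metis multi_member_split)
    then have "N' \<subseteq># mset xs" using Cons.prems by simp
    then obtain ys where "ys \<in> set (subseqs xs)" "mset ys = N'" using Cons.IH by blast
    then have "x # ys \<in> set (subseqs (x # xs))" "mset (x # ys) = N" by (simp_all add: Let_def N)
    then show ?thesis by blast
  next
    case False
    have "count N a \<le> count (mset xs) a" for a
      using mset_subset_eq_count[OF Cons.prems, of a] False by (cases "a = x") (auto simp: not_in_iff)
    then have "N \<subseteq># mset xs" by (rule mset_subset_eqI)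
    then obtain ys where "ys \<in> set (subseqs xs)" "mset ys = N" using Cons.IH by blast
    then show ?thesis by (intro bexI[of _ ys]) (simp_all add: Let_def)
  qed
qed simp

lemma eq_of_subset_mset_size: "N \<subseteq># M \<Longrightarrow> size N = size M \<Longrightarrow> N = M"
  by (metis mset_subset_size less_irrefl subset_mset.le_less)

lemma generator_monomial_irreducible:
  assumes "xs \<in> set generator_monomials"
  shows "irreducible_mono (mset xs)"
proof -
  from assms have "map wtl xs \<in> set (map (map wtl) generator_monomials)" by simp
  from generator_monomials_irreducible_weights[rule_format, OF this]
  have ne: "xs \<noteq> []" and sum: "sum_list (map wtl xs) = 0"
    and subs: "\<And>vs. vs \<in> set (subseqs (map wtl xs)) \<Longrightarrow> sum_list vs = 0 \<Longrightarrow> vs = [] \<or> length vs = length xs"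
    by auto
  have "N = {#} \<or> N = mset xs" if N: "N \<subseteq># mset xs" "wt N = 0" for N
  proof -
    have "image_mset wtl N \<subseteq># mset (map wtl xs)"
      using N(1) by (simp add: image_mset_subseteq_mono)
    then obtain vs where vs: "vs \<in> set (subseqs (map wtl xs))" "mset vs = image_mset wtl N"
      using subset_mset_subseq by blast
    have "sum_list vs = wt N" by (simp add: wt_eq_sum_weights flip: vs(2) sum_mset_sum_list)
    with subs[OF vs(1)] N(2) have "vs = [] \<or> length vs = length xs" by simp
    then have "size N = 0 \<or> size N = size (mset xs)"
      using arg_cong[OF vs(2), of size] by auto
    with N(1) show ?thesis using eq_of_subset_mset_size[of N "mset xs"] by auto
  qed
  with ne sum show ?thesis by (auto simp: irreducible_mono_def wt_mset)
qed

lemma irreducible_mono_conj: "irreducible_mono (conj_mono M) \<longleftrightarrow> irreducible_mono M"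
proof -
  have "irreducible_mono (conj_mono M)" if "irreducible_mono M" for M
    unfolding irreducible_mono_def
  proof (intro conjI allI impI)
    show "conj_mono M \<noteq> {#}" "wt (conj_mono M) = 0" using that by (auto simp: irreducible_mono_def)
    fix N assume "N \<subseteq># conj_mono M" "wt N = 0"
    then have "conj_mono N \<subseteq># M" "wt (conj_mono N) = 0"
      using image_mset_subseteq_mono[of N "conj_mono M" bar] by simp_all
    then have "conj_mono N = {#} \<or> conj_mono N = M" using that by (auto simp: irreducible_mono_def)
    then show "N = {#} \<or> N = conj_mono M" by auto
  qed
  from this[of M] this[of "conj_mono M"] show ?thesis by auto
qed

lemma abs_wtl_le: "wtl l \<in> {-4..4}"
  by (cases l) simp_all

text \<open>
  The weights of an irreducible monomial contain a pattern. Letters lifting it form a factor of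
  weight zero, which is the whole monomial. Conjugation reverses the signs of the pattern.
\<close>

lemma irreducible_positive_pattern:
  assumes "irreducible_mono M"
  obtains M' p where "M' = M \<or> M' = conj_mono M" "irreducible_mono M'"
    "p \<in> set ([0] # weight_patterns)" "image_mset wtl M' = mset p"
proof -
  have "image_mset wtl M \<noteq> {#}" "set_mset (image_mset wtl M) \<subseteq> {-4..4}" "\<Sum>\<^sub># (image_mset wtl M) = 0"
    using assms abs_wtl_le by (auto simp: irreducible_mono_def wt_eq_sum_weights)
  then obtain q where q: "q \<in> set signed_patterns" "mset q \<subseteq># image_mset wtl M"
    using zero_sum_contains_pattern by blast
  obtain xs where xs: "mset xs \<subseteq># M" "map wtl xs = q" using subset_of_image_lifts[OF q(2)] by blast
  then have "wt (mset xs) = 0" "mset xs \<noteq> {#}"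
    using sum_signed_patterns q(1) by (auto simp: wt_mset)
  then have "M = mset xs" using assms xs(1) by (auto simp: irreducible_mono_def)
  with xs(2) have M: "image_mset wtl M = mset q" by (metis mset_map)
  show ?thesis
  proof (cases "q \<in> set ([0] # weight_patterns)")
    case True
    with M assms that show ?thesis by blast
  next
    case False
    then obtain p where p: "p \<in> set weight_patterns" "q = map uminus p"
      using q(1) by (auto simp: signed_patterns_def)
    have "image_mset wtl (conj_mono M) = image_mset uminus (image_mset wtl M)"
      by (simp add: multiset.map_comp o_def)
    also have "\<dots> = mset p" by (simp add: M p(2) multiset.map_comp o_def)
    finally show ?thesis using that[of "conj_mono M" p] p(1) assms by (simp add: irreducible_mono_conj)
  qed
qed

text \<open>
  The monomials over a given pattern are finite in number, and each of them has been found in the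
  list up to conjugation.
\<close>

lemma irreducible_listed:
  assumes "irreducible_mono M"
  obtains xs where "xs \<in> set generator_monomials" "M = mset xs \<or> M = conj_mono (mset xs)"
proof -
  obtain M' p where M': "M' = M \<or> M' = conj_mono M" "p \<in> set ([0] # weight_patterns)" "image_mset wtl M' = mset p"
    using irreducible_positive_pattern[OF assms] .
  then obtain xs where xs: "mset xs \<subseteq># M'" "map wtl xs = p" using subset_of_image_lifts[of p wtl M'] by auto
  moreover have "size (mset xs) = size M'"
    using arg_cong[OF M'(3), of size] xs(2) by auto
  ultimately have "M' = mset xs" using eq_of_subset_mset_size by metis
  have "code xs \<in> set lifted_codes"
    using M'(2) xs(2) unfolding lifted_codes_def by (auto simp: in_product_lists_letters[symmetric])
  then have "code xs \<in> set irreducible_codes" using lifted_codes_listed by blast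
  then obtain ys where "ys \<in> set generator_monomials" "code xs = code ys \<or> code xs = code (map bar ys)"
    by (auto simp: irreducible_codes_def generator_monomials_def)
  moreover from this \<open>M' = mset xs\<close> M'(1) have "M = mset ys \<or> M = conj_mono (mset ys)"
    by (auto simp: code_eq_iff) (metis conj_conj)+
  ultimately show ?thesis using that by blast
qed

lemma distinct_generator_monomials: "distinct generator_monomials" "distinct nonreal_monomials"
  using distinct_irreducible_codes
  by (auto simp: irreducible_codes_def distinct_map generator_monomials_def)

lemma inj_mset_generator_monomials:
  "xs \<in> set generator_monomials \<Longrightarrow> ys \<in> set generator_monomials \<Longrightarrow> mset xs = mset ys \<Longrightarrow> xs = ys"
  using distinct_irreducible_codes unfolding irreducible_codes_def distinct_append distinct_map
  by (metis code_eq_iff inj_onD)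

lemma conj_nonreal_neq:
  assumes "xs \<in> set generator_monomials" "ys \<in> set nonreal_monomials"
  shows "mset xs \<noteq> conj_mono (mset ys)"
proof
  assume "mset xs = conj_mono (mset ys)"
  then have "code xs = code (map bar ys)" by (simp add: code_eq_iff)
  then show False using distinct_irreducible_codes assms
    unfolding irreducible_codes_def distinct_append by auto
qed

lemma conj_basic: "xs \<in> set basic_monomials \<Longrightarrow> conj_mono (mset xs) = mset xs"
  by (auto simp: basic_monomials_def)

lemma conj_generator_monomial_eq:
  assumes "xs \<in> set generator_monomials" "ys \<in> set generator_monomials" "mset xs = conj_mono (mset ys)"
  shows "xs = ys"
  using assms conj_nonreal_neq[of xs ys] conj_basic[of ys] inj_mset_generator_monomials[of xs ys]
  by (auto simp: generator_monomials_def)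

section \<open>Generation\<close>

definition im_pairs :: "(letter list \<times> letter list) list" where
  "im_pairs = [
    ([A1, B1'], [A2, B2']), ([A1, B1'], [A2, A2, A4']), ([A1, B1'], [B2, B2, A4']), ([A1, B1'], [A2, B2, A4']),
    ([A2, B2'], [A1, A3, A4']), ([A2, B2'], [B1, A3, A4']), ([A2, B2'], [A1', X]), ([A2, B2'], [B1', X]),
    ([A2, A2, A4'], [A1', X]), ([A2, A2, A4'], [B1', X]), ([B2, B2, A4'], [A1', X]), ([B2, B2, A4'], [B1', X]),
    ([A2, B2, A4'], [A1', X]), ([A2, B2, A4'], [B1', X]), ([A2, B2'], [A3, A4', X])]"

definition re_fun :: "letter list \<Rightarrow> point \<Rightarrow> real" where
  "re_fun xs p = Re (ev (mset xs) p)"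

definition im_fun :: "letter list \<Rightarrow> point \<Rightarrow> real" where
  "im_fun xs p = Im (ev (mset xs) p)"

definition im_prod_fun :: "letter list \<times> letter list \<Rightarrow> point \<Rightarrow> real" where
  "im_prod_fun = (\<lambda>(xs, ys) p. Im (ev (mset xs) p) * Im (ev (mset ys) p))"

definition SO2_generators :: "(point \<Rightarrow> real) set" where
  "SO2_generators = re_fun ` set generator_monomials \<union> im_fun ` set nonreal_monomials"

definition O2_generators :: "(point \<Rightarrow> real) set" where
  "O2_generators = re_fun ` set generator_monomials \<union> im_prod_fun ` set im_pairs"

lemma reducible_split:
  assumes "wt M = 0" "M \<noteq> {#}" "\<not> irreducible_mono M"
  obtains A B where "M = A + B" "wt A = 0" "wt B = 0" "size A < size M" "size B < size M"
proof -
  obtain A where A: "A \<subseteq># M" "wt A = 0" "A \<noteq> {#}" "A \<noteq> M"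
    using assms by (auto simp: irreducible_mono_def)
  then obtain B where B: "M = A + B" by (metis subset_mset.le_iff_add)
  with A assms show ?thesis by (intro that[of A B]) (auto simp: nonempty_has_size)
qed

lemma exists_irreducible_part:
  assumes "wt M = 0" "M \<noteq> {#}"
  obtains A B where "M = A + B" "irreducible_mono A" "wt B = 0"
proof -
  have "\<exists>A B. M = A + B \<and> irreducible_mono A \<and> wt B = 0"
    using assms
  proof (induction "size M" arbitrary: M rule: less_induct)
    case less
    show ?case
    proof (cases "irreducible_mono M")
      case True
      then show ?thesis by (intro exI[of _ M] exI[of _ "{#}"]) simp
    next
      case False
      obtain A B where AB: "M = A + B" "wt A = 0" "wt B = 0" "size A < size M" "size B < size M"
        using reducible_split[OF less.prems False] .
      then have "A \<noteq> {#}" by auto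
      with less.hyps[OF AB(4,2)] obtain C D where "A = C + D" "irreducible_mono C" "wt D = 0" by blast
      with AB show ?thesis by (intro exI[of _ C] exI[of _ "D + B"]) (simp add: add.assoc)
    qed
  qed
  with that show ?thesis by blast
qed

lemma Im_ev_real_mono: "conj_mono M = M \<Longrightarrow> Im (ev M p) = 0"
  by (metis complex_cnj_cancel_iff ev_conj complex_In_mult_cnj_zero cnj.simps(2) neg_equal_zero)

lemma irreducible_Re_in_alg:
  assumes "irreducible_mono M" "re_fun ` set generator_monomials \<subseteq> S"
  shows "(\<lambda>p. Re (ev M p)) \<in> alg S"
proof -
  obtain xs where xs: "xs \<in> set generator_monomials" "M = mset xs \<or> M = conj_mono (mset xs)"
    using irreducible_listed[OF assms(1)] .
  then have "(\<lambda>p. Re (ev M p)) = re_fun xs" by (auto simp: re_fun_def fun_eq_iff)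
  with xs(1) assms(2) show ?thesis by (auto intro: generated_algebra.gen)
qed

lemma ev_in_alg_SO2_generators:
  assumes "wt M = 0"
  shows "(\<lambda>p. Re (ev M p)) \<in> alg SO2_generators \<and> (\<lambda>p. Im (ev M p)) \<in> alg SO2_generators"
  using assms
proof (induction "size M" arbitrary: M rule: less_induct)
  case less
  consider "M = {#}" | "irreducible_mono M" | "M \<noteq> {#}" "\<not> irreducible_mono M" by blast
  then show ?case
  proof cases
    case 1
    then show ?thesis by (simp add: alg_const)
  next
    case 2
    obtain xs where xs: "xs \<in> set generator_monomials" "M = mset xs \<or> M = conj_mono (mset xs)"
      using irreducible_listed[OF 2] .
    have "im_fun xs \<in> alg SO2_generators"
    proof (cases "xs \<in> set nonreal_monomials")
      case True
      then show ?thesis by (auto simp: SO2_generators_def intro: generated_algebra.gen)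
    next
      case False
      with xs(1) have "xs \<in> set basic_monomials" by (simp add: generator_monomials_def)
      then have "im_fun xs = (\<lambda>p. 0)" using conj_basic Im_ev_real_mono by (auto simp: im_fun_def fun_eq_iff)
      then show ?thesis by (simp add: alg_const)
    qed
    then have "(\<lambda>p. Im (ev M p)) \<in> alg SO2_generators"
      using xs(2) alg_uminus[of "im_fun xs"] by (auto simp: im_fun_def[abs_def])
    with irreducible_Re_in_alg[OF 2, of SO2_generators] show ?thesis by (simp add: SO2_generators_def)
  next
    case 3
    obtain A B where "M = A + B" "wt A = 0" "wt B = 0" "size A < size M" "size B < size M"
      using reducible_split[OF less.prems 3] .
    with less.hyps[of A] less.hyps[of B] show ?thesis by (auto intro!: alg_diff alg_add alg_mult)
  qed
qed

text \<open>
  If \<open>x u\<close> and \<open>y v\<close> have weight zero and \<open>x\<close>, \<open>y\<close> have equal weight, then all the arguments on the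
  right have weight zero too, and they are shorter than \<open>x u y v\<close>. So the product of the imaginary
  parts is expressed by real parts of lower degree.
\<close>

lemma Im_Im_exchange:
  fixes x y u v :: complex
  shows "Im (x * u) * Im (y * v) = Re (x * cnj y) * Re (u * cnj v) - Re (x * v) * Re (y * u)"
  by (simp add: algebra_simps)

context
  fixes S :: "(point \<Rightarrow> real) set" and n :: nat
  assumes smaller: "\<And>N. size N < n \<Longrightarrow> wt N = 0 \<Longrightarrow> (\<lambda>p. Re (ev N p)) \<in> alg S"
begin

lemma Im_Im_shared_equal_weight:
  assumes "size A + size B \<le> n" "wt A = 0" "wt B = 0" "x \<in># A" "y \<in># B" "wtl x = wtl y"
  shows "(\<lambda>p. Im (ev A p) * Im (ev B p)) \<in> alg S"
proof -
  obtain U V where AB: "A = add_mset x U" "B = add_mset y V" using assms by (metis multi_member_split)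
  show ?thesis
  proof (cases "U = {#}")
    \<comment> \<open>The only letters of weight zero are the real ones.\<close>
    case True
    then have "bar x = x" using assms(2) by (cases x) (simp_all add: AB)
    then have "Im (ev A p) = 0" for p using True by (intro Im_ev_real_mono) (simp add: AB)
    then show ?thesis by (simp add: alg_const)
  next
    case False
    then have "(\<lambda>p. Re (ev N p)) \<in> alg S" if "N \<in> {{#x, bar y#}, U + conj_mono V, add_mset x V, add_mset y U}" for N
      using that assms by (intro smaller) (auto simp: AB nonempty_has_size)
    then have "(\<lambda>p. Re (val x p * cnj (val y p)) * Re (ev U p * cnj (ev V p))
        - Re (val x p * ev V p) * Re (val y p * ev U p)) \<in> alg S"
      by (intro alg_diff alg_mult) fastforce+
    then show ?thesis by (simp only: AB ev_simps Im_Im_exchange)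
  qed
qed

lemma Im_Im_shared_weight:
  assumes "size A + size B \<le> n" "wt A = 0" "wt B = 0" "x \<in># A" "y \<in># B" "\<bar>wtl x\<bar> = \<bar>wtl y\<bar>"
  shows "(\<lambda>p. Im (ev A p) * Im (ev B p)) \<in> alg S"
proof (cases "wtl x = wtl y")
  case True
  with Im_Im_shared_equal_weight assms show ?thesis by blast
next
  case False
  with assms(6) have "wtl x = wtl (bar y)" by (simp add: abs_if split: if_splits)
  moreover have "bar y \<in># conj_mono B" using assms(5) by simp
  ultimately have "(\<lambda>p. Im (ev A p) * Im (ev (conj_mono B) p)) \<in> alg S"
    using assms by (intro Im_Im_shared_equal_weight[of A "conj_mono B" x "bar y"]) auto
  from alg_uminus[OF this] show ?thesis by simp
qed

end

definition shares_weight :: "int list \<Rightarrow> int list \<Rightarrow> bool" where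
  "shares_weight p q \<longleftrightarrow> (\<exists>v\<in>set p. \<exists>w\<in>set q. \<bar>v\<bar> = \<bar>w\<bar>)"

definition all_abs_in :: "int set \<Rightarrow> int list \<Rightarrow> bool" where
  "all_abs_in S p \<longleftrightarrow> (\<forall>w\<in>set p. \<bar>w\<bar> \<in> S)"

text \<open>
  A product of monomials over two patterns may have a second factorization into monomials of weight
  zero that share a weight; the four listed patterns suffice as first factors.
\<close>

definition resplits :: "int list \<Rightarrow> int list \<Rightarrow> bool" where
  "resplits p q \<longleftrightarrow> (\<exists>r\<in>{[1, 2, -3], [1, 3, -4], [1, 1, -2], [2, 3, 3, -4, -4]}.
     (\<forall>w\<in>set r. count_list r w \<le> count_list (p @ q) w) \<and> shares_weight r (fold remove1 r (p @ q)))"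

text \<open>
  There is only one coordinate of weight 3 and one of weight 4, and those of weight 0 are real, so
  the irreducible monomials over such a pattern are real.
\<close>

definition degenerate :: "int list \<Rightarrow> bool" where
  "degenerate p \<longleftrightarrow> all_abs_in {0} p \<or> all_abs_in {3} p \<or> all_abs_in {4} p"

text \<open>
  Besides some degenerate pairs these are the weights of the fifteen products; length 3 singles out
  the pattern 1, 3, -4 among those with absolute values in \<open>{1, 3, 4}\<close>.
\<close>

definition exceptional :: "int list \<Rightarrow> int list \<Rightarrow> bool" where
  "exceptional p q \<longleftrightarrow> all_abs_in {1} p \<and> all_abs_in {2, 4} q
     \<or> all_abs_in {2} p \<and> all_abs_in {1, 3, 4} q \<and> length q = 3"

lemma pattern_pairs:
  "\<forall>p\<in>set ([0] # weight_patterns). \<forall>q\<in>set ([0] # weight_patterns).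
     if shares_weight p q then True else if degenerate p then True else if degenerate q then True
     else if exceptional p q then True else if exceptional q p then True else resplits p q"
  unfolding weight_patterns_def
  by (simp add: shares_weight_def degenerate_def exceptional_def resplits_def all_abs_in_def)

lemma nonreal_of_small_support:
  "filter (\<lambda>xs. all_abs_in {1} (map wtl xs)) nonreal_monomials = [[A1, B1'], [A1', X], [B1', X]]"
  "filter (\<lambda>xs. all_abs_in {2} (map wtl xs)) nonreal_monomials = [[A2, B2']]"
  "filter (\<lambda>xs. all_abs_in {2, 4} (map wtl xs)) nonreal_monomials
    = [[A2, B2'], [A2, A2, A4'], [B2, B2, A4'], [A2, B2, A4']]"
  "filter (\<lambda>xs. all_abs_in {1, 3, 4} (map wtl xs) \<and> length xs = 3) nonreal_monomials
    = [[A1, A3, A4'], [B1, A3, A4'], [A3, A4', X]]"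
  "filter (\<lambda>xs. degenerate (map wtl xs)) nonreal_monomials = []"
  unfolding nonreal_monomials_def degenerate_def all_abs_in_def by simp_all

lemma exceptional_nonreal:
  assumes "xs \<in> set nonreal_monomials" "ys \<in> set nonreal_monomials" "exceptional (map wtl xs) (map wtl ys)"
  shows "(xs, ys) \<in> set im_pairs \<or> (ys, xs) \<in> set im_pairs"
proof -
  have filt: "P zs \<Longrightarrow> zs \<in> set (filter P nonreal_monomials)" if "zs \<in> set nonreal_monomials" for P zs
    using that by simp
  note supports = filt[OF assms(1), of "\<lambda>zs. all_abs_in {1} (map wtl zs)", unfolded nonreal_of_small_support]
    filt[OF assms(1), of "\<lambda>zs. all_abs_in {2} (map wtl zs)", unfolded nonreal_of_small_support]
    filt[OF assms(2), of "\<lambda>zs. all_abs_in {2, 4} (map wtl zs)", unfolded nonreal_of_small_support]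
    filt[OF assms(2), of "\<lambda>zs. all_abs_in {1, 3, 4} (map wtl zs) \<and> length zs = 3", unfolded nonreal_of_small_support]
  have "xs \<in> set [[A1, B1'], [A1', X], [B1', X]] \<and> ys \<in> set [[A2, B2'], [A2, A2, A4'], [B2, B2, A4'], [A2, B2, A4']]
      \<or> xs \<in> set [[A2, B2']] \<and> ys \<in> set [[A1, A3, A4'], [B1, A3, A4'], [A3, A4', X]]"
    using assms(3) supports unfolding exceptional_def length_map by blast
  then have "(xs, ys) \<in> set [[A1, B1'], [A1', X], [B1', X]] \<times> set [[A2, B2'], [A2, A2, A4'], [B2, B2, A4'], [A2, B2, A4']]
      \<union> set [[A2, B2']] \<times> set [[A1, A3, A4'], [B1, A3, A4'], [A3, A4', X]]" by blast
  moreover have "\<dots> \<subseteq> set im_pairs \<union> (\<lambda>(xs, ys). (ys, xs)) ` set im_pairs"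
    unfolding im_pairs_def by simp
  ultimately have "(xs, ys) \<in> set im_pairs \<union> (\<lambda>(xs, ys). (ys, xs)) ` set im_pairs" by (rule rev_subsetD)
  then show ?thesis by auto
qed

lemma degenerate_not_nonreal: "xs \<in> set nonreal_monomials \<Longrightarrow> \<not> degenerate (map wtl xs)"
  using nonreal_of_small_support(5) by (metis filter_empty_conv)

lemma mset_fold_remove1: "mset (fold remove1 r p) = mset p - mset r"
  by (induction r arbitrary: p) auto

lemma all_abs_in_weights:
  assumes "A = mset xs \<or> A = conj_mono (mset xs)" "image_mset wtl A = mset p"
  shows "all_abs_in T p = all_abs_in T (map wtl xs)" "length p = length xs"
proof -
  have "set p = set_mset (image_mset wtl A)" by (simp add: assms(2))
  also have "\<dots> = wtl ` set xs \<or> \<dots> = (\<lambda>l. - wtl l) ` set xs"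
    using assms(1) by (auto simp: image_image)
  finally show "all_abs_in T p = all_abs_in T (map wtl xs)" by (auto simp: all_abs_in_def)
  show "length p = length xs"
    using arg_cong[OF assms(2), of size] assms(1) by auto
qed

text \<open>
  If the two monomials share a weight up to sign, a pair of letters can be exchanged. If not, but
  \<open>A + B = N + N'\<close> with \<open>N\<close> and \<open>N'\<close> sharing a weight, then \<open>Im A * Im B\<close> and \<open>Im N * Im N'\<close> differ
  by products of real parts of lower degree, because \<open>Re (A * B) = Re (N * N')\<close>. In the remaining
  cases one of the monomials is real or the product is a generator up to sign.
\<close>

lemma Im_Im_irreducible_pattern:
  assumes smaller: "\<And>N. size N < n \<Longrightarrow> wt N = 0 \<Longrightarrow> (\<lambda>p. Re (ev N p)) \<in> alg S"
    and gens: "im_prod_fun ` set im_pairs \<subseteq> S"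
    and irr: "irreducible_mono A" "irreducible_mono B" and size: "size A + size B \<le> n"
    and pat: "p \<in> set ([0] # weight_patterns)" "image_mset wtl A = mset p"
      "q \<in> set ([0] # weight_patterns)" "image_mset wtl B = mset q"
  shows "(\<lambda>x. Im (ev A x) * Im (ev B x)) \<in> alg S"
proof -
  have wt: "wt A = 0" "wt B = 0" and ne: "A \<noteq> {#}" "B \<noteq> {#}" using irr by (auto simp: irreducible_mono_def)
  obtain xs where xs: "xs \<in> set generator_monomials" "A = mset xs \<or> A = conj_mono (mset xs)"
    using irreducible_listed[OF irr(1)] .
  obtain ys where ys: "ys \<in> set generator_monomials" "B = mset ys \<or> B = conj_mono (mset ys)"
    using irreducible_listed[OF irr(2)] .
  show ?thesis
  proof (cases "xs \<in> set nonreal_monomials \<and> ys \<in> set nonreal_monomials")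
    case False
    with xs(1) ys(1) have "xs \<in> set basic_monomials \<or> ys \<in> set basic_monomials"
      by (auto simp: generator_monomials_def)
    then have "conj_mono A = A \<or> conj_mono B = B" using conj_basic xs(2) ys(2) by auto
    then have "Im (ev A x) * Im (ev B x) = 0" for x
      using Im_ev_real_mono[of A x] Im_ev_real_mono[of B x] by auto
    then show ?thesis by (simp only: alg_const)
  next
    case True
    note abs_p = all_abs_in_weights[OF xs(2) pat(2)] and abs_q = all_abs_in_weights[OF ys(2) pat(4)]
    have "\<not> degenerate p" "\<not> degenerate q"
      using True degenerate_not_nonreal by (auto simp: degenerate_def abs_p abs_q)
    with bspec[OF bspec[OF pattern_pairs pat(1)] pat(3)]
    consider "shares_weight p q" | "exceptional p q \<or> exceptional q p" | "resplits p q"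
      by (auto split: if_splits)
    then show ?thesis
    proof cases
      case 1
      then obtain v w where vw: "v \<in># image_mset wtl A" "w \<in># image_mset wtl B" "\<bar>v\<bar> = \<bar>w\<bar>"
        unfolding pat by (auto simp: shares_weight_def)
      then obtain l k where "l \<in># A" "k \<in># B" "\<bar>wtl l\<bar> = \<bar>wtl k\<bar>" by auto
      with Im_Im_shared_weight[OF smaller size wt] show ?thesis by blast
    next
      case 2
      then have "(xs, ys) \<in> set im_pairs \<or> (ys, xs) \<in> set im_pairs"
        using True exceptional_nonreal[of xs ys] exceptional_nonreal[of ys xs]
        by (auto simp: exceptional_def abs_p abs_q)
      with gens have "im_prod_fun (xs, ys) \<in> alg S \<or> im_prod_fun (ys, xs) \<in> alg S"
        by (auto intro: generated_algebra.gen)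
      then have pr: "(\<lambda>x. Im (ev (mset xs) x) * Im (ev (mset ys) x)) \<in> alg S"
        by (simp add: im_prod_fun_def mult.commute)
      with xs(2) ys(2) alg_uminus[OF pr] show ?thesis by auto
    next
      case 3
      then obtain r where r: "r \<in> {[1, 2, -3], [1, 3, -4], [1, 1, -2], [2, 3, 3, -4, -4]}"
        "\<forall>w\<in>set r. count_list r w \<le> count_list (p @ q) w" "shares_weight r (fold remove1 r (p @ q))"
        unfolding resplits_def by blast
      have "count (mset ws) w = count_list ws w" for ws :: "int list" and w by (induction ws) auto
      with r(2) have "mset r \<subseteq># mset (p @ q)" by (simp only: mset_subseteq_iff_count_list)
      then have "mset r \<subseteq># image_mset wtl (A + B)" by (simp add: pat)
      then obtain zs where zs: "mset zs \<subseteq># A + B" "map wtl zs = r" using subset_of_image_lifts by blast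
      define N where "N = mset zs"
      define N' where "N' = A + B - N"
      have NN': "N + N' = A + B" using zs(1) by (simp add: N_def N'_def)
      have "image_mset wtl N' = mset (fold remove1 r (p @ q))"
        using zs by (simp add: N'_def N_def image_mset_Diff mset_fold_remove1 pat flip: mset_map)
      with r(3) zs(2) obtain v w where "v \<in># image_mset wtl N" "w \<in># image_mset wtl N'" "\<bar>v\<bar> = \<bar>w\<bar>"
        by (auto simp: shares_weight_def N_def)
      then obtain l k where lk: "l \<in># N" "k \<in># N'" "\<bar>wtl l\<bar> = \<bar>wtl k\<bar>" by auto
      have "sum_list r = 0" using r(1) by auto
      then have wtN: "wt N = 0" by (simp add: N_def wt_mset zs(2))
      then have wtN': "wt N' = 0" using arg_cong[OF NN', of wt] wt by simp
      have sizes: "size N + size N' = size A + size B" using arg_cong[OF NN', of size] by simp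
      have pos: "0 < size N" "0 < size N'" "0 < size A" "0 < size B" using lk(1,2) ne by (auto simp: nonempty_has_size[symmetric])
      have small: "(\<lambda>x. Re (ev K x)) \<in> alg S" if "K \<in> {N, N', A, B}" for K
        using that pos sizes size wt wtN wtN' by (intro smaller) auto
      have im: "(\<lambda>x. Im (ev N x) * Im (ev N' x)) \<in> alg S"
        using sizes size by (intro Im_Im_shared_weight[OF smaller _ wtN wtN' lk]) auto
      have "(\<lambda>x. Re (ev A x) * Re (ev B x) - (Re (ev N x) * Re (ev N' x) - Im (ev N x) * Im (ev N' x))) \<in> alg S"
        by (rule alg_diff[OF alg_mult[OF small small] alg_diff[OF alg_mult[OF small small] im]]) simp_all
      moreover have "Re (ev N x) * Re (ev N' x) - Im (ev N x) * Im (ev N' x)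
          = Re (ev A x) * Re (ev B x) - Im (ev A x) * Im (ev B x)" for x
        using arg_cong[OF NN', of "\<lambda>M. Re (ev M x)"] by simp
      ultimately show ?thesis by simp
    qed
  qed
qed

lemma Im_Im_irreducible:
  assumes smaller: "\<And>N. size N < n \<Longrightarrow> wt N = 0 \<Longrightarrow> (\<lambda>p. Re (ev N p)) \<in> alg S"
    and gens: "im_prod_fun ` set im_pairs \<subseteq> S"
    and irr: "irreducible_mono A" "irreducible_mono B" and size: "size A + size B \<le> n"
  shows "(\<lambda>x. Im (ev A x) * Im (ev B x)) \<in> alg S"
proof -
  obtain A' p where A': "A' = A \<or> A' = conj_mono A" "irreducible_mono A'"
    "p \<in> set ([0] # weight_patterns)" "image_mset wtl A' = mset p"
    using irreducible_positive_pattern[OF irr(1)] .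
  obtain B' q where B': "B' = B \<or> B' = conj_mono B" "irreducible_mono B'"
    "q \<in> set ([0] # weight_patterns)" "image_mset wtl B' = mset q"
    using irreducible_positive_pattern[OF irr(2)] .
  have "size A' + size B' \<le> n" using A'(1) B'(1) size by auto
  then have pr: "(\<lambda>x. Im (ev A' x) * Im (ev B' x)) \<in> alg S"
    using Im_Im_irreducible_pattern[OF smaller gens A'(2) B'(2) _ A'(3,4) B'(3,4)] by blast
  from A'(1) B'(1) pr alg_uminus[OF pr] show ?thesis by auto
qed

text \<open>
  By induction on the degree: if \<open>M = A + B + D\<close> with \<open>A\<close>, \<open>B\<close> irreducible, then \<open>Re M\<close> is a polynomial in
  real parts of lower degree and in \<open>Im A * Im B\<close> and \<open>Im A * Im D\<close>. The first product has been
  treated, and the second is a combination of the lower-degree \<open>Re A * Re D\<close> and \<open>Re (A * D)\<close>.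
\<close>

lemma Re_in_alg_O2_generators:
  assumes "wt M = 0"
  shows "(\<lambda>p. Re (ev M p)) \<in> alg O2_generators"
  using assms
proof (induction "size M" arbitrary: M rule: less_induct)
  case less
  note smaller = less.hyps
  have gens: "im_prod_fun ` set im_pairs \<subseteq> O2_generators" "re_fun ` set generator_monomials \<subseteq> O2_generators"
    by (auto simp: O2_generators_def)
  consider "M = {#}" | "irreducible_mono M" | "M \<noteq> {#}" "\<not> irreducible_mono M" by blast
  then show ?case
  proof cases
    case 1
    then show ?thesis by (simp add: alg_const)
  next
    case 2
    with gens(2) show ?thesis by (intro irreducible_Re_in_alg)
  next
    case 3
    obtain A C where A: "M = A + C" "irreducible_mono A" "wt C = 0"
      using exists_irreducible_part[OF less.prems 3(1)] .
    with 3 have "C \<noteq> {#}" by auto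
    then obtain B D where B: "C = B + D" "irreducible_mono B" "wt D = 0"
      using exists_irreducible_part[OF A(3)] by blast
    have wt: "wt A = 0" "wt B = 0" and "A \<noteq> {#}" "B \<noteq> {#}" using A B by (auto simp: irreducible_mono_def)
    then have pos: "0 < size A" "0 < size B" by (auto simp: nonempty_has_size)
    have small: "(\<lambda>p. Re (ev K p)) \<in> alg O2_generators" if "K \<in> {A, B, C, D, A + D}" for K
      using that wt A(3) B(3) pos by (intro smaller) (auto simp: A(1) B(1))
    have AB: "(\<lambda>p. Im (ev A p) * Im (ev B p)) \<in> alg O2_generators"
      by (rule Im_Im_irreducible[OF smaller gens(1) A(2) B(2)]) (auto simp: A(1) B(1))
    have "(\<lambda>p. Re (ev A p) * Re (ev D p) - Re (ev (A + D) p)) \<in> alg O2_generators"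
      by (intro alg_diff alg_mult small) auto
    then have AD: "(\<lambda>p. Im (ev A p) * Im (ev D p)) \<in> alg O2_generators" by simp
    have "(\<lambda>p. Re (ev A p) * Re (ev C p)
        - (Re (ev B p) * (Im (ev A p) * Im (ev D p)) + Re (ev D p) * (Im (ev A p) * Im (ev B p)))) \<in> alg O2_generators"
      by (rule alg_diff[OF alg_mult[OF small small] alg_add[OF alg_mult[OF small AD] alg_mult[OF small AB]]]) simp_all
    then show ?thesis by (simp add: A(1) B(1) algebra_simps)
  qed
qed

lemma generator_monomial_wt: "xs \<in> set generator_monomials \<Longrightarrow> wt (mset xs) = 0"
  using generator_monomial_irreducible[of xs] unfolding irreducible_mono_def by blast

lemma set_im_pairs: "set im_pairs \<subseteq> set nonreal_monomials \<times> set nonreal_monomials"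
proof -
  note supports = nonreal_of_small_support(1,3,4)[symmetric]
  have "set [[A1, B1'], [A1', X], [B1', X]] \<subseteq> set nonreal_monomials"
    unfolding supports by (rule filter_is_subset)
  moreover have "set [[A2, B2'], [A2, A2, A4'], [B2, B2, A4'], [A2, B2, A4']] \<subseteq> set nonreal_monomials"
    unfolding supports by (rule filter_is_subset)
  moreover have "set [[A1, A3, A4'], [B1, A3, A4'], [A3, A4', X]] \<subseteq> set nonreal_monomials"
    unfolding supports by (rule filter_is_subset)
  ultimately show ?thesis unfolding im_pairs_def by simp
qed

lemma nonreal_subset: "set nonreal_monomials \<subseteq> set generator_monomials"
  by (simp add: generator_monomials_def)

lemma alg_SO2_generators: "alg SO2_generators = SO2_invariants"
proof
  have "SO2_generators \<subseteq> SO2_invariants"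
    using Re_invariant Im_invariant generator_monomial_wt nonreal_subset
    by (auto simp: SO2_generators_def re_fun_def[abs_def] im_fun_def[abs_def] O2_invariants_def subset_iff)
  then show "alg SO2_generators \<subseteq> SO2_invariants" by (rule alg_subset_SO2_invariants)
  show "SO2_invariants \<subseteq> alg SO2_generators"
    using SO2_invariant_in_alg ev_in_alg_SO2_generators by blast
qed

lemma alg_O2_generators: "alg O2_generators = O2_invariants"
proof
  have "im_prod_fun (xs, ys) \<in> O2_invariants" if "(xs, ys) \<in> set im_pairs" for xs ys
    unfolding im_prod_fun_def prod.case
    using that set_im_pairs nonreal_subset by (intro Im_Im_invariant generator_monomial_wt) auto
  then have "O2_generators \<subseteq> O2_invariants"
    using Re_invariant generator_monomial_wt by (auto simp: O2_generators_def re_fun_def[abs_def])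
  then show "alg O2_generators \<subseteq> O2_invariants" by (rule alg_subset_O2_invariants)
  show "O2_invariants \<subseteq> alg O2_generators"
    using O2_invariant_in_alg Re_in_alg_O2_generators by blast
qed

section \<open>Minimality\<close>

definition subalgebra :: "(point \<Rightarrow> real) set \<Rightarrow> bool" where
  "subalgebra Q \<longleftrightarrow> (\<forall>c. (\<lambda>_. c) \<in> Q)
     \<and> (\<forall>F\<in>Q. \<forall>G\<in>Q. (\<lambda>p. F p + G p) \<in> Q \<and> (\<lambda>p. F p * G p) \<in> Q)"

lemma alg_subset_subalgebra:
  assumes "subalgebra Q" "S \<subseteq> Q"
  shows "alg S \<subseteq> Q"
proof
  fix F assume "F \<in> alg S"
  then show "F \<in> Q"
    by (induction rule: generated_algebra.induct) (use assms in \<open>auto simp: subalgebra_def\<close>)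
qed

lemma coefficient_mult:
  assumes "finite T" "T \<subseteq> {A. A \<subseteq># K}"
    and "\<And>A. A \<subseteq># K \<Longrightarrow> A \<notin> T \<Longrightarrow> coefficient P A = 0"
  shows "coefficient (P * Q) K = (\<Sum>A\<in>T. coefficient P A * coefficient Q (K - A))"
proof -
  have inner: "(\<Sum>q. coefficient Q q when K = A + q) = (coefficient Q (K - A) when A \<subseteq># K)" for A
  proof (cases "A \<subseteq># K")
    case True
    then have "K = A + q \<longleftrightarrow> q = K - A" for q by auto
    then show ?thesis using True by simp
  next
    case False
    then have "K \<noteq> A + q" for q by auto
    then show ?thesis using False by simp
  qed
  have "coefficient (P * Q) K = (\<Sum>A. coefficient P A * (coefficient Q (K - A) when A \<subseteq># K))"
    by (simp add: lookup_mult inner)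
  also have "\<dots> = (\<Sum>A\<in>T. coefficient P A * (coefficient Q (K - A) when A \<subseteq># K))"
    using assms by (intro Sum_any.expand_superset) auto
  also have "\<dots> = (\<Sum>A\<in>T. coefficient P A * coefficient Q (K - A))"
    using assms(2) by (intro sum.cong) auto
  finally show ?thesis .
qed

lemma weight_zero_coefficient: "weight_zero P \<Longrightarrow> wt M \<noteq> 0 \<Longrightarrow> coefficient P M = 0"
  by (auto simp: weight_zero_def in_keys_iff)

lemma coefficient_mult_irreducible:
  assumes "irreducible_mono M" "weight_zero P"
  shows "coefficient (P * Q) M = coefficient P {#} * coefficient Q M + coefficient P M * coefficient Q {#}"
proof -
  have "coefficient P A = 0" if "A \<subseteq># M" "A \<notin> {{#}, M}" for A
    using that assms by (intro weight_zero_coefficient) (auto simp: irreducible_mono_def)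
  from coefficient_mult[of "{{#}, M}" M P Q, OF _ _ this] assms(1) show ?thesis
    by (auto simp: irreducible_mono_def)
qed

definition only_factors :: "mono \<Rightarrow> mono \<Rightarrow> bool" where
  "only_factors M N \<longleftrightarrow> (\<forall>A. A \<subseteq># M + N \<longrightarrow> wt A = 0 \<longrightarrow> A \<in> {{#}, M, N, M + N})"

lemma coefficient_mult_two_factors:
  assumes "only_factors M N" "M \<noteq> N" "M \<noteq> {#}" "N \<noteq> {#}" "weight_zero P"
  shows "coefficient (P * Q) (M + N) = coefficient P {#} * coefficient Q (M + N) + coefficient P M * coefficient Q N
    + coefficient P N * coefficient Q M + coefficient P (M + N) * coefficient Q {#}"
proof -
  have "coefficient P A = 0" if "A \<subseteq># M + N" "A \<notin> {{#}, M, N, M + N}" for A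
    using that assms by (intro weight_zero_coefficient) (auto simp: only_factors_def)
  from coefficient_mult[of "{{#}, M, N, M + N}" "M + N" P Q, OF _ _ this] assms(2-4) show ?thesis
    by (auto simp: add.assoc)
qed

lemma weight_zero_add: "weight_zero P \<Longrightarrow> weight_zero Q \<Longrightarrow> weight_zero (P + Q)"
  using keys_add[of P Q] by (auto simp: weight_zero_def)

lemma weight_zero_mult: "weight_zero P \<Longrightarrow> weight_zero Q \<Longrightarrow> weight_zero (P * Q)"
  using keys_mult[of P Q] unfolding weight_zero_def by fastforce

lemma weight_zero_const: "weight_zero (mterm {#} c)"
  by (simp add: weight_zero_def)

lemma coefficient_Re_pol:
  "coefficient (Re_pol N) M = (if N = M then 1/2 else 0) + (if conj_mono N = M then 1/2 else 0)"
  by (simp add: Re_pol_def lookup_add lookup_single when_def)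

lemma coefficient_Im_pol:
  "coefficient (Im_pol N) M = (if N = M then - \<i>/2 else 0) + (if conj_mono N = M then \<i>/2 else 0)"
  by (simp add: Im_pol_def lookup_add lookup_single when_def)

lemma weight_zero_Re_pol: "wt M = 0 \<Longrightarrow> weight_zero (Re_pol M)"
  by (auto simp: weight_zero_def in_keys_iff coefficient_Re_pol split: if_splits)

lemma weight_zero_Im_pol: "wt M = 0 \<Longrightarrow> weight_zero (Im_pol M)"
  by (auto simp: weight_zero_def in_keys_iff coefficient_Im_pol split: if_splits)

lemma constant_coefficient_real:
  assumes "represents P F"
  shows "Im (coefficient P {#}) = 0"
proof -
  let ?o = "assign (\<lambda>_. 0)"
  have ev0: "ev M ?o = (if M = {#} then 1 else 0)" for M
    by (cases M) (simp_all add: val_assign)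
  have "evp P ?o = (\<Sum>M\<in>insert {#} (Poly_Mapping.keys P). coefficient P M * ev M ?o)"
    by (rule evp_superset) auto
  also have "\<dots> = coefficient P {#}" by (simp add: ev0 if_distrib cong: if_cong)
  finally have "coefficient P {#} = complex_of_real (F ?o)" using assms by (simp add: represents_def)
  then show ?thesis by simp
qed

text \<open>
  At an irreducible monomial the product rule for coefficients is that of a derivation at the
  origin. Hence the vanishing of the real or of the imaginary part of this coefficient is preserved
  by products.
\<close>

definition vanishing_at :: "(complex \<Rightarrow> real) \<Rightarrow> mono \<Rightarrow> (point \<Rightarrow> real) set" where
  "vanishing_at \<phi> M = {F. \<exists>P. represents P F \<and> weight_zero P \<and> \<phi> (coefficient P M) = 0}"

lemma vanishing_at_iff:
  assumes "represents P F" "weight_zero P"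
  shows "F \<in> vanishing_at \<phi> M \<longleftrightarrow> \<phi> (coefficient P M) = 0"
  unfolding vanishing_at_def using assms represents_unique by blast

lemma subalgebra_vanishing_at:
  assumes irr: "irreducible_mono M" and \<phi>: "\<phi> = Re \<or> \<phi> = Im"
  shows "subalgebra (vanishing_at \<phi> M)"
  unfolding subalgebra_def
proof (intro conjI allI ballI)
  fix c
  have "coefficient (mterm {#} (complex_of_real c)) M = 0"
    using irr by (auto simp: irreducible_mono_def lookup_single when_def)
  then show "(\<lambda>_. c) \<in> vanishing_at \<phi> M"
    using vanishing_at_iff[OF represents_const weight_zero_const] \<phi> by auto
next
  fix F G assume F: "F \<in> vanishing_at \<phi> M" and G: "G \<in> vanishing_at \<phi> M"
  obtain P where P: "represents P F" "weight_zero P" "\<phi> (coefficient P M) = 0"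
    using F by (auto simp: vanishing_at_def)
  obtain Q where Q: "represents Q G" "weight_zero Q" "\<phi> (coefficient Q M) = 0"
    using G by (auto simp: vanishing_at_def)
  show "(\<lambda>p. F p + G p) \<in> vanishing_at \<phi> M"
    using vanishing_at_iff[OF represents_add weight_zero_add, OF P(1) Q(1) P(2) Q(2)] \<phi> P(3) Q(3)
    by (auto simp: lookup_add)
  show "(\<lambda>p. F p * G p) \<in> vanishing_at \<phi> M"
    using vanishing_at_iff[OF represents_mult weight_zero_mult, OF P(1) Q(1) P(2) Q(2)] \<phi> P(3) Q(3)
      constant_coefficient_real[OF P(1)] constant_coefficient_real[OF Q(1)]
    by (auto simp: coefficient_mult_irreducible[OF irr P(2)])
qed

lemma represents_re_fun: "xs \<in> set generator_monomials \<Longrightarrow> represents (Re_pol (mset xs)) (re_fun xs) \<and> weight_zero (Re_pol (mset xs))"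
  using represents_Re weight_zero_Re_pol generator_monomial_wt by (simp add: re_fun_def[abs_def])

lemma represents_im_fun: "xs \<in> set generator_monomials \<Longrightarrow> represents (Im_pol (mset xs)) (im_fun xs) \<and> weight_zero (Im_pol (mset xs))"
  using represents_Im weight_zero_Im_pol generator_monomial_wt by (simp add: im_fun_def[abs_def])

lemma represents_im_prod_fun:
  assumes "(xs, ys) \<in> set im_pairs"
  shows "represents (Im_pol (mset xs) * Im_pol (mset ys)) (im_prod_fun (xs, ys)) \<and> weight_zero (Im_pol (mset xs) * Im_pol (mset ys))"
proof -
  have "xs \<in> set generator_monomials" "ys \<in> set generator_monomials"
    using assms set_im_pairs nonreal_subset by auto
  from represents_im_fun[OF this(1)] represents_im_fun[OF this(2)] show ?thesis
    using represents_mult weight_zero_mult by (auto simp: im_prod_fun_def im_fun_def[abs_def])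
qed

lemma re_fun_vanishing_Re:
  assumes "xs \<in> set generator_monomials" "ys \<in> set generator_monomials"
  shows "re_fun ys \<in> vanishing_at Re (mset xs) \<longleftrightarrow> ys \<noteq> xs"
proof -
  have "re_fun ys \<in> vanishing_at Re (mset xs) \<longleftrightarrow> mset ys \<noteq> mset xs \<and> conj_mono (mset ys) \<noteq> mset xs"
    using represents_re_fun[OF assms(2)]
    by (auto simp: vanishing_at_iff coefficient_Re_pol split: if_splits)
  also have "\<dots> \<longleftrightarrow> ys \<noteq> xs"
    using assms inj_mset_generator_monomials conj_generator_monomial_eq by metis
  finally show ?thesis .
qed

lemma im_fun_vanishing_Re:
  assumes "ys \<in> set generator_monomials"
  shows "im_fun ys \<in> vanishing_at Re M"
  using represents_im_fun[OF assms] by (auto simp: vanishing_at_iff coefficient_Im_pol)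

lemma re_fun_vanishing_Im:
  assumes "ys \<in> set generator_monomials"
  shows "re_fun ys \<in> vanishing_at Im M"
  using represents_re_fun[OF assms] by (auto simp: vanishing_at_iff coefficient_Re_pol)

lemma im_fun_vanishing_Im:
  assumes "xs \<in> set nonreal_monomials" "ys \<in> set nonreal_monomials"
  shows "im_fun ys \<in> vanishing_at Im (mset xs) \<longleftrightarrow> ys \<noteq> xs"
proof -
  have gm: "xs \<in> set generator_monomials" "ys \<in> set generator_monomials" using assms nonreal_subset by auto
  have "conj_mono (mset ys) \<noteq> mset xs" using conj_nonreal_neq[OF gm(1) assms(2)] by simp
  then have "im_fun ys \<in> vanishing_at Im (mset xs) \<longleftrightarrow> mset ys \<noteq> mset xs"
    using represents_im_fun[OF gm(2)] by (auto simp: vanishing_at_iff coefficient_Im_pol)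
  also have "\<dots> \<longleftrightarrow> ys \<noteq> xs" using gm inj_mset_generator_monomials by metis
  finally show ?thesis .
qed

lemma coefficient_Im_pol_const: "M \<noteq> {#} \<Longrightarrow> coefficient (Im_pol M) {#} = 0"
  by (simp add: coefficient_Im_pol)

lemma generator_monomial_nonempty: "xs \<in> set generator_monomials \<Longrightarrow> mset xs \<noteq> {#}"
  using generator_monomial_irreducible[of xs] unfolding irreducible_mono_def by blast

lemma coefficient_Im_prod_irreducible:
  assumes "(xs, ys) \<in> set im_pairs" "irreducible_mono M"
  shows "coefficient (Im_pol (mset xs) * Im_pol (mset ys)) M = 0"
proof -
  have gm: "xs \<in> set generator_monomials" "ys \<in> set generator_monomials"
    using assms set_im_pairs nonreal_subset by auto
  have "weight_zero (Im_pol (mset xs))" using represents_im_fun[OF gm(1)] by blast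
  then show ?thesis
    using coefficient_Im_pol_const[OF generator_monomial_nonempty[OF gm(1)]]
      coefficient_Im_pol_const[OF generator_monomial_nonempty[OF gm(2)]]
    by (simp add: coefficient_mult_irreducible[OF assms(2)])
qed

lemma im_prod_fun_vanishing_Re:
  assumes "pr \<in> set im_pairs" "irreducible_mono M"
  shows "im_prod_fun pr \<in> vanishing_at Re M"
  using represents_im_prod_fun[of "fst pr" "snd pr"] coefficient_Im_prod_irreducible[of "fst pr" "snd pr" M] assms
  by (auto simp: vanishing_at_iff)

text \<open>
  A product of two imaginary parts is separated from the other generators by its expansion
  \<open>Im m * Im n = (Re (m * cnj n) - Re (m * n)) / 2\<close>: only it distinguishes the monomials \<open>m n\<close> and
  \<open>m (cnj n)\<close>. The equality of the coefficients of \<open>n\<close> and \<open>cnj n\<close> is needed to make the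
  condition on \<open>m n\<close> and \<open>m (cnj n)\<close> stable under products.
\<close>

definition balanced_at :: "mono \<Rightarrow> mono \<Rightarrow> (point \<Rightarrow> real) set" where
  "balanced_at M N = {F. \<exists>P. represents P F \<and> weight_zero P \<and> coefficient P N = coefficient P (conj_mono N)
     \<and> coefficient P (M + N) = coefficient P (M + conj_mono N)}"

lemma balanced_at_iff:
  assumes "represents P F" "weight_zero P"
  shows "F \<in> balanced_at M N \<longleftrightarrow> coefficient P N = coefficient P (conj_mono N)
     \<and> coefficient P (M + N) = coefficient P (M + conj_mono N)"
  unfolding balanced_at_def using assms represents_unique by blast

lemma subalgebra_balanced_at:
  assumes irr: "irreducible_mono M" "irreducible_mono N" and ne: "M \<noteq> N" "M \<noteq> conj_mono N"
    and fac: "only_factors M N" "only_factors M (conj_mono N)"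
  shows "subalgebra (balanced_at M N)"
  unfolding subalgebra_def
proof (intro conjI allI ballI)
  have nonempty: "M \<noteq> {#}" "N \<noteq> {#}" "conj_mono N \<noteq> {#}" using irr by (auto simp: irreducible_mono_def)
  fix c
  have "coefficient (mterm {#} (complex_of_real c)) K = 0" if "K \<noteq> {#}" for K
    using that by (simp add: lookup_single when_def)
  then show "(\<lambda>_. c) \<in> balanced_at M N"
    using balanced_at_iff[OF represents_const weight_zero_const] nonempty by auto
next
  have nonempty: "M \<noteq> {#}" "N \<noteq> {#}" "conj_mono N \<noteq> {#}" using irr by (auto simp: irreducible_mono_def)
  fix F G assume F: "F \<in> balanced_at M N" and G: "G \<in> balanced_at M N"
  obtain P where P: "represents P F" "weight_zero P" "coefficient P N = coefficient P (conj_mono N)"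
    "coefficient P (M + N) = coefficient P (M + conj_mono N)"
    using F by (auto simp: balanced_at_def)
  obtain Q where Q: "represents Q G" "weight_zero Q" "coefficient Q N = coefficient Q (conj_mono N)"
    "coefficient Q (M + N) = coefficient Q (M + conj_mono N)"
    using G by (auto simp: balanced_at_def)
  show "(\<lambda>p. F p + G p) \<in> balanced_at M N"
    using balanced_at_iff[OF represents_add weight_zero_add, OF P(1) Q(1) P(2) Q(2)] P(3,4) Q(3,4)
    by (simp add: lookup_add)
  have conj_irr: "irreducible_mono (conj_mono N)" using irr(2) by (simp add: irreducible_mono_conj)
  show "(\<lambda>p. F p * G p) \<in> balanced_at M N"
    unfolding balanced_at_iff[OF represents_mult weight_zero_mult, OF P(1) Q(1) P(2) Q(2)]
      coefficient_mult_irreducible[OF irr(2) P(2)] coefficient_mult_irreducible[OF conj_irr P(2)]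
      coefficient_mult_two_factors[OF fac(1) ne(1) nonempty(1,2) P(2)]
      coefficient_mult_two_factors[OF fac(2) ne(2) nonempty(1,3) P(2)] P(3,4) Q(3,4) by simp
qed

lemma factors_of_im_pairs:
  "\<forall>(xs, ys)\<in>set im_pairs.
     (\<forall>zs\<in>set (subseqs (xs @ ys)). sum_list (map wtl zs) = 0 \<longrightarrow> zs \<in> {[], xs, ys, xs @ ys})
   \<and> (\<forall>zs\<in>set (subseqs (xs @ map bar ys)). sum_list (map wtl zs) = 0 \<longrightarrow> zs \<in> {[], xs, map bar ys, xs @ map bar ys})"
  unfolding im_pairs_def by (simp add: Let_def)

lemma only_factors_mset:
  assumes "\<forall>zs\<in>set (subseqs (xs @ ys)). sum_list (map wtl zs) = 0 \<longrightarrow> zs \<in> {[], xs, ys, xs @ ys}"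
  shows "only_factors (mset xs) (mset ys)"
  unfolding only_factors_def
proof (intro allI impI)
  fix A assume A: "A \<subseteq># mset xs + mset ys" "wt A = 0"
  then obtain zs where zs: "zs \<in> set (subseqs (xs @ ys))" "mset zs = A"
    using subset_mset_subseq[of A "xs @ ys"] by auto
  then have "zs \<in> {[], xs, ys, xs @ ys}" using assms A(2) by (auto simp: wt_mset[symmetric])
  then show "A \<in> {{#}, mset xs, mset ys, mset xs + mset ys}" using zs(2) by auto
qed

text \<open>The degrees in the separate variables, which already tell the products apart.\<close>

definition unbar :: "letter \<Rightarrow> letter" where
  "unbar l = (if wtl l < 0 then bar l else l)"

lemma unbar_bar [simp]: "unbar (bar l) = unbar l"
  by (cases l) (simp_all add: unbar_def)

lemma unbar_conj [simp]: "image_mset unbar (conj_mono M) = image_mset unbar M"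
  by (simp add: multiset.map_comp o_def)

lemma distinct_im_pairs_degrees: "distinct (map (\<lambda>(xs, ys). code (map unbar (xs @ ys))) im_pairs)"
  unfolding im_pairs_def by (simp add: unbar_def code_def)

lemma distinct_im_pairs: "distinct im_pairs"
  using distinct_im_pairs_degrees by (simp add: distinct_map)

lemma im_pairs_degrees_neq:
  assumes "(xs, ys) \<in> set im_pairs" "(us, vs) \<in> set im_pairs" "(us, vs) \<noteq> (xs, ys)"
  shows "image_mset unbar (mset us + mset vs) \<noteq> image_mset unbar (mset xs + mset ys)"
proof
  assume "image_mset unbar (mset us + mset vs) = image_mset unbar (mset xs + mset ys)"
  then have "code (map unbar (us @ vs)) = code (map unbar (xs @ ys))" by (simp add: code_eq_iff)
  moreover have "inj_on (\<lambda>(xs, ys). code (map unbar (xs @ ys))) (set im_pairs)"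
    using distinct_im_pairs_degrees by (simp add: distinct_map)
  ultimately have "(us, vs) = (xs, ys)"
    using assms(1,2) by (intro inj_onD[of "\<lambda>(xs, ys). code (map unbar (xs @ ys))" "set im_pairs"]) auto
  with assms(3) show False by simp
qed

lemma keys_Im_pol: "A \<in> Poly_Mapping.keys (Im_pol M) \<Longrightarrow> A = M \<or> A = conj_mono M"
  by (auto simp: in_keys_iff coefficient_Im_pol split: if_splits)

lemma coefficient_Im_prod_degrees:
  assumes "image_mset unbar (M + N) \<noteq> image_mset unbar K"
  shows "coefficient (Im_pol M * Im_pol N) K = 0"
proof (rule ccontr)
  assume "coefficient (Im_pol M * Im_pol N) K \<noteq> 0"
  then have "K \<in> Poly_Mapping.keys (Im_pol M * Im_pol N)" by (simp add: in_keys_iff)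
  then obtain A B where "K = A + B" "A \<in> Poly_Mapping.keys (Im_pol M)" "B \<in> Poly_Mapping.keys (Im_pol N)"
    using keys_mult[of "Im_pol M" "Im_pol N"] by blast
  with assms keys_Im_pol[of A M] keys_Im_pol[of B N] show False by auto
qed

lemma reducible_sum:
  assumes "irreducible_mono M" "irreducible_mono N"
  shows "\<not> irreducible_mono (M + N)"
  using assms unfolding irreducible_mono_def by (metis add_cancel_left_right mset_subset_eq_add_left)

lemma pair_separated:
  assumes pair: "(xs, ys) \<in> set im_pairs"
  defines "Q \<equiv> balanced_at (mset xs) (mset ys)"
  shows "subalgebra Q" "re_fun ` set generator_monomials \<subseteq> Q" "im_prod_fun ` (set im_pairs - {(xs, ys)}) \<subseteq> Q"
    "im_prod_fun (xs, ys) \<notin> Q"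
proof -
  have nr: "xs \<in> set nonreal_monomials" "ys \<in> set nonreal_monomials" using pair set_im_pairs by auto
  have gm: "xs \<in> set generator_monomials" "ys \<in> set generator_monomials" using nr nonreal_subset by auto
  define M N where "M = mset xs" and "N = mset ys"
  have "xs \<noteq> ys" using pair unfolding im_pairs_def by auto
  then have "M \<noteq> N" using inj_mset_generator_monomials[OF gm] by (auto simp: M_def N_def)
  have "M \<noteq> conj_mono N" using conj_nonreal_neq[OF gm(1) nr(2)] by (simp add: M_def N_def)
  then have "conj_mono M \<noteq> N" by auto
  have nonreal: "conj_mono M \<noteq> M" "conj_mono N \<noteq> N"
    using conj_nonreal_neq[OF gm(1) nr(1)] conj_nonreal_neq[OF gm(2) nr(2)] by (simp_all add: M_def N_def)
  have irr: "irreducible_mono M" "irreducible_mono N"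
    using generator_monomial_irreducible gm by (auto simp: M_def N_def)
  have fac: "only_factors M N" "only_factors M (conj_mono N)"
    using bspec[OF factors_of_im_pairs pair] only_factors_mset[of xs ys] only_factors_mset[of xs "map bar ys"]
    unfolding prod.case M_def N_def mset_map by blast+
  show "subalgebra Q"
    unfolding Q_def M_def[symmetric] N_def[symmetric]
    by (rule subalgebra_balanced_at) fact+
  have Q: "Q = balanced_at M N" by (simp add: Q_def M_def N_def)
  have red: "\<not> irreducible_mono (M + N)" "\<not> irreducible_mono (M + conj_mono N)"
    using reducible_sum irr irreducible_mono_conj by blast+
  have "re_fun zs \<in> Q" if zs: "zs \<in> set generator_monomials" for zs
  proof -
    define K where "K = mset zs"
    have "irreducible_mono K" "irreducible_mono (conj_mono K)"
      using generator_monomial_irreducible[OF zs] by (simp_all add: K_def irreducible_mono_conj)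
    then have "K \<noteq> M + N" "conj_mono K \<noteq> M + N" "K \<noteq> M + conj_mono N" "conj_mono K \<noteq> M + conj_mono N"
      using red by auto
    moreover have "K = conj_mono N \<longleftrightarrow> conj_mono K = N" by auto
    ultimately show ?thesis
      using represents_re_fun[OF zs] conj_mono_eq_iff[of K N]
      by (auto simp: Q balanced_at_iff coefficient_Re_pol K_def[symmetric])
  qed
  then show "re_fun ` set generator_monomials \<subseteq> Q" by blast
  have "im_prod_fun (us, vs) \<in> Q" if uv: "(us, vs) \<in> set im_pairs" "(us, vs) \<noteq> (xs, ys)" for us vs
  proof -
    have "image_mset unbar (mset us + mset vs) \<noteq> image_mset unbar (M + N)"
      "image_mset unbar (mset us + mset vs) \<noteq> image_mset unbar (M + conj_mono N)"
      using im_pairs_degrees_neq[OF pair uv] by (simp_all add: M_def N_def)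
    moreover note rep = represents_im_prod_fun[OF uv(1)]
    ultimately show ?thesis
      using coefficient_Im_prod_irreducible[OF uv(1)] irr(2)
      unfolding Q balanced_at_iff[OF rep[THEN conjunct1] rep[THEN conjunct2]]
      by (simp add: irreducible_mono_conj coefficient_Im_prod_degrees)
  qed
  then show "im_prod_fun ` (set im_pairs - {(xs, ys)}) \<subseteq> Q" by auto
  have ne: "M \<noteq> {#}" "N \<noteq> {#}" using irr by (auto simp: irreducible_mono_def)
  have w: "weight_zero (Im_pol M)" using represents_im_fun[OF gm(1)] by (simp add: M_def)
  have "N \<noteq> M" "conj_mono N \<noteq> M" "M \<noteq> conj_mono M" "N \<noteq> conj_mono N"
    using \<open>M \<noteq> N\<close> \<open>M \<noteq> conj_mono N\<close> nonreal by auto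
  have plus: "coefficient (Im_pol M * Im_pol N) (M + N) = -1/4"
    using \<open>M \<noteq> N\<close> \<open>N \<noteq> M\<close> \<open>conj_mono M \<noteq> N\<close> \<open>conj_mono N \<noteq> M\<close> nonreal ne
    by (simp add: coefficient_mult_two_factors[OF fac(1) \<open>M \<noteq> N\<close> ne w] coefficient_Im_pol)
  have minus: "coefficient (Im_pol M * Im_pol N) (M + conj_mono N) = 1/4"
    using \<open>M \<noteq> N\<close> \<open>N \<noteq> M\<close> \<open>conj_mono M \<noteq> N\<close> \<open>conj_mono N \<noteq> M\<close> \<open>M \<noteq> conj_mono N\<close> \<open>N \<noteq> conj_mono N\<close> nonreal ne
    by (simp add: coefficient_mult_two_factors[OF fac(2) \<open>M \<noteq> conj_mono N\<close> ne(1) _ w] coefficient_Im_pol conj_mono_eq_iff)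
  note rep = represents_im_prod_fun[OF pair, folded M_def N_def]
  show "im_prod_fun (xs, ys) \<notin> Q"
    unfolding Q balanced_at_iff[OF rep[THEN conjunct1] rep[THEN conjunct2]] plus minus by simp
qed

text \<open>
  A subalgebra that contains all generators but one contains everything that the others generate.
\<close>

lemma separated_imp_inj_and_minimal:
  assumes "\<And>i. i \<in> I \<Longrightarrow> \<exists>Q. subalgebra Q \<and> F ` (I - {i}) \<subseteq> Q \<and> F i \<notin> Q"
  shows "inj_on F I" "T \<subset> F ` I \<Longrightarrow> alg T \<noteq> alg (F ` I)" "i \<in> I \<Longrightarrow> F i \<noteq> (\<lambda>_. 0)"
proof -
  show inj: "inj_on F I"
  proof (rule inj_onI, rule ccontr)
    fix i j assume ij: "i \<in> I" "j \<in> I" "F i = F j" "i \<noteq> j"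
    from assms[OF ij(1)] obtain Q where "F ` (I - {i}) \<subseteq> Q" "F i \<notin> Q" by blast
    with ij show False by auto
  qed
  show "alg T \<noteq> alg (F ` I)" if T: "T \<subset> F ` I"
  proof -
    obtain i where i: "i \<in> I" "F i \<notin> T" "T \<subseteq> F ` I" using T by blast
    obtain Q where Q: "subalgebra Q" "F ` (I - {i}) \<subseteq> Q" "F i \<notin> Q" using assms[OF i(1)] by blast
    have "T \<subseteq> Q" using i Q(2) by blast
    then have "alg T \<subseteq> Q" using alg_subset_subalgebra Q(1) by blast
    then have "F i \<notin> alg T" using Q(3) by blast
    moreover have "F i \<in> alg (F ` I)" using i(1) by (auto intro: generated_algebra.gen)
    ultimately show ?thesis by blast
  qed
  show "F i \<noteq> (\<lambda>_. 0)" if "i \<in> I"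
    using assms[OF that] unfolding subalgebra_def by auto
qed

text \<open>With indices for the generators, their distinctness is injectivity on the index set.\<close>

definition SO2_generator :: "letter list + letter list \<Rightarrow> point \<Rightarrow> real" where
  "SO2_generator = case_sum re_fun im_fun"

definition SO2_indices :: "(letter list + letter list) set" where
  "SO2_indices = set generator_monomials <+> set nonreal_monomials"

definition O2_generator :: "letter list + letter list \<times> letter list \<Rightarrow> point \<Rightarrow> real" where
  "O2_generator = case_sum re_fun im_prod_fun"

definition O2_indices :: "(letter list + letter list \<times> letter list) set" where
  "O2_indices = set generator_monomials <+> set im_pairs"

lemma SO2_generators_eq: "SO2_generators = SO2_generator ` SO2_indices"
  by (simp add: SO2_generators_def SO2_generator_def SO2_indices_def Plus_def image_Un image_image)

lemma O2_generators_eq: "O2_generators = O2_generator ` O2_indices"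
  by (simp add: O2_generators_def O2_generator_def O2_indices_def Plus_def image_Un image_image)

lemma SO2_separated:
  assumes "i \<in> SO2_indices"
  shows "\<exists>Q. subalgebra Q \<and> SO2_generator ` (SO2_indices - {i}) \<subseteq> Q \<and> SO2_generator i \<notin> Q"
proof -
  consider xs where "i = Inl xs" "xs \<in> set generator_monomials" | xs where "i = Inr xs" "xs \<in> set nonreal_monomials"
    using assms by (auto simp: SO2_indices_def)
  then show ?thesis
  proof cases
    case 1
    have "subalgebra (vanishing_at Re (mset xs))"
      using subalgebra_vanishing_at generator_monomial_irreducible 1(2) by blast
    then show ?thesis
      using 1 re_fun_vanishing_Re im_fun_vanishing_Re nonreal_subset
      by (intro exI[of _ "vanishing_at Re (mset xs)"]) (auto simp: SO2_generator_def SO2_indices_def)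
  next
    case 2
    have "subalgebra (vanishing_at Im (mset xs))"
      using subalgebra_vanishing_at generator_monomial_irreducible 2(2) nonreal_subset by blast
    then show ?thesis
      using 2 re_fun_vanishing_Im im_fun_vanishing_Im
      by (intro exI[of _ "vanishing_at Im (mset xs)"]) (auto simp: SO2_generator_def SO2_indices_def)
  qed
qed

lemma O2_separated:
  assumes "i \<in> O2_indices"
  shows "\<exists>Q. subalgebra Q \<and> O2_generator ` (O2_indices - {i}) \<subseteq> Q \<and> O2_generator i \<notin> Q"
proof -
  consider xs where "i = Inl xs" "xs \<in> set generator_monomials" | xs ys where "i = Inr (xs, ys)" "(xs, ys) \<in> set im_pairs"
    using assms by (auto simp: O2_indices_def)
  then show ?thesis
  proof cases
    case 1
    have "subalgebra (vanishing_at Re (mset xs))"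
      using subalgebra_vanishing_at generator_monomial_irreducible 1(2) by blast
    then show ?thesis
      using 1 re_fun_vanishing_Re im_prod_fun_vanishing_Re generator_monomial_irreducible
      by (intro exI[of _ "vanishing_at Re (mset xs)"]) (auto simp: O2_generator_def O2_indices_def)
  next
    case 2
    show ?thesis
      using pair_separated[OF 2(2)] 2(1)
      by (intro exI[of _ "balanced_at (mset xs) (mset ys)"]) (auto simp: O2_generator_def O2_indices_def)
  qed
qed

section \<open>From coordinates to tensors\<close>

abbreviation triplet_space :: "(triplet \<times> (real^2)) set" where
  "triplet_space \<equiv> VV \<times> UNIV"

definition coordinates :: "(triplet \<Rightarrow> harm) \<Rightarrow> triplet \<times> (real^2) \<Rightarrow> point" where
  "coordinates \<Phi> = (\<lambda>(v, x). (\<Phi> v, Complex (x$1) (x$2)))"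

lemma in_coordinates_alt: "in_coordinates \<Phi> F = restrict (\<lambda>w. F (coordinates \<Phi> w)) triplet_space"
  by (auto simp: in_coordinates_def coordinates_def restrict_def fun_eq_iff)

lemma in_coordinates_apply: "w \<in> triplet_space \<Longrightarrow> in_coordinates \<Phi> F w = F (coordinates \<Phi> w)"
  by (simp add: in_coordinates_alt)

lemma VV_closed: "u \<in> VV \<Longrightarrow> v \<in> VV \<Longrightarrow> u + v \<in> VV" "u \<in> VV \<Longrightarrow> c *\<^sub>R u \<in> VV"
  by (auto simp: VV_def Ela_def Piez_def Sym2_def)

lemma actV_closed:
  assumes "v \<in> VV"
  shows "actV g v \<in> VV"
proof -
  obtain C P S where v: "v = (C, P, S)" by (metis prod_cases3)
  have m: "C \<in> Ela" "P \<in> Piez" "S \<in> Sym2" using assms by (auto simp: v VV_def)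
  note [simp] = m(1)[unfolded Ela_iff] m(2)[unfolded Piez_iff] m(3)[unfolded Sym2_iff]
  have "act4 g C \<in> Ela" unfolding Ela_iff by (simp add: act4_def sum_2)
  moreover have "act3 g P \<in> Piez" unfolding Piez_iff by (simp add: act3_def sum_2)
  moreover have "act2 g S \<in> Sym2" unfolding Sym2_iff by (simp add: act2_def sum_2)
  ultimately show ?thesis by (simp add: v VV_def actV_def)
qed

lemma mult_refl2_nth: "(g ** refl2) $ i $ 1 = g $ i $ 1" "(g ** refl2) $ i $ 2 = - g $ i $ 2"
  by (simp_all add: matrix_matrix_mult_def sum_2 refl2_nth)

lemma actV_mult_refl2: "actV (g ** refl2) v = actV g (actV refl2 v)"
proof -
  obtain C P S where v: "v = (C, P, S)" by (metis prod_cases3)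
  show ?thesis
    unfolding v actV_def prod.case prod.inject
    by (simp add: vec_eq_iff act4_def act3_def act2_def sum_2 mult_refl2_nth refl2_nth)
qed

definition act :: "real^2^2 \<Rightarrow> triplet \<times> (real^2) \<Rightarrow> triplet \<times> (real^2)" where
  "act g = (\<lambda>(v, x). (actV g v, g *v x))"

context
  fixes \<Phi> :: "triplet \<Rightarrow> harm"
  assumes decomposition: "harmonic_decomposition \<Phi>"
begin

lemma bij_coordinates: "bij_betw (coordinates \<Phi>) triplet_space UNIV"
proof -
  have b: "bij_betw \<Phi> VV UNIV" using decomposition by (simp add: harmonic_decomposition_def)
  have "inj_on (coordinates \<Phi>) triplet_space"
    using b by (auto simp: inj_on_def bij_betw_def coordinates_def vec_eq_iff forall_2)
  moreover have "p \<in> coordinates \<Phi> ` triplet_space" for p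
  proof -
    obtain h z where p: "p = (h, z)" by (cases p)
    obtain v where "v \<in> VV" "\<Phi> v = h" using b by (metis UNIV_I bij_betw_def imageE)
    then have "coordinates \<Phi> (v, vector [Re z, Im z]) = p" "(v, vector [Re z, Im z] :: real^2) \<in> triplet_space"
      by (simp_all add: coordinates_def p)
    then show ?thesis by (metis imageI)
  qed
  ultimately show ?thesis by (auto simp: bij_betw_def)
qed

lemma coordinates_surj: obtains w where "w \<in> triplet_space" "coordinates \<Phi> w = p"
proof -
  have "p \<in> coordinates \<Phi> ` triplet_space" using bij_coordinates by (simp add: bij_betw_def)
  with that show ?thesis by (elim imageE) simp
qed

lemma inj_in_coordinates: "inj (in_coordinates \<Phi>)"
proof (rule injI, rule ext)
  fix F G p assume eq: "in_coordinates \<Phi> F = in_coordinates \<Phi> G"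
  obtain w where "w \<in> triplet_space" "coordinates \<Phi> w = p" by (rule coordinates_surj)
  with fun_cong[OF eq, of w] show "F p = G p" by (simp add: in_coordinates_apply)
qed

lemma coordinates_add:
  assumes "u \<in> triplet_space" "w \<in> triplet_space"
  shows "coordinates \<Phi> (u + w) = coordinates \<Phi> u + coordinates \<Phi> w"
proof -
  have "\<Phi> (fst u + fst w) = \<Phi> (fst u) + \<Phi> (fst w)"
    using assms decomposition by (simp add: harmonic_decomposition_def mem_Times_iff)
  then show ?thesis by (simp add: coordinates_def case_prod_beta complex_eq_iff)
qed

lemma coordinates_scale:
  assumes "w \<in> triplet_space"
  shows "coordinates \<Phi> (c *\<^sub>R w) = c *\<^sub>R coordinates \<Phi> w"
proof -
  have "\<Phi> (c *\<^sub>R fst w) = c *\<^sub>R \<Phi> (fst w)"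
    using assms decomposition by (simp add: harmonic_decomposition_def mem_Times_iff)
  then show ?thesis by (simp add: coordinates_def case_prod_beta complex_eq_iff)
qed

lemma triplet_space_closed:
  "u \<in> triplet_space \<Longrightarrow> w \<in> triplet_space \<Longrightarrow> u + w \<in> triplet_space" "w \<in> triplet_space \<Longrightarrow> c *\<^sub>R w \<in> triplet_space"
  using VV_closed by (auto simp: mem_Times_iff)

text \<open>
  Outside the subspace the decomposition is arbitrary, so it is replaced by a linear left inverse
  of the inverse coordinate map, which is linear on the whole space.
\<close>

lemma linear_coordinates:
  obtains g J where "linear g" "linear J" "\<And>w. w \<in> triplet_space \<Longrightarrow> g w = coordinates \<Phi> w"
    "\<And>p. J p \<in> triplet_space" "\<And>p. coordinates \<Phi> (J p) = p"
proof -
  define J where "J = inv_into triplet_space (coordinates \<Phi>)"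
  have J: "J p \<in> triplet_space" "coordinates \<Phi> (J p) = p" for p
    using bij_coordinates inv_into_into[of p "coordinates \<Phi>" triplet_space]
      f_inv_into_f[of p "coordinates \<Phi>" triplet_space] by (simp_all add: J_def bij_betw_def)
  have J_unique: "w = J p" if "w \<in> triplet_space" "coordinates \<Phi> w = p" for w p
    by (rule inj_onD[OF bij_betw_imp_inj_on[OF bij_coordinates]]) (simp_all only: that J)
  have "linear J"
  proof (rule linearI)
    show "J (p + q) = J p + J q" for p q
      using J_unique[of "J p + J q" "p + q"] J triplet_space_closed coordinates_add by simp
    show "J (c *\<^sub>R p) = c *\<^sub>R J p" for c p
      using J_unique[of "c *\<^sub>R J p" "c *\<^sub>R p"] J triplet_space_closed coordinates_scale by simp
  qed
  moreover have "inj J" using J(2) by (metis injI)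
  ultimately obtain g where g: "linear g" "g \<circ> J = id" using linear_injective_left_inverse by blast
  have "g w = coordinates \<Phi> w" if "w \<in> triplet_space" for w
    using J_unique[OF that refl] g(2) by (metis comp_apply id_apply)
  with \<open>linear J\<close> g(1) J that show ?thesis by blast
qed

lemma polynomials_on_triplet_space:
  "polynomials_on triplet_space = in_coordinates \<Phi> ` {F. real_polynomial_function F}"
proof (intro equalityI subsetI)
  obtain g J where gJ: "linear g" "linear J" "\<And>w. w \<in> triplet_space \<Longrightarrow> g w = coordinates \<Phi> w"
    "\<And>p. J p \<in> triplet_space" "\<And>p. coordinates \<Phi> (J p) = p"
    using linear_coordinates by blast
  {
    fix f assume "f \<in> polynomials_on triplet_space"
    then obtain P where P: "real_polynomial_function P" "f = restrict P triplet_space"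
      by (auto simp: polynomials_on_def)
    have "polynomial_function J"
      using gJ(2) by (intro polynomial_function_bounded_linear) (simp add: linear_conv_bounded_linear)
    then have "real_polynomial_function (P \<circ> J)" using P(1) by (rule real_polynomial_function_compose)
    moreover have "J (coordinates \<Phi> w) = w" if "w \<in> triplet_space" for w
      using that gJ(4,5) by (intro inj_onD[OF bij_betw_imp_inj_on[OF bij_coordinates]])
    then have "in_coordinates \<Phi> (P \<circ> J) = f"
      by (auto simp: in_coordinates_alt P(2) restrict_def fun_eq_iff)
    ultimately show "f \<in> in_coordinates \<Phi> ` {F. real_polynomial_function F}" by blast
  next
    fix f assume "f \<in> in_coordinates \<Phi> ` {F. real_polynomial_function F}"
    then obtain F where F: "real_polynomial_function F" "f = in_coordinates \<Phi> F" by blast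
    have "polynomial_function g"
      using gJ(1) by (intro polynomial_function_bounded_linear) (simp add: linear_conv_bounded_linear)
    then have "real_polynomial_function (F \<circ> g)" using F(1) by (rule real_polynomial_function_compose)
    moreover have "f = restrict (F \<circ> g) triplet_space"
      by (auto simp: in_coordinates_alt F(2) restrict_def fun_eq_iff gJ(3))
    ultimately show "f \<in> polynomials_on triplet_space" by (auto simp: polynomials_on_def)
  }
qed

lemma act_closed: "w \<in> triplet_space \<Longrightarrow> act g w \<in> triplet_space"
  by (auto simp: act_def actV_closed)

lemma coordinates_rot: "w \<in> triplet_space \<Longrightarrow> coordinates \<Phi> (act (rot \<theta>) w) = rotate_point \<theta> (coordinates \<Phi> w)"
proof -
  assume w: "w \<in> triplet_space"
  obtain v x where vx: "w = (v, x)" by (cases w)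
  obtain l1 l2 l3 a1 b1 a2 b2 a3 a4 where h: "\<Phi> v = (l1, l2, l3, a1, b1, a2, b2, a3, a4)"
    by (metis prod.exhaust_sel)
  have "\<Phi> (actV (rot \<theta>) v) = harm_rot \<theta> (\<Phi> v)"
    using w decomposition by (auto simp: vx harmonic_decomposition_def)
  then show ?thesis
    by (simp add: vx act_def coordinates_def rotate_point_def assign_def h harm_rot_def mult.commute
        lam1_def lam2_def lam3_def z1a_def z1b_def z2a_def z2b_def z3_def z4_def zx_def
        matrix_vector_mult_def sum_2 rot_nth complex_eq_iff)
qed

lemma coordinates_refl: "w \<in> triplet_space \<Longrightarrow> coordinates \<Phi> (act refl2 w) = reflect_point (coordinates \<Phi> w)"
proof -
  assume w: "w \<in> triplet_space"
  obtain v x where vx: "w = (v, x)" by (cases w)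
  obtain l1 l2 l3 a1 b1 a2 b2 a3 a4 where h: "\<Phi> v = (l1, l2, l3, a1, b1, a2, b2, a3, a4)"
    by (metis prod.exhaust_sel)
  have "\<Phi> (actV refl2 v) = harm_refl (\<Phi> v)"
    using w decomposition by (auto simp: vx harmonic_decomposition_def)
  then show ?thesis
    by (simp add: vx act_def coordinates_def reflect_point_def assign_def h harm_refl_def
        lam1_def lam2_def lam3_def z1a_def z1b_def z2a_def z2b_def z3_def z4_def zx_def
        matrix_vector_mult_def sum_2 refl2_nth complex_eq_iff)
qed

lemma act_mult_refl2: "act (g ** refl2) w = act g (act refl2 w)"
  by (cases w) (simp add: act_def actV_mult_refl2 matrix_vector_mul_assoc)

lemma Cov_in_coordinates:
  "Cov actV VV G = in_coordinates \<Phi> ` {F. real_polynomial_function F \<and>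
     (\<forall>g\<in>G. \<forall>w\<in>triplet_space. F (coordinates \<Phi> (act g w)) = F (coordinates \<Phi> w))}"
proof -
  have "in_coordinates \<Phi> F (act g w) = in_coordinates \<Phi> F w \<longleftrightarrow> F (coordinates \<Phi> (act g w)) = F (coordinates \<Phi> w)"
    if "w \<in> triplet_space" for F g w
    using that by (simp only: in_coordinates_apply act_closed)
  then show ?thesis
    unfolding Cov_def Inv_def polynomials_on_triplet_space act_def[symmetric] by blast
qed

lemma Cov_SO2: "Cov actV VV SO2 = in_coordinates \<Phi> ` SO2_invariants"
proof -
  have "(\<forall>g\<in>SO2. \<forall>w\<in>triplet_space. F (coordinates \<Phi> (act g w)) = F (coordinates \<Phi> w))
      \<longleftrightarrow> (\<forall>\<theta> p. F (rotate_point \<theta> p) = F p)" for F :: "point \<Rightarrow> real"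
  proof
    assume L: "\<forall>g\<in>SO2. \<forall>w\<in>triplet_space. F (coordinates \<Phi> (act g w)) = F (coordinates \<Phi> w)"
    show "\<forall>\<theta> p. F (rotate_point \<theta> p) = F p"
    proof (intro allI)
      fix \<theta> p
      obtain w where w: "w \<in> triplet_space" "coordinates \<Phi> w = p" by (rule coordinates_surj)
      with L[unfolded SO2_eq, rule_format, of "rot \<theta>" w] show "F (rotate_point \<theta> p) = F p"
        by (simp add: coordinates_rot)
    qed
  qed (auto simp: SO2_eq coordinates_rot)
  then show ?thesis by (simp add: Cov_in_coordinates SO2_invariants_def)
qed

lemma Cov_O2: "Cov actV VV O2 = in_coordinates \<Phi> ` O2_invariants"
proof -
  have "(\<forall>g\<in>O2. \<forall>w\<in>triplet_space. F (coordinates \<Phi> (act g w)) = F (coordinates \<Phi> w))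
      \<longleftrightarrow> (\<forall>\<theta> p. F (rotate_point \<theta> p) = F p) \<and> (\<forall>p. F (reflect_point p) = F p)" (is "?L \<longleftrightarrow> ?R")
    for F :: "point \<Rightarrow> real"
  proof
    assume L: ?L
    show ?R
    proof (intro conjI allI)
      fix \<theta> p
      obtain w where w: "w \<in> triplet_space" "coordinates \<Phi> w = p" by (rule coordinates_surj)
      have "rot \<theta> \<in> O2" "refl2 \<in> O2" by (simp add: O2_eq) (simp add: O2_def refl2_orth)
      with L[rule_format, of "rot \<theta>" w] L[rule_format, of refl2 w] w
      show "F (rotate_point \<theta> p) = F p" "F (reflect_point p) = F p"
        by (simp_all add: coordinates_rot coordinates_refl)
    qed
  next
    assume R: ?R
    show ?L
    proof (intro ballI)
      fix g w assume g: "g \<in> O2" and w: "w \<in> triplet_space"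
      from g consider \<theta> where "g = rot \<theta>" | \<theta> where "g = rot \<theta> ** refl2" by (auto simp: O2_eq)
      then show "F (coordinates \<Phi> (act g w)) = F (coordinates \<Phi> w)"
        by cases (use R w in \<open>simp_all add: coordinates_rot coordinates_refl act_mult_refl2 act_closed\<close>)
    qed
  qed
  then show ?thesis by (simp add: Cov_in_coordinates O2_invariants_def SO2_invariants_def conj_assoc)
qed

lemma in_coordinates_add:
  "restrict (\<lambda>w. in_coordinates \<Phi> F w + in_coordinates \<Phi> G w) triplet_space = in_coordinates \<Phi> (\<lambda>p. F p + G p)"
  by (auto simp: in_coordinates_alt restrict_def fun_eq_iff)

lemma in_coordinates_mult:
  "restrict (\<lambda>w. in_coordinates \<Phi> F w * in_coordinates \<Phi> G w) triplet_space = in_coordinates \<Phi> (\<lambda>p. F p * G p)"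
  by (auto simp: in_coordinates_alt restrict_def fun_eq_iff)

lemma in_coordinates_const: "restrict (\<lambda>_. c) triplet_space = in_coordinates \<Phi> (\<lambda>_. c)"
  by (simp add: in_coordinates_alt)

lemma generated_algebra_in_coordinates:
  "generated_algebra triplet_space (in_coordinates \<Phi> ` S) = in_coordinates \<Phi> ` alg S"
proof (intro equalityI subsetI)
  fix f assume "f \<in> generated_algebra triplet_space (in_coordinates \<Phi> ` S)"
  then show "f \<in> in_coordinates \<Phi> ` alg S"
  proof (induction rule: generated_algebra.induct)
    case (const c)
    show ?case unfolding in_coordinates_const by (intro imageI alg_const)
  next
    case (gen f)
    then show ?case by (auto intro: generated_algebra.gen)
  next
    case (add f g)
    then obtain F G where "f = in_coordinates \<Phi> F" "g = in_coordinates \<Phi> G" "F \<in> alg S" "G \<in> alg S" by blast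
    then show ?case by (simp only: in_coordinates_add alg_add imageI)
  next
    case (mult f g)
    then obtain F G where "f = in_coordinates \<Phi> F" "g = in_coordinates \<Phi> G" "F \<in> alg S" "G \<in> alg S" by blast
    then show ?case by (simp only: in_coordinates_mult alg_mult imageI)
  qed
next
  fix f assume "f \<in> in_coordinates \<Phi> ` alg S"
  then obtain F where F: "F \<in> alg S" "f = in_coordinates \<Phi> F" by blast
  from F(1) have "in_coordinates \<Phi> F \<in> generated_algebra triplet_space (in_coordinates \<Phi> ` S)"
  proof (induction rule: generated_algebra.induct)
    case (const c)
    show ?case unfolding restrict_UNIV in_coordinates_const[symmetric] by (rule generated_algebra.const)
  next
    case (gen F)
    then show ?case by (intro generated_algebra.gen imageI)
  next
    case (add F G)
    show ?case unfolding restrict_UNIV in_coordinates_add[symmetric] by (rule generated_algebra.add) (rule add)+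
  next
    case (mult F G)
    show ?case unfolding restrict_UNIV in_coordinates_mult[symmetric] by (rule generated_algebra.mult) (rule mult)+
  qed
  with F(2) show "f \<in> generated_algebra triplet_space (in_coordinates \<Phi> ` S)" by simp
qed

end

section \<open>Degrees and orders\<close>

lemma val_scale: "val l (t *\<^sub>R p) = of_real t * val l p"
proof -
  obtain l1 l2 l3 a1 b1 a2 b2 a3 a4 z where p: "p = ((l1, l2, l3, a1, b1, a2, b2, a3, a4), z)"
    by (metis prod.exhaust_sel)
  show ?thesis unfolding p
    by (cases l) (simp_all add: lam1_def lam2_def lam3_def z1a_def z1b_def z2a_def z2b_def z3_def z4_def
        zx_def scaleR_conv_of_real)
qed

lemma ev_scale: "ev M (t *\<^sub>R p) = of_real (t ^ size M) * ev M p"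
  by (induction M) (simp_all add: val_scale algebra_simps)

lemma homogeneous_Re: "Re (ev M (t *\<^sub>R p)) = t ^ size M * Re (ev M p)"
  and homogeneous_Im: "Im (ev M (t *\<^sub>R p)) = t ^ size M * Im (ev M p)"
  by (simp_all add: ev_scale del: of_real_power)

definition free_of_x :: "letter list \<Rightarrow> bool" where
  "free_of_x xs \<longleftrightarrow> X \<notin> set xs \<and> X' \<notin> set xs"

lemma val_free: "l \<noteq> X \<Longrightarrow> l \<noteq> X' \<Longrightarrow> val l (h, z) = val l (h, z')"
proof -
  obtain l1 l2 l3 a1 b1 a2 b2 a3 a4 where h: "h = (l1, l2, l3, a1, b1, a2, b2, a3, a4)"
    by (metis prod.exhaust_sel)
  show "l \<noteq> X \<Longrightarrow> l \<noteq> X' \<Longrightarrow> val l (h, z) = val l (h, z')" unfolding h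
    by (cases l) (simp_all add: lam1_def lam2_def lam3_def z1a_def z1b_def z2a_def z2b_def z3_def z4_def)
qed

lemma ev_free: "free_of_x xs \<Longrightarrow> ev (mset xs) (h, z) = ev (mset xs) (h, z')"
proof (induction xs)
  case (Cons l xs)
  then have "val l (h, z) = val l (h, z')" by (intro val_free) (auto simp: free_of_x_def)
  moreover have "ev (mset xs) (h, z) = ev (mset xs) (h, z')" using Cons by (simp add: free_of_x_def)
  ultimately show ?case by simp
qed simp

lemma ev_not_free: "\<not> free_of_x xs \<Longrightarrow> ev (mset xs) (h, 0) = 0"
proof (induction xs)
  case (Cons l xs)
  have "zx (h, 0) = 0" by (cases h) (simp add: zx_def)
  with Cons show ?case by (cases l) (auto simp: free_of_x_def)
qed (simp add: free_of_x_def)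

text \<open>
  This is order zero: since \<open>t ^ 0 = 1\<close> also for \<open>t = 0\<close>, a function of order zero takes the same value
  at every \<open>x\<close> as at the origin.
\<close>

definition independent_of_x :: "(point \<Rightarrow> real) \<Rightarrow> bool" where
  "independent_of_x F \<longleftrightarrow> (\<forall>h z z'. F (h, z) = F (h, z'))"

fun free_index :: "letter list + letter list \<Rightarrow> bool" where
  "free_index (Inl xs) = free_of_x xs"
| "free_index (Inr xs) = free_of_x xs"

fun free_pair_index :: "letter list + letter list \<times> letter list \<Rightarrow> bool" where
  "free_pair_index (Inl xs) = free_of_x xs"
| "free_pair_index (Inr (xs, ys)) = (free_of_x xs \<and> free_of_x ys)"

text \<open>
  A monomial containing \<open>z\<close> or its conjugate vanishes at \<open>z = 0\<close>, so a nonzero generator built from it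
  does depend on \<open>x\<close>.
\<close>

lemma independent_of_x_iff_free:
  assumes "F \<noteq> (\<lambda>_. 0)" "free \<Longrightarrow> independent_of_x F" "\<And>h. \<not> free \<Longrightarrow> F (h, 0) = 0"
  shows "independent_of_x F \<longleftrightarrow> free"
proof
  assume ind: "independent_of_x F"
  show free
  proof (rule ccontr)
    assume "\<not> free"
    have "F p = 0" for p
    proof -
      obtain h z where p: "p = (h, z)" by (cases p)
      then have "F p = F (h, 0)" using ind unfolding independent_of_x_def by blast
      then show ?thesis using assms(3) \<open>\<not> free\<close> by simp
    qed
    with assms(1) show False by (auto simp: fun_eq_iff)
  qed
qed (rule assms(2))

lemma SO2_generator_free:
  assumes "i \<in> SO2_indices"
  shows "independent_of_x (SO2_generator i) \<longleftrightarrow> free_index i"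
proof (rule independent_of_x_iff_free)
  show "SO2_generator i \<noteq> (\<lambda>_. 0)"
    by (rule separated_imp_inj_and_minimal(3)[of SO2_indices SO2_generator, OF SO2_separated assms])
  show "free_index i \<Longrightarrow> independent_of_x (SO2_generator i)"
    unfolding independent_of_x_def SO2_generator_def using ev_free
    by (cases i) (simp_all add: re_fun_def im_fun_def, metis+)
  show "SO2_generator i (h, 0) = 0" if "\<not> free_index i" for h
    using that ev_not_free by (cases i) (simp_all add: SO2_generator_def re_fun_def im_fun_def)
qed

lemma O2_generator_free:
  assumes "i \<in> O2_indices"
  shows "independent_of_x (O2_generator i) \<longleftrightarrow> free_pair_index i"
proof (rule independent_of_x_iff_free)
  show "O2_generator i \<noteq> (\<lambda>_. 0)"
    by (rule separated_imp_inj_and_minimal(3)[of O2_indices O2_generator, OF O2_separated assms])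
  show "free_pair_index i \<Longrightarrow> independent_of_x (O2_generator i)"
    unfolding independent_of_x_def O2_generator_def using ev_free
    by (cases i rule: free_pair_index.cases) (simp_all add: re_fun_def im_prod_fun_def, metis+)
  show "O2_generator i (h, 0) = 0" if "\<not> free_pair_index i" for h
    using that ev_not_free[where h = h]
    by (cases i rule: free_pair_index.cases) (auto simp: O2_generator_def re_fun_def im_prod_fun_def)
qed

lemma filter_free_lengths:
  "length (filter free_of_x generator_monomials) = 65" "length (filter free_of_x nonreal_monomials) = 56"
  "length (filter (\<lambda>(xs, ys). free_of_x xs \<and> free_of_x ys) im_pairs) = 6"
  "length generator_monomials = 108" "length nonreal_monomials = 98" "length im_pairs = 15"
  unfolding generator_monomials_list nonreal_monomials_def im_pairs_def free_of_x_def by simp_all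

lemma card_filter_set: "distinct xs \<Longrightarrow> card {x \<in> set xs. P x} = length (filter P xs)"
  by (metis distinct_card distinct_filter set_filter)

lemma card_indices:
  "card SO2_indices = 206" "card {i \<in> SO2_indices. free_index i} = 121"
  "card O2_indices = 123" "card {i \<in> O2_indices. free_pair_index i} = 71"
proof -
  note dist = distinct_generator_monomials distinct_im_pairs
  have "{i \<in> SO2_indices. free_index i} = {xs \<in> set generator_monomials. free_of_x xs} <+> {xs \<in> set nonreal_monomials. free_of_x xs}"
    by (auto simp: SO2_indices_def)
  then show "card {i \<in> SO2_indices. free_index i} = 121"
    using dist filter_free_lengths by (simp add: card_Plus card_filter_set)
  have "{i \<in> O2_indices. free_pair_index i} = {xs \<in> set generator_monomials. free_of_x xs}
      <+> {pr \<in> set im_pairs. (\<lambda>(xs, ys). free_of_x xs \<and> free_of_x ys) pr}"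
    by (auto simp: O2_indices_def)
  moreover have "card {xs \<in> set generator_monomials. free_of_x xs} = 65"
    using dist filter_free_lengths by (simp add: card_filter_set)
  moreover have "card {pr \<in> set im_pairs. (\<lambda>(xs, ys). free_of_x xs \<and> free_of_x ys) pr} = 6"
    unfolding card_filter_set[OF distinct_im_pairs] by (rule filter_free_lengths)
  moreover have "finite {xs \<in> set generator_monomials. free_of_x xs}"
    "finite {pr \<in> set im_pairs. (\<lambda>(xs, ys). free_of_x xs \<and> free_of_x ys) pr}" by simp_all
  ultimately show "card {i \<in> O2_indices. free_pair_index i} = 71" by (simp only: card_Plus)
  show "card SO2_indices = 206" "card O2_indices = 123"
    using dist filter_free_lengths by (simp_all add: SO2_indices_def O2_indices_def card_Plus distinct_card)
qed

lemma basic_covariants_eq: "basic_covariants = map re_fun basic_monomials"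
  by (simp add: basic_covariants_def basic_monomials_def re_fun_def[abs_def] fun_eq_iff)

lemma monomials_eq: "monomials = map (\<lambda>xs. ev (mset xs)) nonreal_monomials"
  unfolding monomials_def monomials0_def monomials1_def monomials2_def monomials3_def monomials4_def
    nonreal_monomials_def
  by (simp add: fun_eq_iff numeral_eq_Suc mult.assoc)

lemma im_products_eq: "im_products = map im_prod_fun im_pairs"
  by (simp add: im_products_def im_pairs_def im_prod_fun_def power2_eq_square mult.assoc fun_eq_iff)

lemma set_SO2_covariants: "set SO2_covariants = SO2_generators"
  unfolding SO2_covariants_def SO2_generators_def monomials_eq basic_covariants_eq generator_monomials_def
  by (auto simp: re_fun_def[abs_def] im_fun_def[abs_def])

lemma set_O2_covariants: "set O2_covariants = O2_generators"
  unfolding O2_covariants_def O2_generators_def monomials_eq basic_covariants_eq im_products_eq generator_monomials_def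
  by (auto simp: re_fun_def[abs_def])

abbreviation homogeneous :: "(point \<Rightarrow> real) \<Rightarrow> bool" where
  "homogeneous \<equiv> homogeneous_on UNIV"

lemma homogeneous_re_im: "homogeneous (re_fun xs)" "homogeneous (im_fun xs)" "homogeneous (im_prod_fun pr)"
proof -
  show "homogeneous (re_fun xs)" "homogeneous (im_fun xs)"
    using homogeneous_Re homogeneous_Im by (auto simp: homogeneous_on_def re_fun_def im_fun_def)
  show "homogeneous (im_prod_fun pr)"
    unfolding homogeneous_on_def im_prod_fun_def
    by (intro exI[of _ "size (mset (fst pr)) + size (mset (snd pr))"])
      (simp add: case_prod_beta homogeneous_Im power_add del: size_mset)
qed

lemma minimal_integrity_basis_in_coordinates:
  assumes dec: "harmonic_decomposition \<Phi>" and fin: "finite I"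
    and hom: "\<And>i. i \<in> I \<Longrightarrow> homogeneous (F i)"
    and sep: "\<And>i. i \<in> I \<Longrightarrow> \<exists>Q. subalgebra Q \<and> F ` (I - {i}) \<subseteq> Q \<and> F i \<notin> Q"
  shows "minimal_integrity_basis triplet_space (in_coordinates \<Phi> ` alg (F ` I)) (in_coordinates \<Phi> ` F ` I)"
    and "card (in_coordinates \<Phi> ` F ` I) = card I"
    and "card {f \<in> in_coordinates \<Phi> ` F ` I. has_order VV 0 f} = card {i \<in> I. independent_of_x (F i)}"
proof -
  note inj = inj_in_coordinates[OF dec] and gen = generated_algebra_in_coordinates[OF dec]
  have sepI: "inj_on F I" "\<And>T. T \<subset> F ` I \<Longrightarrow> alg T \<noteq> alg (F ` I)"
    using separated_imp_inj_and_minimal[of I F] sep by blast+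
  have homogeneous: "homogeneous_on triplet_space (in_coordinates \<Phi> (F i))" if i: "i \<in> I" for i
  proof -
    obtain d where "\<forall>p t. F i (t *\<^sub>R p) = t ^ d * F i p" using hom[OF i] by (auto simp: homogeneous_on_def)
    then show ?thesis
      unfolding homogeneous_on_def
      by (intro exI[of _ d] ballI allI)
        (simp only: in_coordinates_apply triplet_space_closed[OF dec] coordinates_scale[OF dec])
  qed
  have minimal: "generated_algebra triplet_space T \<noteq> in_coordinates \<Phi> ` alg (F ` I)"
    if T: "T \<subset> in_coordinates \<Phi> ` F ` I" for T
  proof -
    obtain T' where T': "T = in_coordinates \<Phi> ` T'" "T' \<subseteq> F ` I" using T by (meson psubset_imp_subset subset_imageE)
    then have "T' \<subset> F ` I" using T by blast
    then have "alg T' \<noteq> alg (F ` I)" by (rule sepI(2))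
    then show ?thesis using inj by (simp add: T'(1) gen inj_image_eq_iff)
  qed
  show "minimal_integrity_basis triplet_space (in_coordinates \<Phi> ` alg (F ` I)) (in_coordinates \<Phi> ` F ` I)"
    unfolding minimal_integrity_basis_def integrity_basis_def
  proof (intro conjI allI impI)
    show "finite (in_coordinates \<Phi> ` F ` I)" using fin by simp
    show "in_coordinates \<Phi> ` F ` I \<subseteq> in_coordinates \<Phi> ` alg (F ` I)"
      by (intro image_mono subsetI generated_algebra.gen)
    show "\<forall>f\<in>in_coordinates \<Phi> ` F ` I. homogeneous_on triplet_space f" using homogeneous by blast
    show "generated_algebra triplet_space (in_coordinates \<Phi> ` F ` I) = in_coordinates \<Phi> ` alg (F ` I)" by (rule gen)
    show "generated_algebra triplet_space T \<noteq> in_coordinates \<Phi> ` alg (F ` I)"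
      if "T \<subset> in_coordinates \<Phi> ` F ` I" for T using that by (rule minimal)
  qed
  have inj_all: "inj_on (\<lambda>i. in_coordinates \<Phi> (F i)) I"
    using sepI(1) inj by (auto simp: inj_on_def)
  then show "card (in_coordinates \<Phi> ` F ` I) = card I" by (simp add: image_image card_image)
  have "has_order VV 0 (in_coordinates \<Phi> G) \<longleftrightarrow> independent_of_x G" for G
  proof -
    have surj: "\<exists>v\<in>VV. \<Phi> v = h" for h
      using dec unfolding harmonic_decomposition_def bij_betw_def by (metis UNIV_I imageE)
    have Complex_surj: "\<exists>x :: real^2. Complex (x$1) (x$2) = z" for z
      by (intro exI[of _ "vector [Re z, Im z]"]) simp
    have "has_order VV 0 (in_coordinates \<Phi> G)
        \<longleftrightarrow> (\<forall>v\<in>VV. \<forall>(x::real^2) t. G (\<Phi> v, Complex (t * x$1) (t * x$2)) = G (\<Phi> v, Complex (x$1) (x$2)))"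
      by (simp add: has_order_def in_coordinates_def)
    also have "\<dots> \<longleftrightarrow> (\<forall>h z t. G (h, of_real t * z) = G (h, z))"
    proof (intro iffI allI ballI)
      fix h z t assume *: "\<forall>v\<in>VV. \<forall>(x::real^2) t. G (\<Phi> v, Complex (t * x$1) (t * x$2)) = G (\<Phi> v, Complex (x$1) (x$2))"
      obtain v where "v \<in> VV" "\<Phi> v = h" using surj by blast
      moreover obtain x :: "real^2" where "Complex (x$1) (x$2) = z" using Complex_surj by blast
      moreover from this have "Complex (t * x$1) (t * x$2) = of_real t * z" by (auto simp: complex_eq_iff)
      ultimately show "G (h, of_real t * z) = G (h, z)" using * by metis
    next
      fix v t and x :: "real^2" assume *: "\<forall>h z t. G (h, of_real t * z) = G (h, z)"
      have "Complex (t * x$1) (t * x$2) = of_real t * Complex (x$1) (x$2)" for x :: "real^2" by (simp add: complex_eq_iff)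
      then show "G (\<Phi> v, Complex (t * x$1) (t * x$2)) = G (\<Phi> v, Complex (x$1) (x$2))" using * by metis
    qed
    also have "\<dots> \<longleftrightarrow> independent_of_x G"
      unfolding independent_of_x_def by (metis mult_zero_left of_real_0)
    finally show ?thesis .
  qed
  then have "{f \<in> in_coordinates \<Phi> ` F ` I. has_order VV 0 f} = (\<lambda>i. in_coordinates \<Phi> (F i)) ` {i \<in> I. independent_of_x (F i)}"
    by auto
  then show "card {f \<in> in_coordinates \<Phi> ` F ` I. has_order VV 0 f} = card {i \<in> I. independent_of_x (F i)}"
    using inj_on_subset[OF inj_all] by (simp add: card_image)
qed

theorem theorem8p12:
  fixes \<Phi> :: "triplet \<Rightarrow> harm"
  assumes "harmonic_decomposition \<Phi>"
  shows
    "(let B = in_coordinates \<Phi> ` set SO2_covariants in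
        minimal_integrity_basis (VV \<times> UNIV) (Cov actV VV SO2) B \<and>
        card B = 206 \<and> card {f \<in> B. has_order VV 0 f} = 121) \<and>
     (let B = in_coordinates \<Phi> ` set O2_covariants in
        minimal_integrity_basis (VV \<times> UNIV) (Cov actV VV O2) B \<and>
        card B = 123 \<and> card {f \<in> B. has_order VV 0 f} = 71)"
proof -
  have finite: "finite SO2_indices" "finite O2_indices" by (simp_all add: SO2_indices_def O2_indices_def)
  have hom: "homogeneous (SO2_generator i)" "homogeneous (O2_generator j)" for i j
    using homogeneous_re_im by (auto simp: SO2_generator_def O2_generator_def split: sum.split)
  have free: "{i \<in> SO2_indices. independent_of_x (SO2_generator i)} = {i \<in> SO2_indices. free_index i}"
    "{i \<in> O2_indices. independent_of_x (O2_generator i)} = {i \<in> O2_indices. free_pair_index i}"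
    using SO2_generator_free O2_generator_free by auto
  note SO2 = minimal_integrity_basis_in_coordinates[OF assms finite(1) hom(1) SO2_separated]
  note O2 = minimal_integrity_basis_in_coordinates[OF assms finite(2) hom(2) O2_separated]
  show ?thesis
    unfolding Let_def set_SO2_covariants set_O2_covariants Cov_SO2[OF assms] Cov_O2[OF assms]
      alg_SO2_generators[symmetric] alg_O2_generators[symmetric] SO2_generators_eq O2_generators_eq
    using SO2 O2 by (simp only: free card_indices)
qed

end
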